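(* Let $(\bar u,\bar\mu)\in\mathcal D$ and let $(u(t),\mu(t))$ be a conservative solution of the generalized Hunter–Saxton system subject to the initial data $(\bar u,\bar\mu)$. Then for every $x\in\mathbb R$ the following limits exist and are given by $$v(x):=\lim_{t\to\pm\infty}\frac{2}{t}\,u\!\left(\frac{t^2}{4}x,t\right)=\begin{cases}0,& x<0,\\ x,& 0\le x\le\bar\mu(\mathbb R),\\ \bar\mu(\mathbb R),& x>\bar\mu(\mathbb R).\end{cases}$$ Furthermore, the following asymptotic expansions hold: $$u(x,t)=\frac t2\,v\!\left(\frac{4x}{t^2}\right)+o(t)\quad\text{in }L^\infty(\mathbb R),\qquad\text{as }t\to\pm\infty,$$ and $$u_x(x,t)=\partial_x\!\left[\frac t2\,v\!\left(\frac{4x}{t^2}\right)\right]+o(1)\quad\text{in }L^2(\mathbb R),\qquad\text{as }t\to\pm\infty.$$ As a consequence, also $$\lim_{t\to\pm\infty}\mu_s(t)(\mathbb R)=0,$$ where $\mu_s(t)$ is the singular part of the energy measure $\mu(t)$ with respect to the Lebesgue measure.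
   Context: Notation. $C_b(\mathbb R)$ is the space of bounded continuous functions on $\mathbb R$ with the sup-norm; $\mathcal M_+(\mathbb R)$ is the set of finite nonnegative Radon measures on $\mathbb R$ endowed with the weak topology. The space $\mathcal D$ is the set of all pairs $(u,\mu)$ such that (i) $u\in C_b(\mathbb R)$ and $u_x\in L^2(\mathbb R)$; (ii) $\mu\in\mathcal M_+(\mathbb R)$; (iii) $d\mu_{ac}=u_x^2\,dx$, where $\mu_{ac}$ is the absolutely continuous part of $\mu$ with respect to Lebesgue measure $dx$. Generalized Hunter–Saxton system: for $x,t\in\mathbb R$, $$u_t+uu_x=\tfrac12\int_{-\infty}^x d\mu(t),\qquad \mu_t+(u\mu)_x=0,\qquad d\mu_{ac}(t)=u_x^2(x,t)\,dx.$$ Conservative solution. Given $(\bar u,\bar\mu)\in\mathcal D$, a pair $(u(t),\mu(t))$, $t\in\mathbb R$, is a (global-in-time) conservative solution with initial data $(\bar u,\bar\mu)$ if: (i) $u\in C(\mathbb R;C_b(\mathbb R))\cap C^{1/2}_{loc}(\mathbb R\times\mathbb R)$, $u_t\in L^2_{loc}(\mathbb R\times\mathbb R)$, $u_x(\cdot,t)\in L^2(\mathbb R)$ for all $t\in\mathbb R$, and $\mu\in C(\mathbb R;\mathcal M_+(\mathbb R))$; (ii) $(u(\cdot,0),\mu(0))=(\bar u,\bar\mu)$, and $d\mu(t)=u_x^2(x,t)\,dx$ for a.e. $t\in\mathbb R$; (iii) for all $\phi\in C_c^\infty(\mathbb R\times\mathbb R)$, $\int_{\mathbb R}\int_{\mathbb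 R}u\phi_t-\phi\left(uu_x-\tfrac12F\right)dx\,dt=0$, where $F(x,t):=\int_{-\infty}^x d\mu(t)$; (iv) for all $\phi\in C_c^\infty(\mathbb R\times\mathbb R)$, $\int_{\mathbb R}\int_{\mathbb R}(\phi_t+u\phi_x)\,d\mu(t)\,dt=0$; (v) $d\mu_{ac}(t)=u_x^2(x,t)\,dx$ for all $t\in\mathbb R$. A statement "$g(x,t)=h(x,t)+o(\rho(t))$ in $X$ as $t\to\pm\infty$" means $\|g(\cdot,t)-h(\cdot,t)\|_X/|\rho(t)|\to0$ as $t\to+\infty$ and as $t\to-\infty$. *)

theory Defs
  imports "HOL-Analysis.Analysis" "HOL-Probability.Probability"
begin

section \<open>Test functions and weak derivatives\<close>

fun Ck :: "nat \<Rightarrow> ('a::euclidean_space \<Rightarrow> real) \<Rightarrow> bool" where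
  "Ck 0 f \<longleftrightarrow> continuous_on UNIV f"
| "Ck (Suc k) f \<longleftrightarrow>
     (\<forall>x. f differentiable (at x)) \<and> (\<forall>b. Ck k (\<lambda>x. frechet_derivative f (at x) b))"

definition test_function :: "('a::euclidean_space \<Rightarrow> real) \<Rightarrow> bool" where
  "test_function \<phi> \<longleftrightarrow> (\<forall>k. Ck k \<phi>) \<and> compact (closure {x. \<phi> x \<noteq> 0})"

definition dir_deriv :: "'a::euclidean_space \<Rightarrow> ('a \<Rightarrow> real) \<Rightarrow> 'a \<Rightarrow> real" where
  "dir_deriv b \<phi> x = frechet_derivative \<phi> (at x) b"

text \<open>Functions on the space-time plane take the pair \<open>(x, t)\<close> as argument.\<close>

abbreviation D_x :: "(real \<times> real \<Rightarrow> real) \<Rightarrow> real \<times> real \<Rightarrow> real" where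
  "D_x \<equiv> dir_deriv (1, 0)"

abbreviation D_t :: "(real \<times> real \<Rightarrow> real) \<Rightarrow> real \<times> real \<Rightarrow> real" where
  "D_t \<equiv> dir_deriv (0, 1)"

definition L1_loc :: "('a::euclidean_space \<Rightarrow> real) set" where
  "L1_loc = {f \<in> borel_measurable borel. \<forall>K. compact K \<longrightarrow> set_integrable lborel K f}"

definition L2_loc :: "('a::euclidean_space \<Rightarrow> real) set" where
  "L2_loc = {f \<in> borel_measurable borel.
     \<forall>K. compact K \<longrightarrow> set_integrable lborel K (\<lambda>x. (f x)\<^sup>2)}"

definition has_weak_deriv ::
  "'a::euclidean_space \<Rightarrow> ('a \<Rightarrow> real) \<Rightarrow> ('a \<Rightarrow> real) \<Rightarrow> bool" where
  "has_weak_deriv b f g \<longleftrightarrow> f \<in> L1_loc \<and> g \<in> L1_loc \<and>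
     (\<forall>\<phi>. test_function \<phi> \<longrightarrow>
        (LINT x|lborel. f x * dir_deriv b \<phi> x) = - (LINT x|lborel. g x * \<phi> x))"

text \<open>A representative of the weak derivative on the line, which is determined up to a
  Lebesgue null set. It is meaningful only if a weak derivative exists.\<close>

definition weak_deriv :: "(real \<Rightarrow> real) \<Rightarrow> real \<Rightarrow> real" where
  "weak_deriv f = (SOME g. has_weak_deriv 1 f g)"


section \<open>Norms and asymptotic expansions\<close>

definition L2 :: "(real \<Rightarrow> real) set" where
  "L2 = {f \<in> borel_measurable borel. integrable lborel (\<lambda>x. (f x)\<^sup>2)}"

definition norm_L2 :: "(real \<Rightarrow> real) \<Rightarrow> real" where
  "norm_L2 f = sqrt (LINT x|lborel. (f x)\<^sup>2)"

definition Linfty :: "(real \<Rightarrow> real) set" where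
  "Linfty = {f \<in> borel_measurable borel. esssup lborel (\<lambda>x. ereal \<bar>f x\<bar>) < \<infinity>}"

definition norm_Linfty :: "(real \<Rightarrow> real) \<Rightarrow> real" where
  "norm_Linfty f = real_of_ereal (esssup lborel (\<lambda>x. ereal \<bar>f x\<bar>))"

text \<open>\<open>expansion X nrm g h \<rho>\<close> says that \<open>g(x,t) = h(x,t) + o(\<rho>(t))\<close> in the normed space
  \<open>(X, nrm)\<close> as \<open>t\<close> tends to plus infinity and as \<open>t\<close> tends to minus infinity. Membership of
  the difference in \<open>X\<close> is required because \<open>nrm\<close> has a junk value outside \<open>X\<close>.\<close>

definition expansion ::
  "(real \<Rightarrow> real) set \<Rightarrow> ((real \<Rightarrow> real) \<Rightarrow> real) \<Rightarrow>
   (real \<Rightarrow> real \<Rightarrow> real) \<Rightarrow> (real \<Rightarrow> real \<Rightarrow> real) \<Rightarrow> (real \<Rightarrow> real) \<Rightarrow> bool" where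
  "expansion X nrm g h \<rho> \<longleftrightarrow>
     (\<forall>F\<in>{at_top, at_bot}.
        (\<forall>\<^sub>F t in F. (\<lambda>x. g x t - h x t) \<in> X) \<and>
        ((\<lambda>t. nrm (\<lambda>x. g x t - h x t) / \<bar>\<rho> t\<bar>) \<longlongrightarrow> 0) F)"


section \<open>Lebesgue decomposition\<close>

definition singular_lborel :: "real measure \<Rightarrow> bool" where
  "singular_lborel \<sigma> \<longleftrightarrow> (\<exists>N\<in>null_sets lborel. emeasure \<sigma> (- N) = 0)"

definition lebesgue_decomposition ::
  "real measure \<Rightarrow> real measure \<Rightarrow> real measure \<Rightarrow> bool" where
  "lebesgue_decomposition \<mu> \<alpha> \<sigma> \<longleftrightarrow>
     sets \<alpha> = sets borel \<and> sets \<sigma> = sets borel \<and>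
     absolutely_continuous lborel \<alpha> \<and> singular_lborel \<sigma> \<and>
     (\<forall>A\<in>sets borel. emeasure \<mu> A = emeasure \<alpha> A + emeasure \<sigma> A)"

definition ac_part :: "real measure \<Rightarrow> real measure" where
  "ac_part \<mu> = (THE \<alpha>. \<exists>\<sigma>. lebesgue_decomposition \<mu> \<alpha> \<sigma>)"

definition sing_part :: "real measure \<Rightarrow> real measure" where
  "sing_part \<mu> = (THE \<sigma>. \<exists>\<alpha>. lebesgue_decomposition \<mu> \<alpha> \<sigma>)"

text \<open>Uniqueness and existence of the decomposition, so that \<open>ac_part\<close> and \<open>sing_part\<close> of a
  finite Borel measure are what they should be.\<close>

lemma lebesgue_decomposition_unique:
  assumes "lebesgue_decomposition \<mu> \<alpha> \<sigma>" "lebesgue_decomposition \<mu> \<alpha>' \<sigma>'"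
  shows "\<alpha> = \<alpha>'" "\<sigma> = \<sigma>'"
proof -
  have loc: "\<exists>N\<in>null_sets lborel. \<forall>M\<in>null_sets lborel. N \<subseteq> M \<longrightarrow>
      (\<forall>A\<in>sets borel. emeasure \<sigma> A = emeasure \<mu> (A \<inter> M) \<and> emeasure \<alpha> A = emeasure \<mu> (A - M))"
    if D: "lebesgue_decomposition \<mu> \<alpha> \<sigma>" for \<alpha> \<sigma>
  proof -
    note d = D[unfolded lebesgue_decomposition_def]
    obtain N where N: "N \<in> null_sets lborel" "emeasure \<sigma> (- N) = 0"
      using d by (auto simp: singular_lborel_def)
    have "emeasure \<sigma> A = emeasure \<mu> (A \<inter> M) \<and> emeasure \<alpha> A = emeasure \<mu> (A - M)"
      if M: "M \<in> null_sets lborel" "N \<subseteq> M" and A: "A \<in> sets borel" for M A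
    proof -
      have [measurable]: "A \<in> sets borel" "M \<in> sets borel" "N \<in> sets borel"
        using M(1) N(1) A by (auto simp: null_sets_def)
      have "A \<inter> M \<in> null_sets lborel"
        using M(1) by (metis A Int_commute null_set_Int2 sets_lborel)
      hence "A \<inter> M \<in> null_sets \<alpha>"
        using d unfolding absolutely_continuous_def by blast
      hence a0: "emeasure \<alpha> (A \<inter> M) = 0" by auto
      have "emeasure \<sigma> (A - M) \<le> emeasure \<sigma> (- N)"
        using M(2) d by (intro emeasure_mono) auto
      hence s0: "emeasure \<sigma> (A - M) = 0" using N(2) by simp
      have split: "A = (A \<inter> M) \<union> (A - M)" by auto
      have "emeasure \<sigma> A = emeasure \<sigma> (A \<inter> M) + emeasure \<sigma> (A - M)"
        by (subst split, subst plus_emeasure[symmetric]) (use d in auto)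
      moreover have "emeasure \<alpha> A = emeasure \<alpha> (A \<inter> M) + emeasure \<alpha> (A - M)"
        by (subst split, subst plus_emeasure[symmetric]) (use d in auto)
      ultimately show ?thesis using a0 s0 d by simp
    qed
    thus ?thesis using N(1) by blast
  qed
  obtain N where N: "N \<in> null_sets lborel" "\<forall>M\<in>null_sets lborel. N \<subseteq> M \<longrightarrow>
      (\<forall>A\<in>sets borel. emeasure \<sigma> A = emeasure \<mu> (A \<inter> M) \<and> emeasure \<alpha> A = emeasure \<mu> (A - M))"
    using loc[OF assms(1)] by blast
  obtain N' where N': "N' \<in> null_sets lborel" "\<forall>M\<in>null_sets lborel. N' \<subseteq> M \<longrightarrow>
      (\<forall>A\<in>sets borel. emeasure \<sigma>' A = emeasure \<mu> (A \<inter> M) \<and> emeasure \<alpha>' A = emeasure \<mu> (A - M))"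
    using loc[OF assms(2)] by blast
  have M: "N \<union> N' \<in> null_sets lborel" using N(1) N'(1) by (rule null_sets.Un)
  have sets: "sets \<alpha> = sets borel" "sets \<alpha>' = sets borel" "sets \<sigma> = sets borel" "sets \<sigma>' = sets borel"
    using assms by (auto simp: lebesgue_decomposition_def)
  show "\<alpha> = \<alpha>'"
    by (rule measure_eqI) (use sets N(2) N'(2) M in auto)
  show "\<sigma> = \<sigma>'"
    by (rule measure_eqI) (use sets N(2) N'(2) M in auto)
qed

lemma lebesgue_decomposition_exists:
  assumes "finite_borel_measure \<mu>"
  shows "\<exists>\<alpha> \<sigma>. lebesgue_decomposition \<mu> \<alpha> \<sigma>"
proof -
  interpret finite_borel_measure \<mu> by fact
  define S where "S = (SUP N\<in>null_sets lborel. emeasure \<mu> N)"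
  obtain f :: "nat \<Rightarrow> ennreal" where f: "range f \<subseteq> emeasure \<mu> ` null_sets lborel" "S = (SUP i. f i)"
    unfolding S_def using ennreal_SUP_countable_SUP[of "null_sets lborel" "emeasure \<mu>"]
    by (metis empty_iff null_sets.empty_sets)
  have "\<exists>M. M \<in> null_sets lborel \<and> f i = emeasure \<mu> M" for i using f(1) by blast
  then obtain g where g: "\<And>i. g i \<in> null_sets lborel" "\<And>i. f i = emeasure \<mu> (g i)"
    by metis
  define N where "N = (\<Union>i. g i)"
  have N: "N \<in> null_sets lborel" unfolding N_def using g by auto
  hence Nb [measurable]: "N \<in> sets borel" by auto
  have im: "indicator (- N) \<in> borel_measurable \<mu>" "indicator N \<in> borel_measurable \<mu>"
    using Nb by (auto intro!: borel_measurable_indicator simp: M_is_borel)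
  have "f i \<le> emeasure \<mu> N" for i
    unfolding g N_def using Nb g by (intro emeasure_mono) (auto simp: M_is_borel N_def)
  hence "S \<le> emeasure \<mu> N" unfolding f by (intro SUP_least)
  hence max: "emeasure \<mu> M \<le> emeasure \<mu> N" if "M \<in> null_sets lborel" for M
    using that unfolding S_def by (meson SUP_upper order_trans)
  define \<alpha> where "\<alpha> = density \<mu> (indicator (- N))"
  define \<sigma> where "\<sigma> = density \<mu> (indicator N)"
  have a: "emeasure \<alpha> A = emeasure \<mu> (A - N)" if "A \<in> sets borel" for A
    unfolding \<alpha>_def using that Nb im
    by (subst emeasure_density)
       (auto simp: M_is_borel Diff_eq Int_commute simp flip: indicator_inter_arith)
  have s: "emeasure \<sigma> A = emeasure \<mu> (A \<inter> N)" if "A \<in> sets borel" for A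
    unfolding \<sigma>_def using that Nb im
    by (subst emeasure_density)
       (auto simp: M_is_borel Int_commute simp flip: indicator_inter_arith)
  have "emeasure \<mu> (A - N) = 0" if A: "A \<in> null_sets lborel" for A
  proof -
    have "emeasure \<mu> N + emeasure \<mu> (A - N) = emeasure \<mu> (N \<union> A)"
      using A Nb by (subst plus_emeasure) (auto simp: M_is_borel)
    also have "\<dots> \<le> emeasure \<mu> N" using A N by (intro max) auto
    finally show ?thesis
      by (metis add.right_neutral emeasure_finite ennreal_add_left_cancel_le infinity_ennreal_def
          le_zero_eq)
  qed
  moreover have "sets \<alpha> = sets borel" by (simp add: \<alpha>_def M_is_borel)
  ultimately have "absolutely_continuous lborel \<alpha>"
    unfolding absolutely_continuous_def null_sets_def[of \<alpha>]
    using a by (auto simp: null_sets_def)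
  moreover have "singular_lborel \<sigma>"
    unfolding singular_lborel_def using N s[of "- N"] by auto
  moreover have "emeasure \<mu> A = emeasure \<alpha> A + emeasure \<sigma> A" if "A \<in> sets borel" for A
  proof -
    have "emeasure \<mu> (A - N) + emeasure \<mu> (A \<inter> N) = emeasure \<mu> ((A - N) \<union> (A \<inter> N))"
      by (rule plus_emeasure) (use that Nb in \<open>auto simp: M_is_borel\<close>)
    also have "(A - N) \<union> (A \<inter> N) = A" by auto
    finally show ?thesis using that by (simp add: a s)
  qed
  ultimately have "lebesgue_decomposition \<mu> \<alpha> \<sigma>"
    unfolding lebesgue_decomposition_def by (auto simp: \<alpha>_def \<sigma>_def M_is_borel)
  thus ?thesis by blast
qed

lemma lebesgue_decomposition_parts:
  assumes "finite_borel_measure \<mu>"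
  shows "lebesgue_decomposition \<mu> (ac_part \<mu>) (sing_part \<mu>)"
proof -
  obtain \<alpha> \<sigma> where d: "lebesgue_decomposition \<mu> \<alpha> \<sigma>"
    using lebesgue_decomposition_exists[OF assms] by blast
  have "ac_part \<mu> = \<alpha>" unfolding ac_part_def
    using d lebesgue_decomposition_unique(1)[OF _ d] by (intro the_equality) blast+
  moreover have "sing_part \<mu> = \<sigma>" unfolding sing_part_def
    using d lebesgue_decomposition_unique(2)[OF _ d] by (intro the_equality) blast+
  ultimately show ?thesis using d by simp
qed


section \<open>The generalized Hunter--Saxton system\<close>

definition deriv_in_L2 :: "(real \<Rightarrow> real) \<Rightarrow> bool" where
  "deriv_in_L2 f \<longleftrightarrow> (\<exists>g\<in>L2. has_weak_deriv 1 f g)"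

definition energy_density :: "(real \<Rightarrow> real) \<Rightarrow> real measure" where
  "energy_density f = density lborel (\<lambda>x. ennreal ((weak_deriv f x)\<^sup>2))"

text \<open>On the real line every finite Borel measure is Radon, so the finite nonnegative Radon
  measures are given by \<open>finite_borel_measure\<close>.\<close>

definition \<D> :: "((real \<Rightarrow>\<^sub>C real) \<times> real measure) set" where
  "\<D> = {(u :: real \<Rightarrow>\<^sub>C real, \<mu>). deriv_in_L2 u \<and> finite_borel_measure \<mu>
     \<and> ac_part \<mu> = energy_density u}"

text \<open>Continuity of a curve of measures for the weak topology, the initial topology of the maps
  \<open>\<mu> \<mapsto> \<integral> f d\<mu>\<close> with \<open>f\<close> bounded and continuous.\<close>

definition weakly_continuous :: "(real \<Rightarrow> real measure) \<Rightarrow> bool" where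
  "weakly_continuous \<mu> \<longleftrightarrow>
     (\<forall>f :: real \<Rightarrow>\<^sub>C real. continuous_on UNIV (\<lambda>t. LINT x|\<mu> t. f x))"

definition locally_half_holder :: "(real \<times> real \<Rightarrow> real) \<Rightarrow> bool" where
  "locally_half_holder f \<longleftrightarrow>
     (\<forall>K. compact K \<longrightarrow> (\<exists>C. \<forall>p\<in>K. \<forall>q\<in>K. \<bar>f p - f q\<bar> \<le> C * sqrt (dist p q)))"

text \<open>In the two weak formulations the integrals are iterated ones. The inner integrands are
  integrable and the outer ones are continuous in \<open>t\<close> with compact support, by the regularity
  conditions that come before them. An integral over the plane would depend on a choice of
  representatives of the spatial derivative that is jointly measurable in \<open>(x, t)\<close>.\<close>

definition conservative_solution ::
  "(real \<Rightarrow>\<^sub>C real) \<Rightarrow> real measure \<Rightarrow> (real \<Rightarrow> (real \<Rightarrow>\<^sub>C real)) \<Rightarrow> (real \<Rightarrow> real measure) \<Rightarrow> bool"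
where
  "conservative_solution ubar \<mu>bar u \<mu> \<longleftrightarrow>
     continuous_on UNIV u \<and>
     locally_half_holder (\<lambda>(x, t). u t x) \<and>
     (\<exists>w\<in>L2_loc. has_weak_deriv (0, 1) (\<lambda>(x, t). u t x) w) \<and>
     (\<forall>t. deriv_in_L2 (u t)) \<and>
     (\<forall>t. finite_borel_measure (\<mu> t)) \<and> weakly_continuous \<mu> \<and>
     u 0 = ubar \<and> \<mu> 0 = \<mu>bar \<and>
     (AE t in lborel. \<mu> t = energy_density (u t)) \<and>
     \<comment> \<open>\<open>cdf (\<mu> t) x\<close> is \<open>F(x, t)\<close>\<close>
     (\<forall>\<phi>. test_function \<phi> \<longrightarrow>
        (LINT t|lborel. LINT x|lborel.
           u t x * D_t \<phi> (x, t)
           - \<phi> (x, t) * (u t x * weak_deriv (u t) x - 1/2 * cdf (\<mu> t) x)) = 0) \<and>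
     (\<forall>\<phi>. test_function \<phi> \<longrightarrow>
        (LINT t|lborel. LINT x|\<mu> t. D_t \<phi> (x, t) + u t x * D_x \<phi> (x, t)) = 0) \<and>
     (\<forall>t. ac_part (\<mu> t) = energy_density (u t))"

definition profile :: "real \<Rightarrow> real \<Rightarrow> real" where
  "profile m x = (if x < 0 then 0 else if x \<le> m then x else m)"

end

theory Submission
  imports Defs
begin

text \<open>Let \<open>m\<close> be the total energy, \<open>F t x\<close> the energy to the left of \<open>x\<close> at time \<open>t\<close>, and
\<open>q \<alpha> t\<close> the position that has energy \<open>\<alpha>\<close> to its left, for \<open>0 < \<alpha> < m\<close>. Along the flow of \<open>u\<close> the
energy is transported and \<open>u\<close> has acceleration \<open>F/2\<close>. A quantile curve should therefore be a
characteristic of constant acceleration \<open>\<alpha>/2\<close>: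
\<open>q \<alpha> t = q \<alpha> 0 + u 0 (q \<alpha> 0) t + \<alpha> t\<^sup>2/4\<close> and \<open>u t (q \<alpha> t) = u 0 (q \<alpha> 0) + \<alpha> t/2\<close>.
In the variables \<open>y = 4x/t\<^sup>2\<close> and \<open>2u/t\<close> this says that, up to \<open>O(1/t)\<close>, the quantile \<open>\<alpha>\<close> is at
\<open>y = \<alpha>\<close> and has velocity \<open>\<alpha>\<close>. Where there is no energy, \<open>u\<close> is constant in \<open>x\<close>. So \<open>2u/t\<close>
is uniformly close to \<open>F\<close>, and \<open>F\<close> is uniformly close to the profile (\<open>uniform_asymptotics\<close>).

The two formulas are proved for every conservative solution directly from the weak equations;
that needs some care, since \<open>u\<close> is only Hoelder continuous in \<open>x\<close> and its characteristics need not
be unique. For the position (\<open>q_derivative\<close>), a smoothed step that moves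
faster than the fluid around it cannot lose energy on its left (\<open>F_moving_front\<close>); with
speeds close to \<open>u t (q \<alpha> t)\<close> from above and below this squeezes the difference quotients of
\<open>q \<alpha>\<close>. For the velocity (\<open>u_along_q\<close>), the mean of \<open>u\<close> over \<open>[q, q + \<delta>]\<close> has the time
derivative \<open>- (u(q + \<delta>) - u(q))\<^sup>2/(2\<delta>) + F/2\<close>, with \<open>F\<close> averaged over that interval. By
Cauchy--Schwarz the first term is at most half of the energy between \<open>q\<close> and \<open>q + \<delta>\<close>, which
vanishes as \<open>\<delta> \<rightarrow> 0\<close>, while \<open>F(q) = \<alpha>\<close> at almost every time, since then the energy has no atoms.

The \<open>L\<^sup>2\<close> statement costs nothing more (\<open>energy_distance\<close>). The derivative \<open>p\<close> of the self-similar
profile is \<open>2/t\<close> on \<open>[0, m t\<^sup>2/4]\<close>, so \<open>\<integral> p\<^sup>2 = m\<close>, and \<open>J = \<integral> u\<^sub>x p\<close> is \<open>2/t\<close> times the difference of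
\<open>u\<close> at the two ends, which tends to \<open>m\<close>. Since \<open>\<integral> u\<^sub>x\<^sup>2 + \<mu>\<^sub>s(\<real>) = m\<close>, expanding the square gives
\<open>\<parallel>u\<^sub>x - p\<parallel>\<^sup>2 + \<mu>\<^sub>s(\<real>) = 2 (m - J) \<rightarrow> 0\<close>, and both terms on the left are nonnegative.\<close>

section \<open>Smooth step functions\<close>

lemma Ck_weaken:
  fixes f :: "'a::euclidean_space \<Rightarrow> real"
  shows "Ck (Suc k) f \<Longrightarrow> Ck k f"
proof (induction k arbitrary: f)
  case 0
  then show ?case
    by (auto intro!: continuous_at_imp_continuous_on differentiable_imp_continuous_within)
next
  case (Suc k)
  from Suc.prems have "\<forall>x. f differentiable (at x)" "\<forall>b. Ck (Suc k) (\<lambda>x. frechet_derivative f (at x) b)"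
    by simp_all
  then show ?case using Suc.IH by simp
qed

lemma Ck_const: "Ck k (\<lambda>_::'a::euclidean_space. c)"
  by (induction k arbitrary: c) (auto simp: frechet_derivative_const)

lemma frechet_derivativeI:
  "(f has_derivative D) (at x) \<Longrightarrow> frechet_derivative f (at x) = D"
  using frechet_derivative_at by metis

lemma frechet_worksD: "f differentiable (at x) \<Longrightarrow> (f has_derivative frechet_derivative f (at x)) (at x)"
  by (simp add: frechet_derivative_works)

lemma Ck_add:
  fixes f g :: "'a::euclidean_space \<Rightarrow> real"
  shows "Ck k f \<Longrightarrow> Ck k g \<Longrightarrow> Ck k (\<lambda>x. f x + g x)"
proof (induction k arbitrary: f g)
  case 0
  then show ?case by (auto intro!: continuous_intros)
next
  case (Suc k)
  then have d: "f differentiable (at x)" "g differentiable (at x)" for x by auto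
  have "frechet_derivative (\<lambda>x. f x + g x) (at x) b
     = frechet_derivative f (at x) b + frechet_derivative g (at x) b" for x b
    by (subst frechet_derivativeI[OF has_derivative_add[OF d[THEN frechet_worksD]]]) simp
  then show ?case using Suc d by (auto intro!: differentiable_add)
qed

lemma Ck_mult:
  fixes f g :: "'a::euclidean_space \<Rightarrow> real"
  shows "Ck k f \<Longrightarrow> Ck k g \<Longrightarrow> Ck k (\<lambda>x. f x * g x)"
proof (induction k arbitrary: f g)
  case 0
  then show ?case by (auto intro!: continuous_intros)
next
  case (Suc k)
  then have d: "f differentiable (at x)" "g differentiable (at x)" for x by auto
  have *: "frechet_derivative (\<lambda>x. f x * g x) (at x) b
     = f x * frechet_derivative g (at x) b + frechet_derivative f (at x) b * g x" for x b
    by (subst frechet_derivativeI[OF has_derivative_mult[OF d[THEN frechet_worksD]]]) simp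
  have "Ck k f" "Ck k g" using Suc.prems by (blast intro: Ck_weaken)+
  then show ?case using Suc d unfolding Ck.simps *
    by (auto intro!: differentiable_mult Ck_add)
qed

lemma Ck_inverse:
  fixes f :: "'a::euclidean_space \<Rightarrow> real"
  assumes "\<And>x. f x \<noteq> 0"
  shows "Ck k f \<Longrightarrow> Ck k (\<lambda>x. inverse (f x))"
proof (induction k)
  case 0
  then show ?case using assms by (auto intro!: continuous_intros)
next
  case (Suc k)
  then have d: "f differentiable (at x)" for x by auto
  have *: "((\<lambda>x. inverse (f x)) has_derivative
      (\<lambda>b. (- 1) * (inverse (f x) * frechet_derivative f (at x) b * inverse (f x)))) (at x)" for x
    using Deriv.has_derivative_inverse[OF assms d[THEN frechet_worksD]] by simp
  have "Ck k f" using Suc.prems by (blast intro: Ck_weaken)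
  with Suc have "Ck k (\<lambda>x. (- 1) * (inverse (f x) * frechet_derivative f (at x) b * inverse (f x)))" for b
    by (intro Ck_mult Ck_const) auto
  moreover have "(\<lambda>x. inverse (f x)) differentiable (at x)" for x
    using * by (rule differentiableI)
  ultimately show ?case unfolding Ck.simps frechet_derivativeI[OF *] by simp
qed

lemma Ck_compose_affine:
  fixes f :: "real \<Rightarrow> real" and L :: "'a::euclidean_space \<Rightarrow> real"
  assumes L: "bounded_linear L"
  shows "Ck k f \<Longrightarrow> Ck k (\<lambda>x. f (L x + c))"
proof (induction k arbitrary: f)
  case 0
  have "continuous_on UNIV L" using L by (simp add: linear_continuous_on)
  with 0 show ?case
    by (auto intro!: continuous_intros continuous_on_compose2[of UNIV f])
next
  case (Suc k)
  then have d: "f differentiable (at x)" for x by auto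
  have lin: "frechet_derivative f (at y) r = r * frechet_derivative f (at y) 1" for y r
    using linear_frechet_derivative[OF d, of y] linear_scale[of _ r 1] by force
  have l: "((\<lambda>x. L x + c) has_derivative L) (at x)" for x
    using bounded_linear_imp_has_derivative[OF L] by (auto intro!: derivative_eq_intros)
  have *: "((\<lambda>x. f (L x + c)) has_derivative (\<lambda>b. L b * frechet_derivative f (at (L x + c)) 1)) (at x)" for x
    using has_derivative_compose[OF l d[THEN frechet_worksD]] by (subst (asm) lin) simp
  have "Ck k (\<lambda>x. L b * frechet_derivative f (at (L x + c)) 1)" for b
    using Suc by (intro Ck_mult Ck_const) auto
  moreover have "(\<lambda>x. f (L x + c)) differentiable (at x)" for x
    using * by (rule differentiableI)
  ultimately show ?case unfolding Ck.simps frechet_derivativeI[OF *] by simp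
qed

text \<open>The functions \<open>p(1/x) exp(-1/x)\<close>, extended by zero to \<open>x \<le> 0\<close>. Allowing every polynomial \<open>p\<close>
makes the family closed under differentiation, so its smoothness needs no formula for higher
derivatives.\<close>

definition flat :: "real poly \<Rightarrow> real \<Rightarrow> real" where
  "flat p x = (if 0 < x then poly p (1 / x) * exp (- 1 / x) else 0)"

lemma flat_at_right: "((\<lambda>x. poly p (1 / x) * exp (- 1 / x)) \<longlongrightarrow> 0) (at_right (0::real))"
proof -
  have "((\<lambda>y::real. \<Sum>i\<le>degree p. coeff p i * (y ^ i / exp y)) \<longlongrightarrow> (\<Sum>i\<le>degree p. coeff p i * 0)) at_top"
    by (intro tendsto_sum tendsto_mult tendsto_const tendsto_power_div_exp_0)
  also have "(\<lambda>y::real. \<Sum>i\<le>degree p. coeff p i * (y ^ i / exp y)) = (\<lambda>y. poly p y * exp (- y))"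
    by (simp add: poly_altdef sum_distrib_right exp_minus divide_inverse mult.assoc)
  finally have "((\<lambda>y::real. poly p y * exp (- y)) \<longlongrightarrow> 0) at_top" by simp
  from filterlim_compose[OF this filterlim_inverse_at_top_right]
  show ?thesis by (simp add: field_simps)
qed

lemma flat_derivative:
  "(flat p has_real_derivative flat ([:0, 0, 1:] * (p - pderiv p)) x) (at x)"
proof -
  consider "x < 0" | "x > 0" | "x = 0" by linarith
  then show ?thesis
  proof cases
    case 1
    have "((\<lambda>_. 0) has_real_derivative flat ([:0, 0, 1:] * (p - pderiv p)) x) (at x)"
      using 1 by (simp add: flat_def)
    then show ?thesis
      by (rule has_field_derivative_transform_within_open[where S="{..<0}"])
         (use 1 in \<open>auto simp: flat_def\<close>)
  next
    case 2
    have "((\<lambda>x. poly p (1 / x) * exp (- 1 / x)) has_real_derivative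
        flat ([:0, 0, 1:] * (p - pderiv p)) x) (at x)"
      using 2 by (auto intro!: derivative_eq_intros simp: flat_def field_simps power2_eq_square)
    then show ?thesis
      by (rule has_field_derivative_transform_within_open[where S="{0<..}"])
         (use 2 in \<open>auto simp: flat_def\<close>)
  next
    case 3
    have "((\<lambda>h. flat p h / h) \<longlongrightarrow> 0) (at_right 0)"
    proof (rule Lim_transform_eventually[OF flat_at_right[of "pCons 0 p"]])
      show "\<forall>\<^sub>F h in at_right 0. poly (pCons 0 p) (1 / h) * exp (- 1 / h) = flat p h / h"
        by (auto simp: eventually_at_right_less flat_def eventually_at_filter)
    qed
    moreover have "((\<lambda>h. flat p h / h) \<longlongrightarrow> 0) (at_left 0)"
      by (rule Lim_transform_eventually[OF tendsto_const])
         (auto simp: flat_def eventually_at_filter)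
    ultimately have "((\<lambda>h. flat p h / h) \<longlongrightarrow> 0) (at 0)"
      by (simp add: filterlim_split_at)
    then show ?thesis using 3 by (simp add: DERIV_def flat_def)
  qed
qed

lemma Ck_flat: "Ck k (flat p)"
proof (induction k arbitrary: p)
  case 0
  then show ?case
    using DERIV_isCont[OF flat_derivative] by (auto intro!: continuous_at_imp_continuous_on)
next
  case (Suc k)
  have *: "frechet_derivative (flat p) (at x) b = flat ([:0, 0, 1:] * (p - pderiv p)) x * b" for x b
    using frechet_derivativeI[OF flat_derivative[unfolded has_field_derivative_def]] by simp
  have "flat p differentiable (at x)" for x
    using flat_derivative[of p x] by (auto simp: has_field_derivative_def intro: differentiableI)
  then show ?case unfolding Ck.simps *
    by (intro conjI allI Ck_mult Suc.IH Ck_const)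
qed

definition smooth_step :: "real \<Rightarrow> real" where
  "smooth_step x = flat 1 x * inverse (flat 1 x + flat 1 (1 - x))"

lemma smooth_step_denominator: "flat 1 x + flat 1 (1 - x) > 0"
  by (cases "0 < x"; cases "x < 1") (auto simp: flat_def intro: add_pos_pos)

lemma smooth_step_bounds: "0 \<le> smooth_step x" "smooth_step x \<le> 1"
  using smooth_step_denominator[of x] by (auto simp: smooth_step_def flat_def divide_simps split: if_splits)

lemma smooth_step_eq_0: "x \<le> 0 \<Longrightarrow> smooth_step x = 0"
  by (simp add: smooth_step_def flat_def)

lemma smooth_step_eq_1: "1 \<le> x \<Longrightarrow> smooth_step x = 1"
  by (simp add: smooth_step_def flat_def)

lemma Ck_reflect: "Ck k f \<Longrightarrow> Ck k (\<lambda>x::real. f (1 - x))"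
  using Ck_compose_affine[of "\<lambda>x::real. - x" k f 1] by (simp add: bounded_linear_minus bounded_linear_ident)

lemma Ck_smooth_step: "Ck k smooth_step"
  unfolding smooth_step_def[abs_def]
  by (intro Ck_mult Ck_flat Ck_inverse Ck_add Ck_reflect) (metis less_irrefl smooth_step_denominator)

lemma mono_smooth_step: "x \<le> y \<Longrightarrow> smooth_step x \<le> smooth_step y"
proof -
  assume "x \<le> y"
  have m: "flat 1 x \<le> flat 1 y" if "x \<le> y" for x y
    using that by (auto simp: flat_def frac_le)
  have "flat 1 x * (flat 1 y + flat 1 (1 - y)) \<le> flat 1 y * (flat 1 x + flat 1 (1 - x))"
    using mult_mono[OF m[OF \<open>x \<le> y\<close>] m[of "1 - y" "1 - x"]] \<open>x \<le> y\<close>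
    by (simp add: algebra_simps flat_def)
  then show ?thesis
    using smooth_step_denominator[of x] smooth_step_denominator[of y]
    by (simp add: smooth_step_def divide_simps)
qed

section \<open>Test functions on the line\<close>

lemma compact_continuous_bounded:
  fixes f :: "'a::topological_space \<Rightarrow> 'b::real_normed_vector"
  assumes "compact K" "continuous_on UNIV f"
  obtains B where "0 \<le> B" "\<And>x. x \<in> K \<Longrightarrow> norm (f x) \<le> B"
proof -
  have "compact (f ` K)"
    using assms by (intro compact_continuous_image) (auto intro: continuous_on_subset)
  then obtain B where B: "\<forall>y\<in>f ` K. norm y \<le> B" by (meson bounded_iff compact_imp_bounded)
  show ?thesis by (rule that[of "max B 0"]) (use B in \<open>auto simp: le_max_iff_disj\<close>)
qed

lemma test_functionI:
  assumes "\<And>k. Ck k \<phi>" "bounded S" "\<And>x. x \<notin> S \<Longrightarrow> \<phi> x = 0"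
  shows "test_function \<phi>"
proof -
  have "bounded {x. \<phi> x \<noteq> 0}"
    using assms(2) by (rule bounded_subset) (use assms(3) in auto)
  then show ?thesis using assms(1) by (simp add: test_function_def compact_closure)
qed

lemma test_function_support:
  assumes "test_function \<phi>"
  obtains R where "0 < R" "\<And>x. R < norm x \<Longrightarrow> \<phi> x = 0"
proof -
  have "bounded {x. \<phi> x \<noteq> 0}"
    using assms unfolding test_function_def
    by (intro bounded_subset[OF compact_imp_bounded closure_subset]) simp
  then obtain R where "0 < R" "\<forall>x\<in>{x. \<phi> x \<noteq> 0}. norm x \<le> R"
    by (meson bounded_pos)
  then show ?thesis by (intro that[of R]) force+
qed

lemma Ck_continuous: "\<forall>k. Ck k f \<Longrightarrow> continuous_on UNIV f"
  using Ck.simps(1) by blast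

lemma test_function_continuous: "test_function \<phi> \<Longrightarrow> continuous_on S \<phi>"
  unfolding test_function_def using Ck_continuous continuous_on_subset by blast

lemma test_function_differentiable: "test_function \<phi> \<Longrightarrow> \<phi> differentiable (at x)"
  unfolding test_function_def using Ck.simps(2) by blast

lemma test_function_dir_deriv:
  assumes "test_function \<phi>"
  shows "test_function (dir_deriv b \<phi>)"
proof -
  obtain R where R: "\<And>x. R < norm x \<Longrightarrow> \<phi> x = 0"
    using test_function_support[OF assms] by blast
  show ?thesis
  proof (rule test_functionI)
    show "Ck k (dir_deriv b \<phi>)" for k
      using assms unfolding test_function_def dir_deriv_def[abs_def] using Ck.simps(2) by blast
    show "bounded (cball 0 R :: 'a set)" by simp
    fix x :: 'a assume "x \<notin> cball 0 R"
    then have x: "x \<in> - cball 0 R" by simp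
    have "(\<phi> has_derivative (\<lambda>_. 0)) (at x)"
      by (rule has_derivative_transform_within_open[of "\<lambda>_. 0" _ x UNIV "- cball 0 R"]) (use x in \<open>auto simp: R\<close>)
    then show "dir_deriv b \<phi> x = 0"
      by (simp add: dir_deriv_def frechet_derivativeI)
  qed
qed

lemma dir_deriv_real: "(\<phi> has_real_derivative d) (at x) \<Longrightarrow> dir_deriv 1 \<phi> x = d"
  by (simp add: dir_deriv_def has_field_derivative_def frechet_derivativeI)

lemma test_function_has_real_derivative:
  fixes \<phi> :: "real \<Rightarrow> real"
  assumes "test_function \<phi>"
  shows "(\<phi> has_real_derivative dir_deriv 1 \<phi> x) (at x)"
  using test_function_differentiable[OF assms, of x] dir_deriv_real
  by (metis real_differentiable_def)

abbreviation "smooth_bump \<equiv> deriv smooth_step"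

lemma smooth_step_derivative: "(smooth_step has_real_derivative smooth_bump x) (at x)"
proof -
  have "smooth_step differentiable (at x)" using Ck_smooth_step[of "Suc 0"] by simp
  then show ?thesis by (metis DERIV_imp_deriv real_differentiable_def)
qed

lemma continuous_smooth_bump: "continuous_on S smooth_bump"
proof -
  have "smooth_bump = (\<lambda>x. frechet_derivative smooth_step (at x) 1)"
    using dir_deriv_real[OF smooth_step_derivative] by (auto simp: dir_deriv_def)
  moreover have "Ck 0 (\<lambda>x. frechet_derivative smooth_step (at x) 1)"
    using Ck_smooth_step[of "Suc 0"] by simp
  ultimately show ?thesis using continuous_on_subset by (metis Ck.simps(1) top_greatest)
qed

lemma smooth_bump_nonneg: "0 \<le> smooth_bump x"
  by (rule mono_on_imp_deriv_nonneg[OF _ smooth_step_derivative, of UNIV])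
     (auto intro!: mono_onI mono_smooth_step)

lemma smooth_bump_outside: "x \<notin> {0..1} \<Longrightarrow> smooth_bump x = 0"
proof -
  assume "x \<notin> {0..1}"
  then consider "x < 0" | "1 < x" by fastforce
  then have "(smooth_step has_real_derivative 0) (at x)"
  proof cases
    case 1
    show ?thesis
      by (rule has_field_derivative_transform_within_open[of "\<lambda>_. 0" 0 x "{..<0}"])
         (use 1 in \<open>auto simp: smooth_step_eq_0\<close>)
  next
    case 2
    show ?thesis
      by (rule has_field_derivative_transform_within_open[of "\<lambda>_. 1" 0 x "{1<..}"])
         (use 2 in \<open>auto simp: smooth_step_eq_1\<close>)
  qed
  then show ?thesis by (rule DERIV_imp_deriv)
qed

lemma integrable_smooth_bump: "integrable lborel smooth_bump"
  and integral_smooth_bump: "(LINT x|lborel. smooth_bump x) = 1"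
proof -
  have "set_integrable lborel {0..1} smooth_bump"
    by (rule borel_integrable_atLeastAtMost') (rule continuous_smooth_bump)
  moreover have eq: "(\<lambda>x. indicator {0..1} x *\<^sub>R smooth_bump x) = smooth_bump"
    using smooth_bump_outside by (force simp: indicator_def)
  ultimately show "integrable lborel smooth_bump" by (simp add: set_integrable_def)
  have "(LINT x|lborel. smooth_bump x) = (LINT x:{0..1}|lborel. smooth_bump x)"
    using eq by (simp add: set_lebesgue_integral_def)
  also have "\<dots> = smooth_step 1 - smooth_step 0"
    unfolding set_lebesgue_integral_def
    by (rule integral_FTC_Icc) (auto simp: has_real_derivative_iff_has_vector_derivative[symmetric]
        intro!: has_field_derivative_at_within smooth_step_derivative continuous_smooth_bump)
  finally show "(LINT x|lborel. smooth_bump x) = 1" by (simp add: smooth_step_eq_0 smooth_step_eq_1)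
qed

text \<open>Mollification with a kernel supported to the right of \<open>a\<close>. It is stated with the exact form of
the derivative of a rescaled \<open>smooth_step\<close>, because it serves to evaluate weak equations tested
with such steps.\<close>

lemma smooth_bump_approximate_identity:
  fixes f :: "real \<Rightarrow> real"
  assumes f: "continuous_on UNIV f"
  shows "integrable lborel (\<lambda>x. f x * (real (Suc n) * smooth_bump (real (Suc n) * (x - a))))"
    and "(\<lambda>n. LINT x|lborel. f x * (real (Suc n) * smooth_bump (real (Suc n) * (x - a)))) \<longlonglongrightarrow> f a"
proof -
  have meas [measurable]: "f \<in> borel_measurable borel" "smooth_bump \<in> borel_measurable borel"
    using f continuous_smooth_bump by (auto intro: borel_measurable_continuous_onI)
  obtain M where M: "\<And>x. x \<in> {a..a+1} \<Longrightarrow> \<bar>f x\<bar> \<le> M"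
    using compact_continuous_bounded[OF compact_Icc f, of a "a + 1"] unfolding real_norm_def by blast
  have bound: "norm (f (a + y / real (Suc n)) * smooth_bump y) \<le> M * smooth_bump y" for y n
  proof (cases "y \<in> {0..1}")
    case True
    then have "a + y / real (Suc n) \<in> {a..a+1}" by (auto simp: divide_le_eq_1)
    then show ?thesis using M smooth_bump_nonneg by (simp add: abs_mult mult_right_mono)
  qed (simp add: smooth_bump_outside)
  have int: "integrable lborel (\<lambda>y. M * smooth_bump y)"
    using integrable_smooth_bump by simp
  have i: "integrable lborel (\<lambda>y. f (a + y / real (Suc n)) * smooth_bump y)" for n
    by (rule Bochner_Integration.integrable_bound[OF int _ AE_I2[OF order_trans[OF bound]]]) simp_all
  have sub: "f (a + 1 / real (Suc n) * y) * (real (Suc n) * smooth_bump (real (Suc n) * (a + 1 / real (Suc n) * y - a)))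
     = real (Suc n) * (f (a + y / real (Suc n)) * smooth_bump y)" for y n
    by (simp add: algebra_simps del: of_nat_Suc)
  show "integrable lborel (\<lambda>x. f x * (real (Suc n) * smooth_bump (real (Suc n) * (x - a))))"
    using lborel_integrable_real_affine_iff[of "1 / real (Suc n)"
        "\<lambda>x. f x * (real (Suc n) * smooth_bump (real (Suc n) * (x - a)))" a]
      integrable_mult_right[OF i, of "real (Suc n)" n]
    unfolding sub by simp
  have eq: "(LINT x|lborel. f x * (real (Suc n) * smooth_bump (real (Suc n) * (x - a))))
      = (LINT y|lborel. f (a + y / real (Suc n)) * smooth_bump y)" for n
    by (subst lborel_integral_real_affine[of "1 / real (Suc n)" _ a], simp, unfold sub, simp del: of_nat_Suc)
  have "(\<lambda>n. LINT y|lborel. f (a + y / real (Suc n)) * smooth_bump y) \<longlonglongrightarrow> (LINT y|lborel. f a * smooth_bump y)"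
  proof (rule integral_dominated_convergence[OF _ _ int])
    show "AE y in lborel. (\<lambda>n. f (a + y / real (Suc n)) * smooth_bump y) \<longlonglongrightarrow> f a * smooth_bump y"
    proof (rule AE_I2)
      fix y :: real
      have "(\<lambda>n. a + y / real (Suc n)) \<longlonglongrightarrow> a"
        using tendsto_add[OF tendsto_const tendsto_mult_left[OF LIMSEQ_inverse_real_of_nat, of y], of a]
        by (simp add: divide_inverse)
      moreover have "isCont f a" using f continuous_on_eq_continuous_at by blast
      ultimately show "(\<lambda>n. f (a + y / real (Suc n)) * smooth_bump y) \<longlonglongrightarrow> f a * smooth_bump y"
        by (intro tendsto_mult tendsto_const) (rule isCont_tendsto_compose)
    qed
  qed (use bound in auto)
  then show "(\<lambda>n. LINT x|lborel. f x * (real (Suc n) * smooth_bump (real (Suc n) * (x - a)))) \<longlonglongrightarrow> f a"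
    unfolding eq by (simp add: integral_smooth_bump)
qed

text \<open>The kernels have mass one; this bound is uniform in \<open>n\<close> and gives the dominating constant
when the mollification is integrated in time.\<close>

lemma smooth_bump_mollifier_bound:
  assumes f: "continuous_on UNIV f" and B: "\<And>x. \<bar>f x\<bar> \<le> B"
  shows "\<bar>LINT x|lborel. f x * (real (Suc n) * smooth_bump (real (Suc n) * (x - a)))\<bar> \<le> B"
proof -
  have [measurable]: "smooth_bump \<in> borel_measurable borel"
    using continuous_smooth_bump by (auto intro: borel_measurable_continuous_onI)
  have sub: "B * (real (Suc n) * smooth_bump (real (Suc n) * (a + 1 / real (Suc n) * y - a)))
     = real (Suc n) * (B * smooth_bump y)" for y
    by (simp add: algebra_simps del: of_nat_Suc)
  have "\<bar>LINT x|lborel. f x * (real (Suc n) * smooth_bump (real (Suc n) * (x - a)))\<bar>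
      \<le> (LINT x|lborel. \<bar>f x * (real (Suc n) * smooth_bump (real (Suc n) * (x - a)))\<bar>)"
    by (rule integral_abs_bound)
  also have "\<dots> \<le> (LINT x|lborel. B * (real (Suc n) * smooth_bump (real (Suc n) * (x - a))))"
    using smooth_bump_nonneg
    by (intro integral_mono integrable_abs smooth_bump_approximate_identity(1) f continuous_on_const)
       (auto simp: abs_mult intro!: mult_right_mono B)
  also have "\<dots> = B"
    by (subst lborel_integral_real_affine[of "1 / real (Suc n)" _ a], simp, unfold sub,
        simp add: integral_smooth_bump del: of_nat_Suc)
  finally show ?thesis .
qed

text \<open>Smooth approximations of the indicator of an interval, for localising weak equations.\<close>

definition plateau :: "nat \<Rightarrow> real \<Rightarrow> real \<Rightarrow> real \<Rightarrow> real" where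
  "plateau n a b x = smooth_step (real (Suc n) * (x - a)) - smooth_step (real (Suc n) * (x - b))"

lemma Ck_smooth_step_affine: "Ck k (\<lambda>x. smooth_step (c * (x - a)))"
  using Ck_compose_affine[OF bounded_linear_mult_right[of c] Ck_smooth_step, of k "- (c * a)"]
  by (simp add: right_diff_distrib)

lemma Ck_diff: "Ck k f \<Longrightarrow> Ck k g \<Longrightarrow> Ck k (\<lambda>x. f x - g x)"
  using Ck_add[of k f "\<lambda>x. (- 1) * g x"] Ck_mult[OF Ck_const] by fastforce

lemma plateau_outside: "a \<le> b \<Longrightarrow> x \<notin> {a..b + 1} \<Longrightarrow> plateau n a b x = 0"
proof -
  assume ab: "a \<le> b" "x \<notin> {a..b + 1}"
  then consider "x < a" | "b + 1 < x" by fastforce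
  then show ?thesis
  proof cases
    case 1
    then show ?thesis using ab unfolding plateau_def
      by (simp add: smooth_step_eq_0 mult_nonneg_nonpos del: of_nat_Suc)
  next
    case 2
    have "1 \<le> real (Suc n) * (x - c)" if "c \<le> b" for c
      using mult_mono[of 1 "real (Suc n)" 1 "x - c"] 2 that by simp
    then show ?thesis using ab unfolding plateau_def
      by (simp add: smooth_step_eq_1 del: of_nat_Suc)
  qed
qed

lemma test_function_plateau: "a \<le> b \<Longrightarrow> test_function (plateau n a b)"
  using plateau_outside unfolding plateau_def[abs_def]
  by (intro test_functionI[of _ "{a..b+1}"] Ck_diff Ck_smooth_step_affine) auto

lemma plateau_bounds: "a \<le> b \<Longrightarrow> \<bar>plateau n a b x\<bar> \<le> indicator {a..b + 1} x"
proof (cases "x \<in> {a..b+1}")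
  case True
  then show ?thesis using smooth_step_bounds[of "real (Suc n) * (x - a)"] smooth_step_bounds[of "real (Suc n) * (x - b)"]
    by (simp add: plateau_def del: of_nat_Suc)
qed (simp add: plateau_outside)

lemma plateau_derivative:
  "dir_deriv 1 (plateau n a b) x =
     real (Suc n) * smooth_bump (real (Suc n) * (x - a)) - real (Suc n) * smooth_bump (real (Suc n) * (x - b))"
  unfolding plateau_def[abs_def]
  by (intro dir_deriv_real) (auto intro!: derivative_eq_intros DERIV_chain2[OF smooth_step_derivative])

lemma plateau_LIMSEQ: "a \<le> b \<Longrightarrow> (\<lambda>n. plateau n a b x) \<longlonglongrightarrow> indicator {a<..b} x"
proof -
  assume "a \<le> b"
  have s: "(\<lambda>n. smooth_step (real (Suc n) * (x - c))) \<longlonglongrightarrow> indicator {c<..} x" for c :: real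
  proof (cases "c < x")
    case True
    have "\<forall>\<^sub>F n in sequentially. 1 / (x - c) < real n"
      using filterlim_real_sequentially by (simp add: filterlim_at_top_dense)
    then have "\<forall>\<^sub>F n in sequentially. smooth_step (real (Suc n) * (x - c)) = 1"
      by eventually_elim (use True in \<open>auto intro!: smooth_step_eq_1 simp: field_simps\<close>)
    then show ?thesis using True by (simp add: tendsto_eventually)
  next
    case False
    then show ?thesis by (simp add: smooth_step_eq_0 mult_nonneg_nonpos del: of_nat_Suc)
  qed
  have "indicator {a<..} x - indicator {b<..} x = (indicator {a<..b} x :: real)"
    using \<open>a \<le> b\<close> by (auto simp: indicator_def)
  then show ?thesis using tendsto_diff[OF s[of a] s[of b]] by (simp add: plateau_def)
qed

lemma L1_loc_integrable_Icc: "g \<in> L1_loc \<Longrightarrow> set_integrable lborel {a..b::real} g"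
  by (auto simp: L1_loc_def)

lemma L1_loc_integral_plateau_LIMSEQ:
  assumes "g \<in> L1_loc" "a \<le> b"
  shows "integrable lborel (\<lambda>x. g x * plateau n a b x)"
    and "(\<lambda>n. LINT x|lborel. g x * plateau n a b x) \<longlonglongrightarrow> (LINT x:{a..b}|lborel. g x)"
proof -
  have [measurable]: "g \<in> borel_measurable borel" using assms by (simp add: L1_loc_def)
  have [measurable]: "plateau n a b \<in> borel_measurable borel" for n
    using test_function_continuous[OF test_function_plateau[OF assms(2)]]
    by (rule borel_measurable_continuous_onI)
  have int: "integrable lborel (\<lambda>x. \<bar>indicator {a..b+1} x *\<^sub>R g x\<bar>)"
    using L1_loc_integrable_Icc[OF assms(1), of a "b+1"] unfolding set_integrable_def by (rule integrable_abs)
  have bound: "norm (g x * plateau n a b x) \<le> \<bar>indicator {a..b+1} x *\<^sub>R g x\<bar>" for x n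
    using mult_left_mono[OF plateau_bounds[OF assms(2), of n x], of "\<bar>g x\<bar>"]
    by (simp add: abs_mult mult.commute)
  show "integrable lborel (\<lambda>x. g x * plateau n a b x)"
    by (rule Bochner_Integration.integrable_bound[OF int]) (use bound in \<open>auto intro: order_trans\<close>)
  have "(\<lambda>n. LINT x|lborel. g x * plateau n a b x) \<longlonglongrightarrow> (LINT x|lborel. g x * indicator {a<..b} x)"
    by (rule integral_dominated_convergence[OF _ _ int])
       (use bound assms plateau_LIMSEQ in \<open>auto intro!: tendsto_mult\<close>)
  also have "(LINT x|lborel. g x * indicator {a<..b} x) = (LINT x:{a..b}|lborel. g x)"
    unfolding set_lebesgue_integral_def
  proof (rule integral_cong_AE)
    show "AE x in lborel. g x * indicator {a<..b} x = indicator {a..b} x *\<^sub>R g x"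
      using AE_lborel_singleton[of a] by eventually_elim (auto simp: indicator_def)
  qed auto
  finally show "(\<lambda>n. LINT x|lborel. g x * plateau n a b x) \<longlonglongrightarrow> (LINT x:{a..b}|lborel. g x)" .
qed

text \<open>Testing with plateaus turns a weak derivative into an indefinite integral. This is used in
space, for \<open>u t\<close>, and in time, where the weak equations say that spatial averages have a
continuous weak derivative.\<close>

theorem weak_deriv_primitive:
  fixes a b :: real
  assumes w: "has_weak_deriv 1 f g" and f: "continuous_on UNIV f" and ab: "a \<le> b"
  shows "f b - f a = (LINT x:{a..b}|lborel. g x)"
proof -
  have g: "g \<in> L1_loc" using w by (simp add: has_weak_deriv_def)
  let ?I = "\<lambda>(c::real) n. LINT x|lborel. f x * (real (Suc n) * smooth_bump (real (Suc n) * (x - c)))"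
  have "?I a n - ?I b n = - (LINT x|lborel. g x * plateau n a b x)" for n
  proof -
    have "(LINT x|lborel. f x * dir_deriv 1 (plateau n a b) x) = ?I a n - ?I b n"
      using Bochner_Integration.integral_diff[OF smooth_bump_approximate_identity(1)[OF f, of n a]
          smooth_bump_approximate_identity(1)[OF f, of n b]]
      by (simp only: plateau_derivative flip: right_diff_distrib)
    then show ?thesis
      using w test_function_plateau[OF ab, of n] by (simp add: has_weak_deriv_def del: of_nat_Suc)
  qed
  moreover have "(\<lambda>n. ?I a n - ?I b n) \<longlonglongrightarrow> f a - f b"
    by (intro tendsto_diff smooth_bump_approximate_identity f)
  moreover have "(\<lambda>n. - (LINT x|lborel. g x * plateau n a b x)) \<longlonglongrightarrow> - (LINT x:{a..b}|lborel. g x)"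
    by (intro tendsto_minus L1_loc_integral_plateau_LIMSEQ g ab)
  ultimately have "f a - f b = - (LINT x:{a..b}|lborel. g x)"
    using LIMSEQ_unique by fastforce
  then show ?thesis by simp
qed


section \<open>Indefinite integrals\<close>

text \<open>Local absolute continuity with derivative \<open>g\<close>; the formulation by integrals avoids pointwise
differentiability.\<close>

definition primitive :: "(real \<Rightarrow> real) \<Rightarrow> (real \<Rightarrow> real) \<Rightarrow> bool" where
  "primitive f g \<longleftrightarrow> g \<in> L1_loc \<and> (\<forall>a b. a \<le> b \<longrightarrow> f b - f a = (LINT x:{a..b}|lborel. g x))"

lemma L1_loc_continuous:
  fixes f :: "'a::euclidean_space \<Rightarrow> real"
  assumes "continuous_on UNIV f"
  shows "f \<in> L1_loc"
proof -
  have "continuous_on K f" for K using assms by (rule continuous_on_subset) simp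
  then show ?thesis unfolding L1_loc_def set_integrable_def
    by (auto simp del: real_scaleR_def intro!: borel_measurable_continuous_onI borel_integrable_compact)
qed

lemma L1_loc_mult_continuous:
  assumes "g \<in> L1_loc" "continuous_on UNIV f"
  shows "(\<lambda>x. g x * f x :: real) \<in> L1_loc"
proof -
  have [measurable]: "g \<in> borel_measurable borel" "f \<in> borel_measurable borel"
    using assms by (auto simp: L1_loc_def intro: borel_measurable_continuous_onI)
  have "set_integrable lborel K (\<lambda>x. g x * f x)" if K: "compact K" for K
  proof -
    obtain M where M: "\<And>x. x \<in> K \<Longrightarrow> norm (f x) \<le> M"
      using compact_continuous_bounded[OF K assms(2)] by blast
    have "integrable lborel (\<lambda>x. M * (indicator K x *\<^sub>R g x))"
      using assms(1) K by (auto simp: L1_loc_def set_integrable_def)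
    then show ?thesis unfolding set_integrable_def
    proof (rule Bochner_Integration.integrable_bound)
      have [measurable]: "K \<in> sets borel" using K by (simp add: compact_imp_closed)
      show "(\<lambda>x. indicator K x *\<^sub>R (g x * f x)) \<in> borel_measurable lborel" by measurable
      have "\<bar>g x * f x\<bar> \<le> \<bar>M * g x\<bar>" if "x \<in> K" for x
        using mult_left_mono[of "\<bar>f x\<bar>" "\<bar>M\<bar>" "\<bar>g x\<bar>"] M that by (fastforce simp: abs_mult mult.commute)
      then show "AE x in lborel. norm (indicator K x *\<^sub>R (g x * f x)) \<le> norm (M * (indicator K x *\<^sub>R g x))"
        by (intro AE_I2) (auto simp: indicator_def)
    qed
  qed
  then show ?thesis by (simp add: L1_loc_def)
qed

lemma L1_loc_add:
  assumes "f \<in> L1_loc" "g \<in> L1_loc"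
  shows "(\<lambda>x. f x + g x) \<in> L1_loc"
  using assms by (auto simp: L1_loc_def)

lemma integral_Icc_eq_halfline:
  fixes g :: "real \<Rightarrow> real"
  assumes "g \<in> L1_loc" "z \<in> {a..b}"
  shows "(LINT y:{a..z}|lborel. g y) = (LINT y|lborel. (indicator {a..b} y * g y) * of_bool (y \<le> z))"
  unfolding set_lebesgue_integral_def
proof (rule Bochner_Integration.integral_cong)
  show "indicator {a..z} y *\<^sub>R g y = (indicator {a..b} y * g y) * of_bool (y \<le> z)" for y
    using assms(2) by (cases "a \<le> y"; cases "y \<le> z"; cases "y \<le> b") auto
qed simp

text \<open>The square is cut along its diagonal and Fubini's theorem exchanges the order of integration in
one of the triangles. This is integration by parts for integrable densities.\<close>

lemma product_integral_split:
  fixes p q :: "real \<Rightarrow> real"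
  assumes p: "integrable lborel p" and q: "integrable lborel q"
  shows "(LINT z|lborel. p z * (LINT y|lborel. q y * of_bool (y \<le> z)))
       + (LINT z|lborel. q z * (LINT y|lborel. p y * of_bool (y \<le> z)))
       = (LINT z|lborel. p z) * (LINT y|lborel. q y)"
    and "integrable lborel (\<lambda>z. p z * (LINT y|lborel. q y * of_bool (y \<le> z)))"
proof -
  have [measurable]: "p \<in> borel_measurable borel" "q \<in> borel_measurable borel"
    using p q by auto
  have [measurable]: "Measurable.pred (borel \<Otimes>\<^sub>M borel) (\<lambda>(z::real, y::real). y \<le> z)"
    by (simp add: case_prod_beta')
  have prod: "integrable (lborel \<Otimes>\<^sub>M lborel) (\<lambda>(z, y). a z * b y)"
    if a: "integrable lborel a" and b: "integrable lborel b" for a b :: "real \<Rightarrow> real"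
  proof (rule lborel_pair.Fubini_integrable)
    have [measurable]: "a \<in> borel_measurable borel" "b \<in> borel_measurable borel"
      using a b by auto
    show "(\<lambda>(z, y). a z * b y) \<in> borel_measurable (lborel \<Otimes>\<^sub>M lborel)" by measurable
    show "integrable lborel (\<lambda>x. LINT y|lborel. norm (case (x, y) of (z, y) \<Rightarrow> a z * b y))"
      using a b by (simp add: abs_mult)
    show "AE x in lborel. integrable lborel (\<lambda>y. case (x, y) of (z, y) \<Rightarrow> a z * b y)"
      using b by simp
  qed
  have low: "integrable (lborel \<Otimes>\<^sub>M lborel) (\<lambda>(z, y). a z * b y * of_bool (P z y))"
    if "integrable lborel a" "integrable lborel b" "Measurable.pred (borel \<Otimes>\<^sub>M borel) (\<lambda>(z, y). P z y)"
    for a b :: "real \<Rightarrow> real" and P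
    by (rule Bochner_Integration.integrable_bound[OF prod[OF that(1,2)]])
       (use that in \<open>auto simp: case_prod_beta' intro!: AE_I2\<close>)
  have int1: "integrable (lborel \<Otimes>\<^sub>M lborel) (\<lambda>(z, y). p z * q y * of_bool (y \<le> z))"
    by (rule low[OF p q]) measurable
  have int2: "integrable (lborel \<Otimes>\<^sub>M lborel) (\<lambda>(z, y). q z * p y * of_bool (y \<le> z))"
    by (rule low[OF q p]) measurable
  show int3: "integrable lborel (\<lambda>z. p z * (LINT y|lborel. q y * of_bool (y \<le> z)))"
    using lborel_pair.integrable_fst'[OF int1] by (simp add: mult.assoc)
  have "(LINT z|lborel. q z * (LINT y|lborel. p y * of_bool (y \<le> z)))
      = (LINT z|lborel. LINT y|lborel. q z * p y * of_bool (y \<le> z))"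
    by (simp add: mult.assoc)
  also have "\<dots> = (LINT y|lborel. LINT z|lborel. q z * p y * of_bool (y \<le> z))"
    using lborel_pair.Fubini_integral[OF int2] by simp
  also have "\<dots> = (LINT y|lborel. p y * (LINT z|lborel. q z * of_bool (y \<le> z)))"
    by (simp flip: integral_mult_right_zero add: ac_simps)
  finally have swap: "(LINT z|lborel. q z * (LINT y|lborel. p y * of_bool (y \<le> z)))
      = (LINT y|lborel. p y * (LINT z|lborel. q z * of_bool (y \<le> z)))" .
  have int4: "integrable lborel (\<lambda>y. p y * (LINT z|lborel. q z * of_bool (y \<le> z)))"
  proof -
    have "integrable (lborel \<Otimes>\<^sub>M lborel) (\<lambda>(y, z). p y * q z * of_bool (y \<le> z))"
      by (rule low[OF p q]) measurable
    from lborel_pair.integrable_fst'[OF this] show ?thesis by (simp add: mult.assoc)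
  qed
  have cover: "(LINT y|lborel. q y * of_bool (y \<le> z)) + (LINT y|lborel. q y * of_bool (z \<le> y)) = (LINT y|lborel. q y)" for z
  proof -
    have i: "integrable lborel (\<lambda>y. q y * of_bool (y \<le> z))" "integrable lborel (\<lambda>y. q y * of_bool (z \<le> y))"
      by (auto intro!: Bochner_Integration.integrable_bound[OF q] AE_I2)
    have "(LINT y|lborel. q y * of_bool (y \<le> z)) + (LINT y|lborel. q y * of_bool (z \<le> y))
       = (LINT y|lborel. q y * of_bool (y \<le> z) + q y * of_bool (z \<le> y))"
      using i by simp
    also have "\<dots> = (LINT y|lborel. q y)"
    proof (rule integral_cong_AE)
      show "AE y in lborel. q y * of_bool (y \<le> z) + q y * of_bool (z \<le> y) = q y"
        using AE_lborel_singleton[of z] by eventually_elim auto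
    qed auto
    finally show ?thesis .
  qed
  show "(LINT z|lborel. p z * (LINT y|lborel. q y * of_bool (y \<le> z)))
       + (LINT z|lborel. q z * (LINT y|lborel. p y * of_bool (y \<le> z)))
       = (LINT z|lborel. p z) * (LINT y|lborel. q y)"
    unfolding swap using int3 int4
    by (simp flip: Bochner_Integration.integral_add distrib_left add: cover)
qed

lemma primitive_continuous:
  assumes "primitive f g"
  shows "continuous_on UNIV f"
proof (rule continuous_at_imp_continuous_on, safe)
  fix x :: real
  have "set_integrable lborel {x-1..x+1} g"
    using assms by (auto simp: primitive_def intro: L1_loc_integrable_Icc)
  then have c: "continuous_on {x-1..x+1} (\<lambda>y. integral {x-1..y} g)"
    by (intro indefinite_integral_continuous_1 set_borel_integral_eq_integral(1))
  have "f y = f (x - 1) + integral {x-1..y} g" if "y \<in> {x-1..x+1}" for y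
  proof -
    have "f y - f (x - 1) = (LINT z:{x-1..y}|lborel. g z)"
      using assms that by (simp add: primitive_def)
    also have "\<dots> = integral {x-1..y} g"
      using assms by (intro set_borel_integral_eq_integral(2) L1_loc_integrable_Icc) (simp add: primitive_def)
    finally show ?thesis by simp
  qed
  then have "continuous_on {x-1..x+1} f"
    by (intro continuous_on_eq[OF continuous_on_add[OF continuous_on_const[of _ "f (x - 1)"] c]]) (rule sym)
  then show "isCont f x"
    by (rule continuous_on_interior) simp
qed

theorem primitive_mult:
  assumes "primitive f1 g1" "primitive f2 g2"
  shows "primitive (\<lambda>x. f1 x * f2 x) (\<lambda>x. g1 x * f2 x + g2 x * f1 x)"
  unfolding primitive_def
proof (intro conjI allI impI)
  note c = assms[THEN primitive_continuous]
  have g: "g1 \<in> L1_loc" "g2 \<in> L1_loc" using assms by (auto simp: primitive_def)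
  have l: "(\<lambda>x. g1 x * f2 x) \<in> L1_loc" "(\<lambda>x. g2 x * f1 x) \<in> L1_loc"
    using g c by (auto intro: L1_loc_mult_continuous)
  show "(\<lambda>x. g1 x * f2 x + g2 x * f1 x) \<in> L1_loc"
    by (intro L1_loc_add l)
  fix a b :: real assume ab: "a \<le> b"
  define p where "p y = indicator {a..b} y * g1 y" for y
  define q where "q y = indicator {a..b} y * g2 y" for y
  have pq: "integrable lborel p" "integrable lborel q"
    using L1_loc_integrable_Icc[OF g(1), of a b] L1_loc_integrable_Icc[OF g(2), of a b]
    by (simp_all add: p_def[abs_def] q_def[abs_def] set_integrable_def)
  have f: "f1 z = f1 a + (LINT y|lborel. p y * of_bool (y \<le> z))"
      "f2 z = f2 a + (LINT y|lborel. q y * of_bool (y \<le> z))" if "z \<in> {a..b}" for z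
    using assms that integral_Icc_eq_halfline[OF g(1) that] integral_Icc_eq_halfline[OF g(2) that]
    by (auto simp: primitive_def p_def q_def algebra_simps)
  have fb: "f1 b = f1 a + (LINT y|lborel. p y)" "f2 b = f2 a + (LINT y|lborel. q y)"
    using assms ab by (auto simp: primitive_def p_def q_def set_lebesgue_integral_def algebra_simps)
  have eq: "(LINT x:{a..b}|lborel. g1' x * f2' x) = (LINT x|lborel. p' x) * f2' a
      + (LINT z|lborel. p' z * (LINT y|lborel. q' y * of_bool (y \<le> z)))"
    if "\<And>z. p' z = indicator {a..b} z * g1' z"
      "\<And>z. z \<in> {a..b} \<Longrightarrow> f2' z = f2' a + (LINT y|lborel. q' y * of_bool (y \<le> z))"
      "integrable lborel p'" "integrable lborel q'" for p' q' g1' f2' :: "real \<Rightarrow> real"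
  proof -
    have "(LINT x:{a..b}|lborel. g1' x * f2' x)
        = (LINT z|lborel. p' z * f2' a + p' z * (LINT y|lborel. q' y * of_bool (y \<le> z)))"
      unfolding set_lebesgue_integral_def
    proof (intro Bochner_Integration.integral_cong refl)
      fix z show "indicator {a..b} z *\<^sub>R (g1' z * f2' z) = p' z * f2' a + p' z * (LINT y|lborel. q' y * of_bool (y \<le> z))"
        by (cases "z \<in> {a..b}") (simp_all add: that(1) that(2)[of z] distrib_left)
    qed
    also have "\<dots> = (LINT x|lborel. p' x) * f2' a
      + (LINT z|lborel. p' z * (LINT y|lborel. q' y * of_bool (y \<le> z)))"
      using Bochner_Integration.integral_add[OF integrable_mult_left[OF that(3), of "f2' a"] product_integral_split(2)[OF that(3,4)]]
      by simp
    finally show ?thesis .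
  qed
  have "(LINT x:{a..b}|lborel. g1 x * f2 x + g2 x * f1 x)
     = (LINT x:{a..b}|lborel. g1 x * f2 x) + (LINT x:{a..b}|lborel. g2 x * f1 x)"
    by (intro set_integral_add L1_loc_integrable_Icc l)
  also have "\<dots> = (LINT x|lborel. p x) * f2 a + (LINT x|lborel. q x) * f1 a + (LINT x|lborel. p x) * (LINT x|lborel. q x)"
    using product_integral_split(1)[OF pq] eq[OF p_def f(2) pq] eq[OF q_def f(1) pq(2,1)]
    by linarith
  also have "\<dots> = f1 b * f2 b - f1 a * f2 a"
    by (simp add: fb algebra_simps)
  finally show "f1 b * f2 b - f1 a * f2 a = (LINT x:{a..b}|lborel. g1 x * f2 x + g2 x * f1 x)"
    by (rule sym)
qed

lemma primitive_test_function:
  assumes "test_function \<phi>"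
  shows "primitive \<phi> (dir_deriv 1 \<phi>)"
  unfolding primitive_def
proof (intro conjI allI impI)
  have c: "continuous_on S (dir_deriv 1 \<phi>)" for S
    by (intro test_function_continuous test_function_dir_deriv assms)
  then show "dir_deriv 1 \<phi> \<in> L1_loc" by (intro L1_loc_continuous)
  fix a b :: real assume "a \<le> b"
  then show "\<phi> b - \<phi> a = (LINT x:{a..b}|lborel. dir_deriv 1 \<phi> x)"
    unfolding set_lebesgue_integral_def
    by (intro integral_FTC_Icc[symmetric] c) (auto simp: has_real_derivative_iff_has_vector_derivative[symmetric]
        intro!: has_field_derivative_at_within test_function_has_real_derivative[OF assms])
qed

lemma integral_by_parts_test_function:
  assumes f: "primitive f g" and \<phi>: "test_function \<phi>"
  shows "integrable lborel (\<lambda>x. f x * dir_deriv 1 \<phi> x)" "integrable lborel (\<lambda>x. g x * \<phi> x)"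
    "(LINT x|lborel. f x * dir_deriv 1 \<phi> x) = - (LINT x|lborel. g x * \<phi> x)"
proof -
  obtain R where R: "0 < R" "\<And>x. R < norm x \<Longrightarrow> \<phi> x = 0" using test_function_support[OF \<phi>] by blast
  obtain R' where R': "0 < R'" "\<And>x. R' < norm x \<Longrightarrow> dir_deriv 1 \<phi> x = 0"
    using test_function_support[OF test_function_dir_deriv[OF \<phi>]] by blast
  define S where "S = max R R' + 1"
  have S: "\<phi> x = 0" "dir_deriv 1 \<phi> x = 0" if "x \<notin> {-S<..<S}" for x
    using that R(1) by (auto simp: S_def intro!: R(2) R'(2))
  have S0: "0 < S" using R(1) by (simp add: S_def)
  note p = primitive_mult[OF f primitive_test_function[OF \<phi>]]
  have l: "(\<lambda>x. f x * dir_deriv 1 \<phi> x) \<in> L1_loc" "(\<lambda>x. g x * \<phi> x) \<in> L1_loc"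
    using test_function_continuous[OF \<phi>] test_function_continuous[OF test_function_dir_deriv[OF \<phi>]]
      primitive_continuous[OF f] f[unfolded primitive_def]
    by (auto intro!: L1_loc_mult_continuous L1_loc_continuous[of "\<lambda>x. f x * dir_deriv 1 \<phi> x"] continuous_intros)
  have ind: "indicator {-S..S} x *\<^sub>R (h x * k x) = h x * k x"
    if "\<And>x. x \<notin> {-S<..<S} \<Longrightarrow> k x = 0" for h k :: "real \<Rightarrow> real" and x
    using that[of x] by (cases "x \<in> {-S<..<S}") auto
  have e: "(\<lambda>x. indicator {-S..S} x *\<^sub>R (f x * dir_deriv 1 \<phi> x)) = (\<lambda>x. f x * dir_deriv 1 \<phi> x)"
    by (intro ext ind S(2))
  have e': "(\<lambda>x. indicator {-S..S} x *\<^sub>R (g x * \<phi> x)) = (\<lambda>x. g x * \<phi> x)"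
    by (intro ext ind S(1))
  show i: "integrable lborel (\<lambda>x. f x * dir_deriv 1 \<phi> x)" "integrable lborel (\<lambda>x. g x * \<phi> x)"
    using l[THEN L1_loc_integrable_Icc, of "-S" S] unfolding set_integrable_def e e' by auto
  have "f S * \<phi> S - f (-S) * \<phi> (-S) = (LINT x:{-S..S}|lborel. g x * \<phi> x + dir_deriv 1 \<phi> x * f x)"
    using p S0 by (simp add: primitive_def)
  also have "\<dots> = (LINT x|lborel. g x * \<phi> x) + (LINT x|lborel. f x * dir_deriv 1 \<phi> x)"
    unfolding set_lebesgue_integral_def scaleR_add_right mult.commute[of "dir_deriv 1 \<phi> _" "f _"]
      fun_cong[OF e] fun_cong[OF e']
    by (rule Bochner_Integration.integral_add[OF i(2,1)])
  finally show "(LINT x|lborel. f x * dir_deriv 1 \<phi> x) = - (LINT x|lborel. g x * \<phi> x)"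
    using S(1)[of S] S(1)[of "-S"] by simp
qed

lemma primitive_has_weak_deriv:
  assumes "primitive f g"
  shows "has_weak_deriv 1 f g"
proof -
  show ?thesis
    unfolding has_weak_deriv_def
  proof (intro conjI allI impI)
    show "f \<in> L1_loc" by (intro L1_loc_continuous primitive_continuous[OF assms])
    show "g \<in> L1_loc" using assms by (simp add: primitive_def)
    show "(LINT x|lborel. f x * dir_deriv 1 \<phi> x) = - (LINT x|lborel. g x * \<phi> x)"
      if "test_function \<phi>" for \<phi>
      by (rule integral_by_parts_test_function(3)[OF assms that])
  qed
qed

lemma has_weak_deriv_primitive:
  assumes "has_weak_deriv 1 f g" "continuous_on UNIV f"
  shows "primitive f g"
  unfolding primitive_def
proof (intro conjI allI impI)
  show "g \<in> L1_loc" using assms(1) by (simp add: has_weak_deriv_def)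
  show "f b - f a = (LINT x:{a..b}|lborel. g x)" if "a \<le> b" for a b
    by (rule weak_deriv_primitive[OF assms that])
qed

text \<open>The Cauchy--Schwarz inequality, obtained from the nonnegativity of the variance of \<open>g\<close> on the
interval.\<close>

lemma square_increment_le:
  assumes f: "primitive f g" and "x \<le> y" and g: "set_integrable lborel {x..y} (\<lambda>z. (g z)\<^sup>2)"
  shows "(f y - f x)\<^sup>2 \<le> (y - x) * (LINT z:{x..y}|lborel. (g z)\<^sup>2)"
proof (cases "x = y")
  case False
  with \<open>x \<le> y\<close> have "x < y" by simp
  define G where "G = f y - f x"
  \<comment> \<open>the mean of \<open>g\<close> on the interval\<close>
  define k where "k = G / (y - x)"
  have gi: "set_integrable lborel {x..y} g"
    using f by (auto simp: primitive_def intro: L1_loc_integrable_Icc)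
  have G: "G = (LINT z:{x..y}|lborel. g z)" using f \<open>x \<le> y\<close> by (simp add: primitive_def G_def)
  have c: "set_integrable lborel {x..y} (\<lambda>_. k\<^sup>2)" by (intro borel_integrable_atLeastAtMost' continuous_intros)
  have "0 \<le> (LINT z:{x..y}|lborel. (g z - k)\<^sup>2)"
    unfolding set_lebesgue_integral_def by (intro integral_nonneg_AE AE_I2) (simp add: indicator_def)
  also have "(LINT z:{x..y}|lborel. (g z - k)\<^sup>2) = (LINT z:{x..y}|lborel. (g z)\<^sup>2 + k\<^sup>2 - 2 * k * g z)"
    by (simp add: power2_diff algebra_simps)
  also have "\<dots> = (LINT z:{x..y}|lborel. (g z)\<^sup>2) + (y - x) * k\<^sup>2 - 2 * k * G"
    using \<open>x < y\<close> g gi c by (simp add: set_integral_diff set_integral_add G) (simp add: set_lebesgue_integral_def)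
  also have "\<dots> = (LINT z:{x..y}|lborel. (g z)\<^sup>2) - G\<^sup>2 / (y - x)"
    using \<open>x < y\<close> by (simp add: k_def power2_eq_square divide_simps)
  finally show ?thesis using \<open>x < y\<close> by (simp add: G_def field_simps)
qed simp

lemma primitive_derivative:
  assumes "primitive A K" "continuous_on UNIV K"
  shows "(A has_real_derivative K t) (at t)"
proof -
  have c: "continuous_on {t-1..t+1} K" using assms(2) by (rule continuous_on_subset) simp
  have A: "A s = A (t - 1) + integral {t-1..s} K" if "s \<in> {t-1..t+1}" for s
  proof -
    have "A s - A (t - 1) = (LINT z:{t-1..s}|lborel. K z)"
      using assms that by (simp add: primitive_def)
    also have "\<dots> = integral {t-1..s} K"
      using assms by (intro set_borel_integral_eq_integral(2) L1_loc_integrable_Icc) (simp add: primitive_def)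
    finally show ?thesis by simp
  qed
  have "((\<lambda>s. integral {t-1..s} K) has_real_derivative K t) (at t within {t-1..t+1})"
    by (rule integral_has_real_derivative[OF c]) simp
  then have "((\<lambda>s. A (t - 1) + integral {t-1..s} K) has_real_derivative K t) (at t within {t-1..t+1})"
    by (auto intro!: derivative_eq_intros)
  then have "(A has_real_derivative K t) (at t within {t-1..t+1})"
  proof (rule has_field_derivative_transform_within[where d = 1])
    show "A (t - 1) + integral {t-1..x} K = A x" if "x \<in> {t-1..t+1}" for x
      by (rule A[OF that, symmetric])
  qed auto
  moreover have "at t within {t-1..t+1} = at t" by (rule at_within_interior) simp
  ultimately show ?thesis by simp
qed

lemma integrable_indicator_Icc [simp]: "integrable lborel (indicat_real {a..b::real})"
  by (rule integrable_real_indicator) (auto simp: emeasure_lborel_Icc_eq)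

text \<open>The positive and the negative part of \<open>h\<close> are the densities of two finite measures with the
same distribution function, hence of the same measure.\<close>

lemma integral_halflines_zero_imp_AE_zero:
  fixes h :: "real \<Rightarrow> real"
  assumes h: "integrable lborel h" and zero: "\<And>x. (LINT y:{..x}|lborel. h y) = 0"
  shows "AE y in lborel. h y = 0"
proof -
  have [measurable]: "h \<in> borel_measurable borel" using h by auto
  let ?P = "density lborel (\<lambda>y. ennreal (max 0 (h y)))"
  let ?N = "density lborel (\<lambda>y. ennreal (max 0 (- h y)))"
  have i: "integrable lborel (\<lambda>y. max 0 (h y))" "integrable lborel (\<lambda>y. max 0 (- h y))"
    using h by auto
  have em: "emeasure (density lborel (\<lambda>y. ennreal (f y))) A = ennreal (LINT y:A|lborel. f y)"
    if f: "integrable lborel f" "\<And>y. 0 \<le> f y" and A: "A \<in> sets borel" for f :: "real \<Rightarrow> real" and A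
  proof -
    have [measurable]: "A \<in> sets borel" "f \<in> borel_measurable borel" using f A by auto
    have "emeasure (density lborel (\<lambda>y. ennreal (f y))) A = (\<integral>\<^sup>+y. ennreal (indicator A y *\<^sub>R f y) \<partial>lborel)"
      by (subst emeasure_density) (auto intro!: nn_integral_cong simp: indicator_def)
    also have "\<dots> = ennreal (LINT y:A|lborel. f y)"
      unfolding set_lebesgue_integral_def
      by (rule nn_integral_eq_integral) (use f in \<open>auto intro!: integrable_mult_indicator[of A lborel f, simplified]\<close>)
    finally show ?thesis .
  qed
  have "?P = ?N"
  proof (rule cdf_unique')
    have fb: "finite_borel_measure (density lborel (\<lambda>y. ennreal (f y)))"
      if "integrable lborel f" "\<And>y. 0 \<le> f y" for f :: "real \<Rightarrow> real"
    proof (intro finite_borel_measure.intro finite_borel_measure_axioms.intro finite_measureI)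
      show "emeasure (density lborel (\<lambda>y. ennreal (f y))) (space (density lborel (\<lambda>y. ennreal (f y)))) \<noteq> \<infinity>"
        using em[OF that, of UNIV] by simp
    qed simp
    show "finite_borel_measure ?P" "finite_borel_measure ?N" by (intro fb i; simp)+
    show "cdf ?P = cdf ?N"
    proof
      fix x
      have "(LINT y:{..x}|lborel. max 0 (h y)) - (LINT y:{..x}|lborel. max 0 (- h y)) = (LINT y:{..x}|lborel. max 0 (h y) - max 0 (- h y))"
        unfolding set_integrable_def
        by (intro set_integral_diff(2)[symmetric]; unfold set_integrable_def; intro integrable_mult_indicator i; simp)
      also have "\<dots> = (LINT y:{..x}|lborel. h y)"
        by (rule arg_cong[where f = "set_lebesgue_integral lborel {..x}"]) (auto simp: max_def)
      finally have "(LINT y:{..x}|lborel. max 0 (h y)) = (LINT y:{..x}|lborel. max 0 (- h y))"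
        using zero by simp
      moreover have "emeasure ?P {..x} = ennreal (LINT y:{..x}|lborel. max 0 (h y))"
        "emeasure ?N {..x} = ennreal (LINT y:{..x}|lborel. max 0 (- h y))"
        by (rule em[OF i(1)], simp, simp, rule em[OF i(2)], simp, simp)
      ultimately show "cdf ?P x = cdf ?N x"
        unfolding cdf_def measure_def by (simp only:)
    qed
  qed
  from sigma_finite_measure.density_unique[OF sigma_finite_lborel _ _ this]
  have "AE y in lborel. ennreal (max 0 (h y)) = ennreal (max 0 (- h y))"
    by measurable
  then show ?thesis
    by eventually_elim (auto simp: max_def split: if_splits)
qed

lemma primitive_unique:
  assumes "primitive f g" "primitive f g'"
  shows "AE x in lborel. g x = g' x"
proof -
  have loc: "g \<in> L1_loc" "g' \<in> L1_loc" using assms by (auto simp: primitive_def)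
  have z: "(LINT x:{a..b}|lborel. g x - g' x) = 0" if "a \<le> b" for a b
  proof -
    have "(LINT x:{a..b}|lborel. g x) = f b - f a" "(LINT x:{a..b}|lborel. g' x) = f b - f a"
      using assms that unfolding primitive_def by metis+
    then show ?thesis by (simp add: set_integral_diff L1_loc_integrable_Icc loc)
  qed
  have "AE x in lborel. indicator {- real n..real n} x * (g x - g' x) = 0" for n
  proof (rule integral_halflines_zero_imp_AE_zero)
    show "integrable lborel (\<lambda>x. indicator {- real n..real n} x * (g x - g' x))"
      using set_integral_diff(1)[OF L1_loc_integrable_Icc[OF loc(1)] L1_loc_integrable_Icc[OF loc(2)], of "- real n" "real n"]
      by (simp add: set_integrable_def)
    fix x
    have "(LINT y:{..x}|lborel. indicator {- real n..real n} y * (g y - g' y))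
        = (LINT y:{- real n..min x (real n)}|lborel. g y - g' y)"
      unfolding set_lebesgue_integral_def
      by (intro Bochner_Integration.integral_cong) (auto simp: indicator_def)
    also have "\<dots> = 0"
    proof (cases "- real n \<le> min x (real n)")
      case True
      then show ?thesis by (rule z)
    next
      case False
      then have "{- real n..min x (real n)} = {}"
        by (intro atLeastatMost_empty) linarith
      then show ?thesis by (simp add: set_lebesgue_integral_def)
    qed
    finally show "(LINT y:{..x}|lborel. indicator {- real n..real n} y * (g y - g' y)) = 0" .
  qed
  then have "AE x in lborel. \<forall>n. indicator {- real n..real n} x * (g x - g' x) = 0"
    by (rule iffD2[OF AE_all_countable, OF allI])
  then show ?thesis
  proof eventually_elim
    case (elim x)
    obtain n where "\<bar>x\<bar> \<le> real n" using real_arch_simple by blast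
    then show ?case using elim[rule_format, of n] by (auto simp: indicator_def abs_le_iff)
  qed
qed

section \<open>Test functions on the plane\<close>

lemma Ck_fst_snd:
  assumes "Ck k f"
  shows "Ck k (\<lambda>p::real \<times> real. f (fst p - c * snd p))"
    and "Ck k (\<lambda>p::real \<times> real. f (fst p))" and "Ck k (\<lambda>p::real \<times> real. f (snd p))"
proof -
  have "bounded_linear (\<lambda>p::real \<times> real. fst p - c * snd p)"
    by (intro bounded_linear_sub bounded_linear_fst bounded_linear_const_mult bounded_linear_snd)
  from Ck_compose_affine[OF this assms, of 0] show "Ck k (\<lambda>p::real \<times> real. f (fst p - c * snd p))" by simp
  from Ck_compose_affine[OF bounded_linear_fst assms, of 0] show "Ck k (\<lambda>p::real \<times> real. f (fst p))" by simp
  from Ck_compose_affine[OF bounded_linear_snd assms, of 0] show "Ck k (\<lambda>p::real \<times> real. f (snd p))" by simp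
qed

lemma test_function_Ck: "test_function \<phi> \<Longrightarrow> Ck k \<phi>"
  by (simp add: test_function_def)

lemma dir_derivI: "(\<phi> has_derivative D) (at p) \<Longrightarrow> dir_deriv b \<phi> p = D b"
  by (simp add: dir_deriv_def frechet_derivativeI)

lemma test_function_tensor:
  assumes "test_function \<eta>" "test_function \<psi>"
  shows "test_function (\<lambda>p::real \<times> real. \<eta> (fst p) * \<psi> (snd p))"
    and "D_t (\<lambda>p. \<eta> (fst p) * \<psi> (snd p)) (x, t) = \<eta> x * dir_deriv 1 \<psi> t"
proof -
  obtain R R' where R: "\<And>x. R < norm x \<Longrightarrow> \<eta> x = 0" "\<And>x. R' < norm x \<Longrightarrow> \<psi> x = 0"
    using test_function_support assms by metis
  show "test_function (\<lambda>p::real \<times> real. \<eta> (fst p) * \<psi> (snd p))"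
  proof (rule test_functionI)
    show "Ck k (\<lambda>p::real \<times> real. \<eta> (fst p) * \<psi> (snd p))" for k
      by (intro Ck_mult Ck_fst_snd test_function_Ck assms)
    show "bounded (cball 0 R \<times> cball 0 R' :: (real \<times> real) set)" by (intro bounded_Times) auto
    show "\<eta> (fst p) * \<psi> (snd p) = 0" if "p \<notin> cball 0 R \<times> cball 0 R'" for p
      using that R by (cases p) (auto simp: not_le)
  qed
  have "((\<lambda>p. \<eta> (fst p) * \<psi> (snd p)) has_derivative
      (\<lambda>b. \<eta> x * (snd b * dir_deriv 1 \<psi> t) + fst b * dir_deriv 1 \<eta> x * \<psi> t)) (at (x, t))"
    using has_derivative_mult[OF
        DERIV_compose_FDERIV[OF test_function_has_real_derivative[OF assms(1), of "fst (x, t)"] has_derivative_fst[OF has_derivative_ident]]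
        DERIV_compose_FDERIV[OF test_function_has_real_derivative[OF assms(2), of "snd (x, t)"] has_derivative_snd[OF has_derivative_ident]]]
    by simp
  from dir_derivI[OF this, of "(0, 1)"]
  show "D_t (\<lambda>p. \<eta> (fst p) * \<psi> (snd p)) (x, t) = \<eta> x * dir_deriv 1 \<psi> t" by simp
qed

lemma test_function_mult_time:
  assumes \<phi>: "test_function (\<phi> :: real \<times> real \<Rightarrow> real)" and \<psi>: "test_function \<psi>"
  shows "test_function (\<lambda>p. \<phi> p * \<psi> (snd p))"
    and "D_t (\<lambda>p. \<phi> p * \<psi> (snd p)) (x, t) = D_t \<phi> (x, t) * \<psi> t + \<phi> (x, t) * dir_deriv 1 \<psi> t"
    and "D_x (\<lambda>p. \<phi> p * \<psi> (snd p)) (x, t) = D_x \<phi> (x, t) * \<psi> t"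
proof -
  obtain R where R: "\<And>x. R < norm x \<Longrightarrow> \<phi> x = 0"
    using test_function_support \<phi> by metis
  show "test_function (\<lambda>p. \<phi> p * \<psi> (snd p))"
  proof (rule test_functionI)
    show "Ck k (\<lambda>p. \<phi> p * \<psi> (snd p))" for k
      by (intro Ck_mult Ck_fst_snd test_function_Ck assms)
    show "bounded (cball 0 R :: (real \<times> real) set)" by auto
    show "\<phi> p * \<psi> (snd p) = 0" if "p \<notin> cball 0 R" for p
      using that R by simp
  qed
  have "(\<phi> has_derivative (\<lambda>b. dir_deriv b \<phi> (x, t))) (at (x, t))"
    using test_function_differentiable[OF \<phi>] unfolding dir_deriv_def by (rule frechet_worksD)
  from has_derivative_mult[OF this
        DERIV_compose_FDERIV[OF test_function_has_real_derivative[OF \<psi>, of "snd (x, t)"] has_derivative_snd[OF has_derivative_ident]]]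
  have "((\<lambda>p. \<phi> p * \<psi> (snd p)) has_derivative
      (\<lambda>b. \<phi> (x, t) * (snd b * dir_deriv 1 \<psi> t) + dir_deriv b \<phi> (x, t) * \<psi> t)) (at (x, t))"
    by simp
  note d = dir_derivI[OF this]
  show "D_t (\<lambda>p. \<phi> p * \<psi> (snd p)) (x, t) = D_t \<phi> (x, t) * \<psi> t + \<phi> (x, t) * dir_deriv 1 \<psi> t"
    "D_x (\<lambda>p. \<phi> p * \<psi> (snd p)) (x, t) = D_x \<phi> (x, t) * \<psi> t"
    unfolding d by simp_all
qed

lemma test_function_bounded:
  assumes "test_function \<phi>"
  obtains B where "0 \<le> B" "\<And>x. \<bar>\<phi> x\<bar> \<le> B"
proof -
  obtain R where R: "0 < R" "\<And>x. R < norm x \<Longrightarrow> \<phi> x = 0"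
    using test_function_support[OF assms] by blast
  obtain B where B: "0 \<le> B" "\<And>x. x \<in> cball 0 R \<Longrightarrow> norm (\<phi> x) \<le> B"
    using compact_continuous_bounded[OF compact_cball test_function_continuous[OF assms]] by blast
  have "\<bar>\<phi> x\<bar> \<le> B" for x
    using B R(2)[of x] by (cases "R < norm x") auto
  then show ?thesis using B(1) that by blast
qed

lemma test_function_uniformly_continuous:
  assumes "test_function \<phi>"
  shows "uniformly_continuous_on UNIV \<phi>"
  unfolding uniformly_continuous_on_def
proof (intro allI impI)
  obtain R where R: "0 < R" "\<And>x. R < norm x \<Longrightarrow> \<phi> x = 0"
    using test_function_support[OF assms] by blast
  fix e :: real assume "0 < e"
  have "uniformly_continuous_on (cball 0 (R + 1)) \<phi>"
    by (intro compact_uniformly_continuous test_function_continuous assms) simp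
  then obtain d where d: "0 < d" "\<And>x y. x \<in> cball 0 (R + 1) \<Longrightarrow> y \<in> cball 0 (R + 1) \<Longrightarrow> dist y x < d \<Longrightarrow> dist (\<phi> y) (\<phi> x) < e"
    using \<open>0 < e\<close> unfolding uniformly_continuous_on_def by metis
  have "dist (\<phi> y) (\<phi> x) < e" if "dist y x < min d 1" for x y
  proof (cases "norm x \<le> R \<or> norm y \<le> R")
    case True
    have "norm y \<le> norm x + 1" "norm x \<le> norm y + 1"
      using that norm_triangle_ineq2[of x y] norm_triangle_ineq2[of y x] by (auto simp: dist_norm norm_minus_commute)
    then show ?thesis using True that by (intro d(2)) auto
  qed (use R \<open>0 < e\<close> in auto)
  then show "\<exists>d>0. \<forall>x\<in>UNIV. \<forall>x'\<in>UNIV. dist x' x < d \<longrightarrow> dist (\<phi> x') (\<phi> x) < e"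
    using d(1) by (intro exI[of _ "min d 1"]) auto
qed

lemma continuous_test_function_slice:
  "test_function (\<phi> :: real \<times> real \<Rightarrow> real) \<Longrightarrow> continuous_on UNIV (\<lambda>x. \<phi> (x, t))"
  by (rule continuous_on_compose2[OF test_function_continuous]) (auto intro!: continuous_intros)

text \<open>Time slices depend continuously on time in the sup-norm. This is what lets weakly continuous
measures be integrated against test functions that move.\<close>

lemma test_function_uniform_limit:
  assumes "test_function (\<phi> :: real \<times> real \<Rightarrow> real)"
  shows "uniform_limit UNIV (\<lambda>s x. \<phi> (x, s)) (\<lambda>x. \<phi> (x, t)) (at t)"
  unfolding uniform_limit_iff
proof (intro allI impI)
  fix e :: real assume "0 < e"
  then obtain d where d: "0 < d" "\<And>x y. dist y x < d \<Longrightarrow> dist (\<phi> y) (\<phi> x) < e"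
    using test_function_uniformly_continuous[OF assms] unfolding uniformly_continuous_on_def by (metis UNIV_I)
  have "\<forall>\<^sub>F s in at t. dist s t < d" using d(1) eventually_at by blast
  then show "\<forall>\<^sub>F s in at t. \<forall>x\<in>UNIV. dist (\<phi> (x, s)) (\<phi> (x, t)) < e"
    by eventually_elim (auto intro!: d(2) simp: dist_Pair_Pair)
qed

lemma integrable_L1_loc_test_function:
  assumes "g \<in> L1_loc" "test_function \<psi>"
  shows "integrable lborel (\<lambda>x. g x * \<psi> x)"
proof -
  obtain R where R: "\<And>x. R < norm x \<Longrightarrow> \<psi> x = 0"
    using test_function_support assms(2) by metis
  have "set_integrable lborel (cball 0 R) (\<lambda>x. g x * \<psi> x)"
    using L1_loc_mult_continuous[OF assms(1) test_function_continuous[OF assms(2)]]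
    by (auto simp: L1_loc_def)
  moreover have "(\<lambda>x. indicator (cball 0 R) x *\<^sub>R (g x * \<psi> x)) = (\<lambda>x. g x * \<psi> x)"
    using R by (auto simp: indicator_def fun_eq_iff not_le)
  ultimately show ?thesis by (simp add: set_integrable_def)
qed

section \<open>Transport of the energy\<close>

text \<open>The initial data enter only as the values at time zero, so the locale does not name them.\<close>

locale hs_solution =
  fixes u :: "real \<Rightarrow> (real \<Rightarrow>\<^sub>C real)" and \<mu> :: "real \<Rightarrow> real measure"
  assumes solution: "conservative_solution (u 0) (\<mu> 0) u \<mu>"
begin

lemma finite_borel: "finite_borel_measure (\<mu> t)"
  using solution by (simp add: conservative_solution_def)

lemma space_\<mu> [simp]: "space (\<mu> t) = UNIV"
  by (simp add: finite_borel_measure.borel_UNIV finite_borel)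

lemma sets_\<mu> [simp, measurable_cong]: "sets (\<mu> t) = sets borel"
  by (simp add: finite_borel_measure.M_is_borel finite_borel)

lemma finite_\<mu>: "finite_measure (\<mu> t)"
  by (intro finite_borel_measure.axioms finite_borel)

lemma continuous_u: "continuous_on UNIV u"
  using solution by (simp add: conservative_solution_def)

lemma integrable_bounded_continuous:
  assumes "continuous_on UNIV (f :: real \<Rightarrow> real)" "\<And>x. \<bar>f x\<bar> \<le> B"
  shows "integrable (\<mu> t) f"
  by (rule finite_measure.integrable_const_bound[OF finite_\<mu>, of _ B])
     (use assms in \<open>auto intro!: borel_measurable_continuous_onI simp: measurable_cong_sets[OF sets_\<mu> refl]\<close>)

lemma weak_continuity:
  assumes "continuous_on UNIV (f :: real \<Rightarrow> real)" "\<And>x. \<bar>f x\<bar> \<le> B"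
  shows "continuous_on UNIV (\<lambda>t. LINT x|\<mu> t. f x)"
proof -
  have "f \<in> bcontfun"
    unfolding bcontfun_def using assms by (auto intro!: boundedI[of _ B])
  then have "apply_bcontfun (Bcontfun f) = f" by (rule Bcontfun_inverse)
  moreover have "continuous_on UNIV (\<lambda>t. LINT x|\<mu> t. apply_bcontfun (Bcontfun f) x)"
    using solution unfolding conservative_solution_def weakly_continuous_def by blast
  ultimately show ?thesis by simp
qed

lemma continuous_mass: "continuous_on UNIV (\<lambda>t. measure (\<mu> t) UNIV)"
  using weak_continuity[of "\<lambda>_. 1" 1] by simp

text \<open>Weak continuity controls a fixed integrand; the change of the integrand is controlled by its
sup-norm times the locally bounded total mass.\<close>

lemma continuous_integral_curve:
  fixes g :: "real \<Rightarrow> real \<Rightarrow> real"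
  assumes c: "\<And>t. continuous_on UNIV (g t)" and b: "\<And>t x. \<bar>g t x\<bar> \<le> B t"
    and lim: "\<And>t. uniform_limit UNIV g (g t) (at t)"
  shows "continuous_on UNIV (\<lambda>t. LINT x|\<mu> t. g t x)"
proof (rule continuous_at_imp_continuous_on, safe)
  fix t0
  have int: "integrable (\<mu> t) (g s)" for s t
    by (rule integrable_bounded_continuous[OF c b])
  have fixed: "((\<lambda>t. LINT x|\<mu> t. g t0 x) \<longlongrightarrow> (LINT x|\<mu> t0. g t0 x)) (at t0)"
    using weak_continuity[OF c b, of t0] by (simp add: continuous_on_eq_continuous_at isCont_def)
  have "((\<lambda>t. (LINT x|\<mu> t. g t x) - (LINT x|\<mu> t. g t0 x)) \<longlongrightarrow> 0) (at t0)"
  proof (rule tendstoI)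
    fix e :: real assume "0 < e"
    define M where "M = measure (\<mu> t0) UNIV + 1"
    have "0 < M" by (simp add: M_def add_nonneg_pos)
    have "((\<lambda>t. measure (\<mu> t) UNIV) \<longlongrightarrow> measure (\<mu> t0) UNIV) (at t0)"
      using continuous_mass by (simp add: continuous_on_eq_continuous_at isCont_def)
    then have "\<forall>\<^sub>F t in at t0. measure (\<mu> t) UNIV < M"
      by (rule order_tendstoD) (simp add: M_def)
    moreover have "\<forall>\<^sub>F t in at t0. \<forall>x\<in>UNIV. dist (g t x) (g t0 x) < e / (2 * M)"
      using lim[of t0] \<open>0 < M\<close> \<open>0 < e\<close> by (auto simp: uniform_limit_iff)
    ultimately show "\<forall>\<^sub>F t in at t0. dist ((LINT x|\<mu> t. g t x) - (LINT x|\<mu> t. g t0 x)) 0 < e"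
    proof eventually_elim
      case (elim t)
      have "\<bar>(LINT x|\<mu> t. g t x) - (LINT x|\<mu> t. g t0 x)\<bar> = \<bar>LINT x|\<mu> t. g t x - g t0 x\<bar>"
        using int by simp
      also have "\<dots> \<le> (LINT x|\<mu> t. \<bar>g t x - g t0 x\<bar>)" by (rule integral_abs_bound)
      also have "\<dots> \<le> (LINT x|\<mu> t. e / (2 * M))"
        using elim(2) int finite_measure.integrable_const[OF finite_\<mu>]
        by (intro integral_mono) (auto simp: dist_real_def less_imp_le)
      also have "\<dots> = measure (\<mu> t) UNIV * (e / (2 * M))" by simp
      also have "\<dots> \<le> M * (e / (2 * M))"
        using elim(1) \<open>0 < e\<close> \<open>0 < M\<close> by (intro mult_right_mono) auto
      also have "\<dots> < e" using \<open>0 < e\<close> \<open>0 < M\<close> by simp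
      finally show ?case by simp
    qed
  qed
  from tendsto_add[OF this fixed] show "isCont (\<lambda>t. LINT x|\<mu> t. g t x) t0"
    by (simp add: isCont_def)
qed

lemma uniform_limit_u: "uniform_limit UNIV (\<lambda>t. apply_bcontfun (u t)) (u t) (at t)"
  unfolding uniform_limit_iff
proof (intro allI impI)
  fix e :: real assume "0 < e"
  have "(u \<longlongrightarrow> u t) (at t)" using continuous_u by (simp add: continuous_on_eq_continuous_at isCont_def)
  then have "\<forall>\<^sub>F s in at t. dist (u s) (u t) < e" using \<open>0 < e\<close> by (rule tendstoD)
  then show "\<forall>\<^sub>F s in at t. \<forall>x\<in>UNIV. dist (apply_bcontfun (u s) x) (apply_bcontfun (u t) x) < e"
    by eventually_elim (auto intro: dist_fun_lt_imp_dist_val_lt)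
qed

lemma continuous_u_space: "continuous_on S (apply_bcontfun (u t))"
  by (metis continuous_on_apply_bcontfun continuous_on_subset subset_UNIV)

lemma u_le_norm: "\<bar>u t x\<bar> \<le> norm (u t)"
  using norm_bounded[of "u t" x] by simp

lemma norm_u_bounded_on:
  obtains B where "0 \<le> B" "\<And>t x. t \<in> {a..b} \<Longrightarrow> \<bar>u t x\<bar> \<le> B"
proof -
  obtain B where B: "0 \<le> B" "\<And>t. t \<in> {a..b} \<Longrightarrow> norm (u t) \<le> B"
    using compact_continuous_bounded[OF compact_Icc continuous_u] by blast
  show ?thesis by (rule that[OF B(1)]) (rule order_trans[OF u_le_norm B(2)])
qed

lemma jointly_continuous_u: "continuous_on UNIV (\<lambda>p. u (snd p) (fst p))"
proof (rule continuous_at_imp_continuous_on, safe)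
  fix x t :: real
  have "((\<lambda>p. u (snd p) (fst p) - u t (fst p)) \<longlongrightarrow> 0) (at (x, t))"
  proof (rule Lim_null_comparison)
    show "\<forall>\<^sub>F p in at (x, t). norm (u (snd p) (fst p) - u t (fst p)) \<le> dist (u (snd p)) (u t)"
      using dist_bounded[of "u _" _ "u t"] by (auto simp: dist_real_def intro!: always_eventually)
    have "continuous_on UNIV (\<lambda>p :: real \<times> real. u (snd p))"
      by (rule continuous_on_compose2[OF continuous_u]) (auto intro!: continuous_intros)
    then have "isCont (\<lambda>p. u (snd p)) (x, t)" by (simp add: continuous_on_eq_continuous_at)
    then have "((\<lambda>p. u (snd p)) \<longlongrightarrow> u t) (at (x, t))" by (simp add: isCont_def)
    from tendsto_dist[OF this tendsto_const[of "u t"]]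
    show "((\<lambda>p. dist (u (snd p)) (u t)) \<longlongrightarrow> 0) (at (x, t))" by simp
  qed
  moreover have "isCont (\<lambda>p. u t (fst p)) (x, t)"
  proof -
    have "continuous_on UNIV (\<lambda>p :: real \<times> real. u t (fst p))"
      by (rule continuous_on_compose2[OF continuous_u_space]) (auto intro!: continuous_intros)
    then show ?thesis by (simp add: continuous_on_eq_continuous_at)
  qed
  then have "((\<lambda>p. u t (fst p)) \<longlongrightarrow> u t x) (at (x, t))" by (simp add: isCont_def)
  ultimately show "isCont (\<lambda>p. u (snd p) (fst p)) (x, t)"
    using tendsto_add by (fastforce simp: isCont_def)
qed

text \<open>The continuity equation, integrated over a time interval: the test function is multiplied by a
cutoff in time, and the resulting weak derivative in time is continuous.\<close>

lemma transport:
  fixes \<phi> :: "real \<times> real \<Rightarrow> real"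
  assumes \<phi>: "test_function \<phi>" and "a \<le> b"
  shows "\<And>t. integrable (\<mu> t) (\<lambda>x. D_t \<phi> (x, t) + u t x * D_x \<phi> (x, t))"
    and "continuous_on UNIV (\<lambda>t. LINT x|\<mu> t. D_t \<phi> (x, t) + u t x * D_x \<phi> (x, t))"
    and "(LINT x|\<mu> b. \<phi> (x, b)) - (LINT x|\<mu> a. \<phi> (x, a))
      = (LINT t:{a..b}|lborel. LINT x|\<mu> t. D_t \<phi> (x, t) + u t x * D_x \<phi> (x, t))"
proof -
  note d = test_function_dir_deriv[OF \<phi>]
  define A where "A t = (LINT x|\<mu> t. \<phi> (x, t))" for t
  define K where "K t = (LINT x|\<mu> t. D_t \<phi> (x, t) + u t x * D_x \<phi> (x, t))" for t
  note sl = continuous_test_function_slice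
  obtain B0 B1 B2 where B: "\<And>p. \<bar>\<phi> p\<bar> \<le> B0" "\<And>p. \<bar>D_t \<phi> p\<bar> \<le> B1" "\<And>p. \<bar>D_x \<phi> p\<bar> \<le> B2"
    using test_function_bounded[OF \<phi>] test_function_bounded[OF d] by metis
  have bnd: "\<bar>D_t \<phi> (x, t) + u t x * D_x \<phi> (x, t)\<bar> \<le> B1 + norm (u t) * B2" for x t
  proof -
    have "\<bar>D_t \<phi> (x, t) + u t x * D_x \<phi> (x, t)\<bar> \<le> \<bar>D_t \<phi> (x, t)\<bar> + \<bar>u t x\<bar> * \<bar>D_x \<phi> (x, t)\<bar>"
      by (metis abs_mult abs_triangle_ineq)
    also have "\<dots> \<le> B1 + norm (u t) * B2"
      by (intro add_mono mult_mono B u_le_norm) auto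
    finally show ?thesis .
  qed
  have cK0: "continuous_on UNIV (\<lambda>x. D_t \<phi> (x, t) + u t x * D_x \<phi> (x, t))" for t
    by (intro continuous_intros sl d continuous_u_space)
  have int: "integrable (\<mu> t) (\<lambda>x. D_t \<phi> (x, t) + u t x * D_x \<phi> (x, t))" for t
    by (rule integrable_bounded_continuous[OF cK0 bnd])
  then show "integrable (\<mu> t) (\<lambda>x. D_t \<phi> (x, t) + u t x * D_x \<phi> (x, t))" for t .
  have cA: "continuous_on UNIV A" unfolding A_def
    by (rule continuous_integral_curve[OF sl[OF \<phi>] B(1) test_function_uniform_limit[OF \<phi>]])
  have cK: "continuous_on UNIV K" unfolding K_def
  proof (rule continuous_integral_curve[OF cK0 bnd])
    fix t
    show "uniform_limit UNIV (\<lambda>t x. D_t \<phi> (x, t) + u t x * D_x \<phi> (x, t))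
        (\<lambda>x. D_t \<phi> (x, t) + u t x * D_x \<phi> (x, t)) (at t)"
      by (intro uniform_limit_add uniform_lim_mult test_function_uniform_limit d uniform_limit_u)
         (auto intro!: boundedI[of _ "norm (u t)"] boundedI[of _ B2] u_le_norm B)
  qed
  then show "continuous_on UNIV (\<lambda>t. LINT x|\<mu> t. D_t \<phi> (x, t) + u t x * D_x \<phi> (x, t))"
    by (simp add: K_def)
  have "has_weak_deriv 1 A K"
    unfolding has_weak_deriv_def
  proof (intro conjI allI impI L1_loc_continuous cA cK)
    fix \<psi> :: "real \<Rightarrow> real" assume \<psi>: "test_function \<psi>"
    have i: "integrable (\<mu> t) (\<lambda>x. D_t \<phi> (x, t) + u t x * D_x \<phi> (x, t))" "integrable (\<mu> t) (\<lambda>x. \<phi> (x, t))" for t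
      by (rule int, rule integrable_bounded_continuous[OF sl[OF \<phi>] B(1)])
    have "(LINT x|\<mu> t. D_t (\<lambda>p. \<phi> p * \<psi> (snd p)) (x, t) + u t x * D_x (\<lambda>p. \<phi> p * \<psi> (snd p)) (x, t))
        = K t * \<psi> t + A t * dir_deriv 1 \<psi> t" for t
    proof -
      have "(LINT x|\<mu> t. D_t (\<lambda>p. \<phi> p * \<psi> (snd p)) (x, t) + u t x * D_x (\<lambda>p. \<phi> p * \<psi> (snd p)) (x, t))
        = (LINT x|\<mu> t. (D_t \<phi> (x, t) + u t x * D_x \<phi> (x, t)) * \<psi> t + \<phi> (x, t) * dir_deriv 1 \<psi> t)"
        by (intro Bochner_Integration.integral_cong refl) (simp add: test_function_mult_time[OF \<phi> \<psi>] algebra_simps)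
      also have "\<dots> = K t * \<psi> t + A t * dir_deriv 1 \<psi> t"
        unfolding K_def A_def
        by (subst Bochner_Integration.integral_add) (use i[of t] in auto)
      finally show ?thesis .
    qed
    moreover have "(LINT t|lborel. LINT x|\<mu> t. D_t (\<lambda>p. \<phi> p * \<psi> (snd p)) (x, t) + u t x * D_x (\<lambda>p. \<phi> p * \<psi> (snd p)) (x, t)) = 0"
      using solution test_function_mult_time(1)[OF \<phi> \<psi>] unfolding conservative_solution_def by blast
    ultimately have "(LINT t|lborel. K t * \<psi> t + A t * dir_deriv 1 \<psi> t) = 0" by simp
    moreover have "integrable lborel (\<lambda>t. K t * \<psi> t)" "integrable lborel (\<lambda>t. A t * dir_deriv 1 \<psi> t)"
      by (intro integrable_L1_loc_test_function L1_loc_continuous cA cK \<psi> test_function_dir_deriv)+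
    ultimately show "(LINT t|lborel. A t * dir_deriv 1 \<psi> t) = - (LINT t|lborel. K t * \<psi> t)"
      by simp
  qed
  from weak_deriv_primitive[OF this cA \<open>a \<le> b\<close>]
  show "(LINT x|\<mu> b. \<phi> (x, b)) - (LINT x|\<mu> a. \<phi> (x, a))
      = (LINT t:{a..b}|lborel. LINT x|\<mu> t. D_t \<phi> (x, t) + u t x * D_x \<phi> (x, t))"
    by (simp add: A_def K_def)
qed


text \<open>The profile \<open>h(x - c t)\<close> moves with speed \<open>c\<close>, and \<open>h' (u - c)\<close> is the rate at which the fluid
crosses it. The function \<open>h\<close> has no compact support, so it is cut off at distance \<open>n\<close>; the
cutoff has slope \<open>O(1/n)\<close> and \<open>u\<close> is bounded, so the error vanishes as \<open>n\<close> grows.\<close>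

lemma monotone_mass_function:
  fixes h h' :: "real \<Rightarrow> real"
  assumes smooth: "\<And>k. Ck k h" and bd: "\<And>x. \<bar>h x\<bar> \<le> 1"
    and h': "\<And>x. (h has_real_derivative h' x) (at x)" and ab: "a \<le> b"
    and sgn: "\<And>t x. t \<in> {a..b} \<Longrightarrow> 0 \<le> h' (x - c * t) * (u t x - c)"
  shows "(LINT x|\<mu> a. h (x - c * a)) \<le> (LINT x|\<mu> b. h (x - c * b))"
proof -
  obtain U where U: "0 \<le> U" "\<And>t x. t \<in> {a..b} \<Longrightarrow> \<bar>u t x\<bar> \<le> U"
    using norm_u_bounded_on by blast
  obtain M where M: "\<And>t. t \<in> {a..b} \<Longrightarrow> norm (measure (\<mu> t) UNIV) \<le> M"
    using compact_continuous_bounded[OF compact_Icc continuous_mass, of a b] by blast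
  obtain C where C_nonneg: "0 \<le> C" and "\<And>x. x \<in> {0..1} \<Longrightarrow> norm (smooth_bump x) \<le> C"
    using compact_continuous_bounded[OF compact_Icc continuous_smooth_bump, of 0 1] by blast
  then have C: "\<bar>smooth_bump x\<bar> \<le> C" for x
    by (cases "x \<in> {0..1}") (auto simp: smooth_bump_outside)
  \<comment> \<open>spatial cutoff at scale \<open>n\<close>, and a temporal one that is \<open>1\<close> near \<open>[a, b]\<close>\<close>
  define P where "P n x = smooth_step (x / real (Suc n) + 2) * smooth_step (2 - x / real (Suc n))" for n x
  define P' where "P' n x = (smooth_bump (x / real (Suc n) + 2) * smooth_step (2 - x / real (Suc n))
      - smooth_step (x / real (Suc n) + 2) * smooth_bump (2 - x / real (Suc n))) / real (Suc n)" for n x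
  define \<eta> where "\<eta> t = smooth_step (t - a + 2) * smooth_step (b + 2 - t)" for t
  have P_deriv: "(P n has_real_derivative P' n x) (at x)" for n x
  proof -
    have "((\<lambda>x. smooth_step (x / real (Suc n) + 2)) has_real_derivative
        smooth_bump (x / real (Suc n) + 2) * (1 / real (Suc n))) (at x)"
      "((\<lambda>x. smooth_step (2 - x / real (Suc n))) has_real_derivative
        smooth_bump (2 - x / real (Suc n)) * (- 1 / real (Suc n))) (at x)"
      by (rule DERIV_chain2[OF smooth_step_derivative]; auto intro!: derivative_eq_intros)+
    from DERIV_mult[OF this] show ?thesis
      unfolding P_def[abs_def] P'_def
      by (rule DERIV_cong) (simp add: diff_divide_distrib mult.commute del: of_nat_Suc)
  qed
  have P_bounds: "0 \<le> P n x" "P n x \<le> 1" for n x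
    unfolding P_def by (auto intro!: mult_nonneg_nonneg mult_le_one smooth_step_bounds)
  have P'_bound: "\<bar>P' n x\<bar> \<le> 2 * C / real (Suc n)" for n x
  proof -
    have "\<bar>smooth_bump y * smooth_step z\<bar> \<le> C" for y z
      using mult_mono[OF C[of y], of "smooth_step z" 1] smooth_step_bounds[of z] C_nonneg by (simp add: abs_mult)
    from this[of "x / real (Suc n) + 2" "2 - x / real (Suc n)"] this[of "2 - x / real (Suc n)" "x / real (Suc n) + 2"]
    have "\<bar>smooth_bump (x / real (Suc n) + 2) * smooth_step (2 - x / real (Suc n))
      - smooth_step (x / real (Suc n) + 2) * smooth_bump (2 - x / real (Suc n))\<bar> \<le> 2 * C"
      by (simp add: mult.commute del: of_nat_Suc)
    then show ?thesis unfolding P'_def abs_divide abs_of_nat by (intro divide_right_mono) simp_all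
  qed
  have P_outside: "P n x = 0" if "2 * real (Suc n) < \<bar>x\<bar>" for n x
  proof (cases "0 \<le> x")
    case True
    then show ?thesis using that by (simp add: P_def smooth_step_eq_0 field_simps)
  next
    case False
    then have "x / real (Suc n) + 2 \<le> 0" using that by (simp add: field_simps)
    then show ?thesis by (simp add: P_def smooth_step_eq_0)
  qed
  have \<eta>_outside: "\<eta> t = 0" if "t \<notin> {a - 2..b + 2}" for t
    using that by (auto simp: \<eta>_def smooth_step_eq_0)
  have \<eta>_one: "\<eta> t = 1" if "t \<in> {a - 1..b + 1}" for t
    using that by (simp add: \<eta>_def smooth_step_eq_1)
  have \<eta>_deriv: "(\<eta> has_real_derivative 0) (at t)" if "t \<in> {a..b}" for t
    by (rule has_field_derivative_transform_within_open[of "\<lambda>_. 1" 0 t "{a - 1<..<b + 1}"])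
       (use that \<eta>_one in auto)
  define \<phi> where "\<phi> n p = h (fst p - c * snd p) * P n (fst p) * \<eta> (snd p)" for n and p :: "real \<times> real"
  have test: "test_function (\<phi> n)" for n
  proof (rule test_functionI)
    have "Ck k (\<lambda>x. smooth_step (x / real (Suc n) + 2))" for k
      using Ck_compose_affine[OF bounded_linear_divide[of "real (Suc n)"] Ck_smooth_step] by simp
    moreover have "Ck k (\<lambda>x. smooth_step (2 - x / real (Suc n)))" for k
      using Ck_compose_affine[OF bounded_linear_minus[OF bounded_linear_divide[of "real (Suc n)"]] Ck_smooth_step, of k 2] by simp
    ultimately have "Ck k (P n)" for k
      unfolding P_def[abs_def] by (intro Ck_mult)
    moreover have "Ck k \<eta>" for k
      using Ck_compose_affine[OF bounded_linear_ident Ck_smooth_step, of k "2 - a"]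
        Ck_compose_affine[OF bounded_linear_minus[OF bounded_linear_ident] Ck_smooth_step, of k "b + 2"]
      unfolding \<eta>_def[abs_def] by (intro Ck_mult) (simp_all add: algebra_simps)
    ultimately show "Ck k (\<phi> n)" for k
      unfolding \<phi>_def[abs_def] by (intro Ck_mult Ck_fst_snd smooth)
    show "bounded (cball 0 (2 * real (Suc n)) \<times> {a - 2..b + 2})" by (intro bounded_Times) auto
    show "\<phi> n p = 0" if "p \<notin> cball 0 (2 * real (Suc n)) \<times> {a - 2..b + 2}" for p
      using that P_outside[of n "fst p"] \<eta>_outside[of "snd p"] by (cases p) (auto simp: \<phi>_def not_le)
  qed
  have deriv: "D_t (\<phi> n) (x, t) = - c * h' (x - c * t) * P n x"
    "D_x (\<phi> n) (x, t) = h' (x - c * t) * P n x + h (x - c * t) * P' n x" if t: "t \<in> {a..b}" for n x t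
  proof -
    have lin: "((\<lambda>p. fst p - c * snd p) has_derivative (\<lambda>p. fst p - c * snd p)) (at (x, t))"
      by (auto intro!: derivative_eq_intros)
    have "(\<phi> n has_derivative (\<lambda>p. (fst p - c * snd p) * h' (x - c * t) * P n x
        + h (x - c * t) * (fst p * P' n x))) (at (x, t))"
      unfolding \<phi>_def[abs_def]
      by (rule has_derivative_eq_rhs[OF has_derivative_mult[OF has_derivative_mult[OF
            DERIV_compose_FDERIV[OF h' lin]
            DERIV_compose_FDERIV[OF P_deriv has_derivative_fst[OF has_derivative_ident]]]
            DERIV_compose_FDERIV[OF _ has_derivative_snd[OF has_derivative_ident]]]])
         (use \<eta>_deriv[OF t] \<eta>_one[of t] t in \<open>auto simp: algebra_simps\<close>)
    note d = dir_derivI[OF this]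
    show "D_t (\<phi> n) (x, t) = - c * h' (x - c * t) * P n x"
      "D_x (\<phi> n) (x, t) = h' (x - c * t) * P n x + h (x - c * t) * P' n x"
      unfolding d by simp_all
  qed
  define K where "K n t = (LINT x|\<mu> t. D_t (\<phi> n) (x, t) + u t x * D_x (\<phi> n) (x, t))" for n t
  define e where "e n = U * (2 * C / real (Suc n)) * M" for n
  have K_ge: "- e n \<le> K n t" if t: "t \<in> {a..b}" for n t
  proof -
    have lower: "- (U * (2 * C / real (Suc n))) \<le> D_t (\<phi> n) (x, t) + u t x * D_x (\<phi> n) (x, t)" for x
    proof -
      have "\<bar>u t x * (h (x - c * t) * P' n x)\<bar> \<le> U * (1 * (2 * C / real (Suc n)))"
        unfolding abs_mult using U t C_nonneg by (intro mult_mono bd P'_bound) auto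
      moreover have "D_t (\<phi> n) (x, t) + u t x * D_x (\<phi> n) (x, t)
          = h' (x - c * t) * (u t x - c) * P n x + u t x * (h (x - c * t) * P' n x)"
        unfolding deriv[OF t] by (simp add: algebra_simps)
      moreover have "0 \<le> h' (x - c * t) * (u t x - c) * P n x"
        by (intro mult_nonneg_nonneg[OF sgn[OF t] P_bounds(1)])
      ultimately show ?thesis by linarith
    qed
    have "- e n \<le> - (U * (2 * C / real (Suc n))) * measure (\<mu> t) UNIV"
    proof -
      have "0 \<le> U * (2 * C / real (Suc n))" using U C_nonneg by simp
      moreover have "measure (\<mu> t) UNIV \<le> M" using M t by force
      ultimately have "U * (2 * C / real (Suc n)) * measure (\<mu> t) UNIV \<le> e n"
        unfolding e_def by (intro mult_left_mono)
      then show ?thesis unfolding mult_minus_left by (rule le_imp_neg_le)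
    qed
    also have "\<dots> = (LINT x|\<mu> t. - (U * (2 * C / real (Suc n))))" by simp
    also have "\<dots> \<le> K n t" unfolding K_def
      by (intro integral_mono lower transport(1)[OF test ab] finite_measure.integrable_const[OF finite_\<mu>])
    finally show ?thesis .
  qed
  have step: "- e n * (b - a) \<le> (LINT x|\<mu> b. \<phi> n (x, b)) - (LINT x|\<mu> a. \<phi> n (x, a))" for n
  proof -
    have c: "continuous_on {a..b} (K n)"
      unfolding K_def using transport(2)[OF test ab] by (rule continuous_on_subset) simp
    have "- e n * (b - a) = (LINT t:{a..b}|lborel. - e n)"
      using ab by (simp add: set_lebesgue_integral_def)
    also have "\<dots> \<le> (LINT t:{a..b}|lborel. K n t)"
      by (intro set_integral_mono borel_integrable_atLeastAtMost' c K_ge continuous_intros)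
    also have "\<dots> = (LINT x|\<mu> b. \<phi> n (x, b)) - (LINT x|\<mu> a. \<phi> n (x, a))"
      unfolding K_def using transport(3)[OF test ab] by simp
    finally show ?thesis .
  qed
  have lim: "(\<lambda>n. LINT x|\<mu> t. \<phi> n (x, t)) \<longlonglongrightarrow> (LINT x|\<mu> t. h (x - c * t))" if t: "t \<in> {a..b}" for t
  proof (rule integral_dominated_convergence[where w = "\<lambda>_. 1"])
    have ch: "continuous_on UNIV h" using smooth[of 0] by simp
    have "continuous_on UNIV (\<lambda>x. h (x - c * t))"
      by (rule continuous_on_compose2[OF ch]) (auto intro!: continuous_intros)
    then show "(\<lambda>x. h (x - c * t)) \<in> borel_measurable (\<mu> t)"
      by (auto intro!: borel_measurable_continuous_onI simp: measurable_cong_sets[OF sets_\<mu> refl])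
    show "(\<lambda>x. \<phi> n (x, t)) \<in> borel_measurable (\<mu> t)" for n
      by (auto intro!: borel_measurable_continuous_onI continuous_test_function_slice test simp: measurable_cong_sets[OF sets_\<mu> refl])
    show "integrable (\<mu> t) (\<lambda>_. 1::real)" by (rule finite_measure.integrable_const[OF finite_\<mu>])
    have one: "\<eta> t = 1" using t by (intro \<eta>_one) auto
    show "AE x in \<mu> t. norm (\<phi> n (x, t)) \<le> 1" for n
      using bd P_bounds by (auto simp: \<phi>_def one abs_mult intro!: mult_le_one)
    show "AE x in \<mu> t. (\<lambda>n. \<phi> n (x, t)) \<longlonglongrightarrow> h (x - c * t)"
    proof (rule AE_I2)
      fix x
      have "\<forall>\<^sub>F n in sequentially. \<bar>x\<bar> < real n"
        using filterlim_real_sequentially by (simp add: filterlim_at_top_dense)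
      then have "\<forall>\<^sub>F n in sequentially. \<phi> n (x, t) = h (x - c * t)"
      proof eventually_elim
        case (elim n)
        then have "1 \<le> x / real (Suc n) + 2" "1 \<le> 2 - x / real (Suc n)"
          by (auto simp: field_simps)
        then have "P n x = 1" unfolding P_def by (simp only: smooth_step_eq_1 mult_1_right)
        then show ?case by (simp add: \<phi>_def one)
      qed
      then show "(\<lambda>n. \<phi> n (x, t)) \<longlonglongrightarrow> h (x - c * t)" by (rule tendsto_eventually)
    qed
  qed
  have "(\<lambda>n. inverse (real (Suc n))) \<longlonglongrightarrow> 0" by (rule LIMSEQ_inverse_real_of_nat)
  from tendsto_mult_left[OF this, of "- (U * 2 * C * M) * (b - a)"]
  have "(\<lambda>n. - e n * (b - a)) \<longlonglongrightarrow> 0"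
    by (simp add: e_def divide_inverse algebra_simps del: of_nat_Suc)
  moreover have "(\<lambda>n. (LINT x|\<mu> b. \<phi> n (x, b)) - (LINT x|\<mu> a. \<phi> n (x, a)))
      \<longlonglongrightarrow> (LINT x|\<mu> b. h (x - c * b)) - (LINT x|\<mu> a. h (x - c * a))"
    using ab by (intro tendsto_diff lim) auto
  ultimately have "0 \<le> (LINT x|\<mu> b. h (x - c * b)) - (LINT x|\<mu> a. h (x - c * a))"
    by (rule LIMSEQ_le) (use step in auto)
  then show ?thesis by simp
qed

text \<open>Constant profiles are crossed at rate zero, and both signs of the constant are admissible.\<close>

lemma mass_conserved: "measure (\<mu> t) UNIV = measure (\<mu> 0) UNIV"
proof -
  have le: "measure (\<mu> a) UNIV = measure (\<mu> b) UNIV" if "a \<le> b" for a b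
    using monotone_mass_function[of "\<lambda>_. 1" "\<lambda>_. 0" a b 0]
      monotone_mass_function[of "\<lambda>_. - 1" "\<lambda>_. 0" a b 0] that
    by (simp add: Ck_const)
  show ?thesis using le[of t 0] le[of 0 t] by linarith
qed


section \<open>Quantiles of the energy are characteristics\<close>

definition F :: "real \<Rightarrow> real \<Rightarrow> real" where "F t x = cdf (\<mu> t) x"

definition total_mass :: real where "total_mass = measure (\<mu> 0) UNIV"

lemma F_mono: "x \<le> y \<Longrightarrow> F t x \<le> F t y"
  unfolding F_def by (rule finite_borel_measure.cdf_nondecreasing[OF finite_borel])

lemma F_nonneg: "0 \<le> F t x"
  unfolding F_def by (rule finite_borel_measure.cdf_nonneg[OF finite_borel])

lemma F_le_total_mass: "F t x \<le> total_mass"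
  unfolding F_def total_mass_def
  using finite_borel_measure.cdf_bounded[OF finite_borel, of t x] mass_conserved[of t] by simp

sublocale F: right_continuous_mono "F t" 0 total_mass for t
proof
  interpret finite_borel_measure "\<mu> t" by (rule finite_borel)
  show "continuous (at_right x) (F t)" for x unfolding F_def[abs_def] by (rule cdf_is_right_cont)
  show "mono (F t)" by (intro monoI F_mono)
  show "(F t \<longlongrightarrow> 0) at_bot" unfolding F_def[abs_def] by (rule cdf_lim_at_bot)
  show "(F t \<longlongrightarrow> total_mass) at_top"
    unfolding F_def[abs_def] using cdf_lim_at_top mass_conserved[of t] by (simp add: total_mass_def)
qed

lemma measure_halfline: "measure (\<mu> t) {x<..} = total_mass - F t x"
proof -
  interpret finite_measure "\<mu> t" by (rule finite_\<mu>)
  have "measure (\<mu> t) (space (\<mu> t) - {..x}) = measure (\<mu> t) (space (\<mu> t)) - measure (\<mu> t) {..x}"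
    by (rule finite_measure_compl) simp
  moreover have "{x<..} = UNIV - {..x}" by auto
  ultimately have "measure (\<mu> t) {x<..} = measure (\<mu> t) UNIV - measure (\<mu> t) {..x}" by simp
  then show ?thesis using mass_conserved[of t] by (simp add: F_def cdf_def total_mass_def)
qed

text \<open>Comparison with a smoothed step of width \<open>\<delta>\<close> that starts at \<open>x\<close> and moves with speed \<open>c\<close>. The
velocity is compared with \<open>c\<close> only on the strip where the step is not constant, which makes the
estimate local. The factor \<open>t - s\<close> treats both directions of time at once.\<close>

lemma F_moving_front:
  assumes \<delta>: "0 < \<delta>"
    and speed: "\<And>\<tau> z. \<lbrakk>min s t \<le> \<tau>; \<tau> \<le> max s t; x + c * (\<tau> - s) \<le> z; z \<le> x + \<delta> + c * (\<tau> - s)\<rbrakk>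
      \<Longrightarrow> 0 \<le> (t - s) * (c - u \<tau> z)"
  shows "F s x \<le> F t (x + \<delta> + c * (t - s))"
proof (cases "s = t")
  case True
  then show ?thesis using F_mono[of x "x + \<delta>" s] \<delta> by simp
next
  case False
  define x0 where "x0 = x - c * s"
  define h where "h y = smooth_step (1 / \<delta> * (y - x0))" for y
  define h' where "h' y = 1 / \<delta> * smooth_bump (1 / \<delta> * (y - x0))" for y
  have h: "(h has_real_derivative h' y) (at y)" for y
    unfolding h_def[abs_def] h'_def
    by (rule DERIV_cong[OF DERIV_chain2[OF smooth_step_derivative]])
       (use \<delta> in \<open>auto intro!: derivative_eq_intros\<close>)
  have Ck: "Ck k h" for k unfolding h_def[abs_def] by (rule Ck_smooth_step_affine)
  have bd: "\<bar>h y\<bar> \<le> 1" "\<bar>- h y\<bar> \<le> 1" for y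
    using smooth_step_bounds unfolding h_def by auto
  have Ck': "Ck k (\<lambda>y. - h y)" for k using Ck_mult[OF Ck_const Ck, of k "- 1"] by simp
  have h'_outside: "h' (z - c * \<tau>) = 0" if "z \<notin> {x + c * (\<tau> - s)..x + \<delta> + c * (\<tau> - s)}" for z \<tau>
  proof -
    have "1 / \<delta> * (z - c * \<tau> - x0) \<notin> {0..1}"
      using that \<delta> by (auto simp: x0_def field_simps)
    then show ?thesis unfolding h'_def by (simp add: smooth_bump_outside)
  qed
  have h'_nonneg: "0 \<le> h' y" for y using \<delta> smooth_bump_nonneg by (simp add: h'_def)
  have key: "(LINT z|\<mu> t. h (z - c * t)) \<le> (LINT z|\<mu> s. h (z - c * s))"
  proof (cases "s \<le> t")
    case True
    have "0 \<le> - h' (z - c * \<tau>) * (u \<tau> z - c)" if "\<tau> \<in> {s..t}" for \<tau> z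
    proof (cases "z \<in> {x + c * (\<tau> - s)..x + \<delta> + c * (\<tau> - s)}")
      case True
      then have "0 \<le> (t - s) * (c - u \<tau> z)" using that by (intro speed) auto
      then have "u \<tau> z - c \<le> 0" using \<open>s \<le> t\<close> \<open>s \<noteq> t\<close> by (simp add: zero_le_mult_iff)
      then show ?thesis using h'_nonneg by (simp add: mult_nonneg_nonpos)
    qed (simp add: h'_outside)
    from monotone_mass_function[OF Ck' bd(2) DERIV_minus[OF h] True this]
    show ?thesis by simp
  next
    case False
    have "0 \<le> h' (z - c * \<tau>) * (u \<tau> z - c)" if "\<tau> \<in> {t..s}" for \<tau> z
    proof (cases "z \<in> {x + c * (\<tau> - s)..x + \<delta> + c * (\<tau> - s)}")
      case True
      then have "0 \<le> (t - s) * (c - u \<tau> z)" using that by (intro speed) auto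
      then have "0 \<le> u \<tau> z - c" using False by (simp add: zero_le_mult_iff)
      then show ?thesis using h'_nonneg by simp
    qed (simp add: h'_outside)
    from monotone_mass_function[OF Ck bd(1) h _ this] False
    show ?thesis by simp
  qed
  have meas: "(\<lambda>z. h (z - c * \<tau>)) \<in> borel_measurable borel" for \<tau>
  proof -
    have "continuous_on UNIV h" using Ck[of 0] by simp
    then have "continuous_on UNIV (\<lambda>z. h (z - c * \<tau>))"
      by (rule continuous_on_compose2) (auto intro!: continuous_intros)
    then show ?thesis by (rule borel_measurable_continuous_onI)
  qed
  have int: "integrable (\<mu> \<tau>) (\<lambda>z. h (z - c * \<tau>))" for \<tau>
    by (rule finite_measure.integrable_const_bound[OF finite_\<mu>, of _ 1])
      (use bd meas in \<open>auto simp: measurable_cong_sets[OF sets_\<mu> refl]\<close>)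
  have ind: "integrable (\<mu> \<tau>) (indicat_real {y<..})" for \<tau> y
    by (rule finite_measure.integrable_const_bound[OF finite_\<mu>, of _ 1])
      (auto simp: measurable_cong_sets[OF sets_\<mu> refl])
  have "total_mass - F t (x + \<delta> + c * (t - s)) = (LINT z|\<mu> t. indicator {x + \<delta> + c * (t - s)<..} z)"
    by (simp add: measure_halfline)
  also have "\<dots> \<le> (LINT z|\<mu> t. h (z - c * t))"
  proof (rule integral_mono[OF ind int])
    fix z
    show "indicator {x + \<delta> + c * (t - s)<..} z \<le> h (z - c * t)"
      using smooth_step_bounds \<delta> smooth_step_eq_1[of "1 / \<delta> * (z - c * t - x0)"]
      by (auto simp: indicator_def h_def x0_def field_simps)
  qed
  also note key
  also have "(LINT z|\<mu> s. h (z - c * s)) \<le> (LINT z|\<mu> s. indicator {x<..} z)"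
  proof (rule integral_mono[OF int ind])
    fix z
    show "h (z - c * s) \<le> indicator {x<..} z"
      using smooth_step_bounds \<delta> smooth_step_eq_0[of "1 / \<delta> * (z - c * s - x0)"]
      by (auto simp: indicator_def h_def x0_def field_simps)
  qed
  also have "\<dots> = total_mass - F s x" by (simp add: measure_halfline)
  finally show ?thesis by simp
qed

text \<open>The left-continuous quantile, so that the closed half-line up to \<open>q \<alpha> t\<close> carries energy at least \<open>\<alpha>\<close>.\<close>

definition q :: "real \<Rightarrow> real \<Rightarrow> real" where
  "q \<alpha> t = Inf {x. \<alpha> \<le> F t x}"

lemma q_le_iff: "0 < \<alpha> \<Longrightarrow> \<alpha> < total_mass \<Longrightarrow> q \<alpha> t \<le> x \<longleftrightarrow> \<alpha> \<le> F t x"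
  unfolding q_def by (rule F.pseudoinverse[symmetric])

context
  fixes \<alpha> assumes \<alpha>: "0 < \<alpha>" "\<alpha> < total_mass"
begin

text \<open>The width of the step in \<open>F_moving_front\<close> tends to zero. Exchanging \<open>s\<close> and \<open>t\<close> turns this upper
bound into a lower one.\<close>

lemma q_upper:
  assumes \<delta>: "0 < \<delta>"
    and speed: "\<And>\<tau> z. \<lbrakk>min s t \<le> \<tau>; \<tau> \<le> max s t; q \<alpha> s + c * (\<tau> - s) \<le> z; z \<le> q \<alpha> s + \<delta> + c * (\<tau> - s)\<rbrakk>
      \<Longrightarrow> 0 \<le> (t - s) * (c - u \<tau> z)"
  shows "q \<alpha> t \<le> q \<alpha> s + c * (t - s)"
proof (rule field_le_epsilon)
  fix e :: real assume "0 < e"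
  have "\<alpha> \<le> F s (q \<alpha> s)" using q_le_iff[OF \<alpha>] by blast
  also have "\<dots> \<le> F t (q \<alpha> s + min e \<delta> + c * (t - s))"
  proof (rule F_moving_front)
    show "0 < min e \<delta>" using \<open>0 < e\<close> \<delta> by simp
    fix \<tau> z assume "min s t \<le> \<tau>" "\<tau> \<le> max s t" "q \<alpha> s + c * (\<tau> - s) \<le> z"
      "z \<le> q \<alpha> s + min e \<delta> + c * (\<tau> - s)"
    then show "0 \<le> (t - s) * (c - u \<tau> z)" by (intro speed) auto
  qed
  finally have "q \<alpha> t \<le> q \<alpha> s + min e \<delta> + c * (t - s)" by (simp add: q_le_iff[OF \<alpha>])
  then show "q \<alpha> t \<le> q \<alpha> s + c * (t - s) + e" by linarith
qed

text \<open>A rough bound, with the global speed limit instead of a local one. It confines the curve, so that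
the local comparison in \<open>q_derivative\<close> also applies when it starts away from time \<open>t\<close>.\<close>

lemma q_lipschitz:
  assumes B: "0 \<le> B" "\<And>t x. t \<in> {a..b} \<Longrightarrow> \<bar>u t x\<bar> \<le> B" and st: "s \<in> {a..b}" "t \<in> {a..b}"
  shows "\<bar>q \<alpha> t - q \<alpha> s\<bar> \<le> B * \<bar>t - s\<bar>"
proof -
  have *: "q \<alpha> t - q \<alpha> s \<le> B * \<bar>t - s\<bar>" if "s \<in> {a..b}" "t \<in> {a..b}" for s t
  proof (cases "s \<le> t")
    case True
    have "q \<alpha> t \<le> q \<alpha> s + B * (t - s)"
    proof (rule q_upper[where \<delta> = 1])
      fix \<tau> z assume "min s t \<le> \<tau>" "\<tau> \<le> max s t"
      then have "\<bar>u \<tau> z\<bar> \<le> B" using that by (intro B) auto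
      then show "0 \<le> (t - s) * (B - u \<tau> z)" using True by (intro mult_nonneg_nonneg) auto
    qed simp
    then show ?thesis using True by simp
  next
    case False
    have "q \<alpha> t \<le> q \<alpha> s + (- B) * (t - s)"
    proof (rule q_upper[where \<delta> = 1])
      fix \<tau> z assume "min s t \<le> \<tau>" "\<tau> \<le> max s t"
      then have "\<bar>u \<tau> z\<bar> \<le> B" using that by (intro B) auto
      then show "0 \<le> (t - s) * (- B - u \<tau> z)" using False by (intro mult_nonpos_nonpos) auto
    qed simp
    then show ?thesis using False by (simp add: algebra_simps)
  qed
  from *[OF st] *[OF st(2,1)] show ?thesis by (simp add: abs_le_iff abs_minus_commute)
qed

text \<open>By continuity \<open>u\<close> differs from \<open>u t (q \<alpha> t)\<close> by less than \<open>e\<close> near the point of the curve. Fronts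
with the speeds \<open>u t (q \<alpha> t) \<plusminus> e\<close>, started at time \<open>t\<close> and at the nearby time, bound the
increment of \<open>q \<alpha>\<close> from above and from below.\<close>

lemma q_derivative: "(q \<alpha> has_real_derivative u t (q \<alpha> t)) (at t)"
  unfolding has_field_derivative_def has_derivative_at_alt
proof (intro conjI allI impI)
  show "bounded_linear ((*) (u t (q \<alpha> t)))" by (rule bounded_linear_mult_right)
  fix e :: real assume "0 < e"
  define x0 where "x0 = q \<alpha> t"
  define u0 where "u0 = u t x0"
  obtain B where B: "0 \<le> B" "\<And>\<tau> x. \<tau> \<in> {t-1..t+1} \<Longrightarrow> \<bar>u \<tau> x\<bar> \<le> B"
    using norm_u_bounded_on by blast
  have "isCont (\<lambda>p. u (snd p) (fst p)) (x0, t)"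
    using jointly_continuous_u by (simp add: continuous_on_eq_continuous_at)
  then obtain d where d: "0 < d" "\<And>p. dist p (x0, t) < d \<Longrightarrow> dist (u (snd p) (fst p)) u0 < e"
    using \<open>0 < e\<close> unfolding continuous_at_eps_delta u0_def by (metis fst_conv snd_conv)
  define r where "r = d / 2"
  have r: "0 < r" "\<And>z \<tau>. \<bar>z - x0\<bar> < r \<Longrightarrow> \<bar>\<tau> - t\<bar> < r \<Longrightarrow> \<bar>u \<tau> z - u0\<bar> < e"
  proof -
    show "0 < r" using d by (simp add: r_def)
    fix z \<tau> assume "\<bar>z - x0\<bar> < r" "\<bar>\<tau> - t\<bar> < r"
    then have "dist (z, \<tau>) (x0, t) < d"
      using sqrt_sum_squares_le_sum_abs[of "z - x0" "\<tau> - t"] by (simp add: dist_Pair_Pair dist_real_def r_def)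
    from d(2)[OF this] show "\<bar>u \<tau> z - u0\<bar> < e" by (simp add: dist_real_def)
  qed
  define L where "L = B + \<bar>u0\<bar> + e"
  have L: "0 < L" using B \<open>0 < e\<close> by (simp add: L_def add_nonneg_pos)
  \<comment> \<open>within time \<open>\<rho>\<close> the curve, the front and half of the admissible width \<open>r\<close> stay inside the
    neighbourhood where the velocity is close to \<open>u0\<close>\<close>
  define \<rho> where "\<rho> = min (min 1 r) (r / 2 / L)"
  have \<rho>: "0 < \<rho>" "\<rho> \<le> 1" "\<rho> \<le> r" "L * \<rho> \<le> r / 2"
    using r L by (auto simp: \<rho>_def min_def field_simps)
  have bound: "q \<alpha> t' - q \<alpha> s \<le> u0 * (t' - s) + e * \<bar>t' - s\<bar>"
    if s: "\<bar>s - t\<bar> < \<rho>" and t': "\<bar>t' - t\<bar> < \<rho>" and ends: "s = t \<or> t' = t" for s t'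
  proof -
    define c where "c = (if s \<le> t' then u0 + e else u0 - e)"
    have c: "\<bar>c\<bar> \<le> \<bar>u0\<bar> + e" using \<open>0 < e\<close> by (auto simp: c_def)
    have "q \<alpha> t' \<le> q \<alpha> s + c * (t' - s)"
    proof (rule q_upper[where \<delta> = "r / 2"])
      show "0 < r / 2" using r by simp
      fix \<tau> z assume \<tau>: "min s t' \<le> \<tau>" "\<tau> \<le> max s t'"
        and z: "q \<alpha> s + c * (\<tau> - s) \<le> z" "z \<le> q \<alpha> s + r / 2 + c * (\<tau> - s)"
      have \<tau>t: "\<bar>\<tau> - t\<bar> < \<rho>" using \<tau> s t' by (auto simp: min_def max_def split: if_splits)
      have \<tau>s: "\<bar>\<tau> - s\<bar> < \<rho>"
        using ends \<tau> s t' by (auto simp: min_def max_def split: if_splits)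
      have "\<bar>q \<alpha> s - x0\<bar> \<le> B * \<bar>s - t\<bar>"
        unfolding x0_def by (rule q_lipschitz[OF B]) (use s \<rho> in auto)
      also have "\<dots> \<le> B * \<rho>" using s B by (intro mult_left_mono) auto
      finally have 1: "\<bar>q \<alpha> s - x0\<bar> \<le> B * \<rho>" .
      have "\<bar>c * (\<tau> - s)\<bar> \<le> (\<bar>u0\<bar> + e) * \<rho>"
        unfolding abs_mult using c \<tau>s \<open>0 < e\<close> by (intro mult_mono) auto
      moreover have "(\<bar>u0\<bar> + e) * \<rho> + B * \<rho> \<le> r / 2" using \<rho>(4) by (simp add: L_def algebra_simps)
      moreover have "c * (\<tau> - s) < (\<bar>u0\<bar> + e) * \<rho>"
      proof -
        have "c * (\<tau> - s) \<le> \<bar>c\<bar> * \<bar>\<tau> - s\<bar>" by (simp flip: abs_mult)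
        also have "\<dots> \<le> (\<bar>u0\<bar> + e) * \<bar>\<tau> - s\<bar>" using c by (intro mult_right_mono) auto
        also have "\<dots> < (\<bar>u0\<bar> + e) * \<rho>"
          using \<tau>s \<open>0 < e\<close> by (intro mult_strict_left_mono) auto
        finally show ?thesis .
      qed
      ultimately have "\<bar>z - x0\<bar> < r" using 1 z r(1) by linarith
      then have "\<bar>u \<tau> z - u0\<bar> < e" using \<tau>t \<rho> by (intro r) auto
      then show "0 \<le> (t' - s) * (c - u \<tau> z)"
        by (cases "s \<le> t'") (auto simp: c_def intro!: mult_nonneg_nonneg mult_nonpos_nonpos)
    qed
    then show ?thesis by (auto simp: c_def algebra_simps split: if_splits)
  qed
  show "\<exists>d>0. \<forall>y. norm (y - t) < d \<longrightarrow> norm (q \<alpha> y - q \<alpha> t - u t (q \<alpha> t) * (y - t)) \<le> e * norm (y - t)"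
  proof (intro exI[of _ \<rho>] conjI allI impI \<rho>)
    fix y assume "norm (y - t) < \<rho>"
    then have "q \<alpha> y - q \<alpha> t \<le> u0 * (y - t) + e * \<bar>y - t\<bar>" "q \<alpha> t - q \<alpha> y \<le> u0 * (t - y) + e * \<bar>t - y\<bar>"
      using \<rho>(1) by (auto intro!: bound)
    moreover have "u0 * (t - y) = - (u0 * (y - t))" "\<bar>t - y\<bar> = \<bar>y - t\<bar>" by (auto simp: algebra_simps)
    ultimately show "norm (q \<alpha> y - q \<alpha> t - u t (q \<alpha> t) * (y - t)) \<le> e * norm (y - t)"
      unfolding real_norm_def by (fold x0_def u0_def) (simp add: abs_le_iff u0_def x0_def)
  qed
qed

end

section \<open>Bounds by the energy\<close>

abbreviation "ux t \<equiv> weak_deriv (u t)"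

lemma has_weak_deriv_u: "has_weak_deriv 1 (u t) (ux t)"
proof -
  have "\<exists>g. has_weak_deriv 1 (u t) g"
    using solution unfolding conservative_solution_def deriv_in_L2_def by blast
  then show ?thesis unfolding weak_deriv_def by (rule someI_ex)
qed

lemma primitive_u: "primitive (u t) (ux t)"
  by (intro has_weak_deriv_primitive has_weak_deriv_u continuous_u_space)

lemma ux_measurable [measurable]: "ux t \<in> borel_measurable borel"
  using has_weak_deriv_u[of t] by (simp add: has_weak_deriv_def L1_loc_def)

lemma decomposition: "lebesgue_decomposition (\<mu> t) (energy_density (u t)) (sing_part (\<mu> t))"
proof -
  have "ac_part (\<mu> t) = energy_density (u t)"
    using solution unfolding conservative_solution_def by blast
  with lebesgue_decomposition_parts[OF finite_borel[of t]] show ?thesis by simp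
qed

lemma emeasure_energy_density:
  "A \<in> sets borel \<Longrightarrow> emeasure (energy_density (u t)) A = (\<integral>\<^sup>+x. ennreal (indicator A x * (ux t x)\<^sup>2) \<partial>lborel)"
  unfolding energy_density_def
  by (subst emeasure_density) (auto intro!: nn_integral_cong simp: indicator_def)

text \<open>The absolutely continuous part of the energy is the square of the derivative at every time;
what is missing from the total energy is the singular part.\<close>

lemma energy_integral:
  assumes A: "A \<in> sets borel"
  shows "set_integrable lborel A (\<lambda>x. (ux t x)\<^sup>2)"
    and "measure (\<mu> t) A = (LINT x:A|lborel. (ux t x)\<^sup>2) + measure (sing_part (\<mu> t)) A"
proof -
  interpret finite_measure "\<mu> t" by (rule finite_\<mu>)
  have split: "emeasure (\<mu> t) A = emeasure (energy_density (u t)) A + emeasure (sing_part (\<mu> t)) A"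
    using decomposition[of t] A by (simp add: lebesgue_decomposition_def)
  have fin: "emeasure (energy_density (u t)) A < \<infinity>" "emeasure (sing_part (\<mu> t)) A < \<infinity>"
    using split emeasure_finite[of A] by (auto simp: top.not_eq_extremum less_top)
  have [measurable]: "A \<in> sets borel" by (rule A)
  show i: "set_integrable lborel A (\<lambda>x. (ux t x)\<^sup>2)"
    unfolding set_integrable_def
    by (rule integrableI_nonneg) (use fin(1) emeasure_energy_density[OF A, of t] in auto)
  have e: "measure (energy_density (u t)) A = (LINT x:A|lborel. (ux t x)\<^sup>2)"
    unfolding measure_def emeasure_energy_density[OF A] set_lebesgue_integral_def
    by (subst integral_eq_nn_integral) auto
  show "measure (\<mu> t) A = (LINT x:A|lborel. (ux t x)\<^sup>2) + measure (sing_part (\<mu> t)) A"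
    unfolding e[symmetric] using split fin by (simp add: measure_def enn2real_plus)
qed

text \<open>The open interval matters: atoms at the end points do not count. In particular \<open>u t\<close> is constant
on intervals without energy.\<close>

lemma square_increment_u:
  assumes "x \<le> y"
  shows "(u t y - u t x)\<^sup>2 \<le> (y - x) * measure (\<mu> t) {x<..<y}"
proof -
  have "(u t y - u t x)\<^sup>2 \<le> (y - x) * (LINT z:{x..y}|lborel. (ux t z)\<^sup>2)"
    by (intro square_increment_le primitive_u assms energy_integral) simp
  also have "(LINT z:{x..y}|lborel. (ux t z)\<^sup>2) = (LINT z:{x<..<y}|lborel. (ux t z)\<^sup>2)"
    unfolding set_lebesgue_integral_def
  proof (rule integral_cong_AE)
    show "AE z in lborel. indicator {x..y} z *\<^sub>R (ux t z)\<^sup>2 = indicator {x<..<y} z *\<^sub>R (ux t z)\<^sup>2"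
      using AE_lborel_singleton[of x] AE_lborel_singleton[of y] by eventually_elim (auto simp: indicator_def)
  qed auto
  also have "\<dots> \<le> measure (\<mu> t) {x<..<y}"
    using energy_integral(2)[of "{x<..<y}" t] by simp
  finally show ?thesis using assms by (simp add: mult_left_mono)
qed

section \<open>The momentum equation\<close>

lemma F_measurable [measurable]: "F t \<in> borel_measurable borel"
  by (intro borel_measurable_mono monoI F_mono)

lemma integrable_mult_F:
  assumes "integrable lborel w"
  shows "integrable lborel (\<lambda>x. w x * F t x)"
proof (rule Bochner_Integration.integrable_bound)
  show "integrable lborel (\<lambda>x. w x * total_mass)" using assms by simp
  show "AE x in lborel. norm (w x * F t x) \<le> norm (w x * total_mass)"
    using F_nonneg F_le_total_mass order_trans[OF F_nonneg F_le_total_mass]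
    by (intro AE_I2) (auto simp: abs_mult intro!: mult_left_mono)
qed (use assms in measurable)

text \<open>For a fixed \<open>x\<close> the value \<open>F t x\<close> may jump in time when an atom passes. After integration in \<open>x\<close>,
Fubini's theorem yields the integral of a bounded continuous function against the energy.\<close>

lemma continuous_integral_F:
  assumes w: "integrable lborel w"
  shows "continuous_on UNIV (\<lambda>t. LINT x|lborel. w x * F t x)"
proof -
  have [measurable]: "w \<in> borel_measurable borel" using w by auto
  \<comment> \<open>the inner integral after exchanging the order of integration\<close>
  define W where "W z = (LINT x|lborel. w x * of_bool (z \<le> x))" for z
  have iw: "integrable lborel (\<lambda>x. w x * of_bool (z \<le> x))" for z
    by (auto intro!: Bochner_Integration.integrable_bound[OF w] AE_I2)
  have "\<bar>W z\<bar> \<le> (LINT x|lborel. \<bar>w x\<bar>)" for z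
  proof -
    have "\<bar>W z\<bar> \<le> (LINT x|lborel. \<bar>w x * of_bool (z \<le> x)\<bar>)" unfolding W_def by (rule integral_abs_bound)
    also have "\<dots> \<le> (LINT x|lborel. \<bar>w x\<bar>)"
      by (intro integral_mono integrable_abs iw w) (auto simp: abs_mult)
    finally show ?thesis .
  qed
  moreover have "continuous_on UNIV W"
  proof (rule continuous_at_imp_continuous_on, safe)
    fix z0
    show "isCont W z0" unfolding continuous_at_sequentially comp_def
    proof (intro allI impI)
      fix s :: "nat \<Rightarrow> real" assume s: "s \<longlonglongrightarrow> z0"
      show "(\<lambda>n. W (s n)) \<longlonglongrightarrow> W z0"
        unfolding W_def
      proof (rule integral_dominated_convergence[where w = "\<lambda>x. \<bar>w x\<bar>"])
        show "AE x in lborel. (\<lambda>n. w x * of_bool (s n \<le> x)) \<longlonglongrightarrow> w x * of_bool (z0 \<le> x)"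
          using AE_lborel_singleton[of z0]
        proof eventually_elim
          case (elim x)
          have "\<forall>\<^sub>F n in sequentially. of_bool (s n \<le> x) = (of_bool (z0 \<le> x) :: real)"
          proof (cases "z0 < x")
            case True
            from order_tendstoD(2)[OF s this] show ?thesis by eventually_elim (use True in auto)
          next
            case False
            then have "x < z0" using elim by simp
            from order_tendstoD(1)[OF s this] show ?thesis by eventually_elim (use False elim in auto)
          qed
          then show ?case by (intro tendsto_mult tendsto_const tendsto_eventually)
        qed
        show "AE x in lborel. norm (w x * of_bool (s n \<le> x)) \<le> \<bar>w x\<bar>" for n
          by (intro AE_I2) (auto simp: abs_mult)
      qed (use w in auto)
    qed
  qed
  ultimately have "continuous_on UNIV (\<lambda>t. LINT z|\<mu> t. W z)" by (rule weak_continuity[rotated])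
  moreover have "(LINT x|lborel. w x * F t x) = (LINT z|\<mu> t. W z)" for t
  proof -
    interpret finite_measure "\<mu> t" by (rule finite_\<mu>)
    interpret pair_sigma_finite lborel "\<mu> t" ..
    have [measurable]: "Measurable.pred (borel \<Otimes>\<^sub>M borel) (\<lambda>(x::real, z::real). z \<le> x)"
      by (simp add: case_prod_beta')
    have m: "(\<lambda>(x, z). w x * of_bool (z \<le> x)) \<in> borel_measurable (lborel \<Otimes>\<^sub>M \<mu> t)"
      by measurable
    have ib: "integrable (\<mu> t) (\<lambda>z. of_bool (z \<le> x) :: real)" for x
      by (rule integrable_const_bound[of _ 1]) auto
    have inner: "(LINT z|\<mu> t. of_bool (z \<le> x)) = F t x" for x
    proof -
      have "(\<lambda>z. of_bool (z \<le> x)) = indicat_real {..x}" by (auto simp: indicator_def)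
      then show ?thesis by (simp add: F_def cdf_def)
    qed
    have "integrable (lborel \<Otimes>\<^sub>M \<mu> t) (\<lambda>(x, z). w x * of_bool (z \<le> x))"
    proof (rule Fubini_integrable[OF m])
      have "(\<lambda>x. LINT z|\<mu> t. norm (case (x, z) of (x, z) \<Rightarrow> w x * of_bool (z \<le> x))) = (\<lambda>x. \<bar>w x\<bar> * F t x)"
        by (simp add: abs_mult inner)
      then show "integrable lborel (\<lambda>x. LINT z|\<mu> t. norm (case (x, z) of (x, z) \<Rightarrow> w x * of_bool (z \<le> x)))"
        using integrable_mult_F[OF integrable_abs[OF w]] by simp
      show "AE x in lborel. integrable (\<mu> t) (\<lambda>z. case (x, z) of (x, z) \<Rightarrow> w x * of_bool (z \<le> x))"
        using ib by simp
    qed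
    from Fubini_integral[OF this] show ?thesis
      by (simp add: W_def inner)
  qed
  ultimately show ?thesis by simp
qed

lemma continuous_integral_space:
  fixes g :: "real \<Rightarrow> real \<Rightarrow> real" and w :: "real \<Rightarrow> real"
  assumes w: "integrable lborel w" and c: "\<And>t. continuous_on UNIV (g t)" and b: "\<And>t x. \<bar>g t x\<bar> \<le> B t"
    and lim: "\<And>t. uniform_limit UNIV g (g t) (at t)"
  shows "continuous_on UNIV (\<lambda>t::real. LINT x|lborel. g t x * w x)"
    and "\<And>t. integrable lborel (\<lambda>x. g t x * w x)"
proof -
  have [measurable]: "g t \<in> borel_measurable borel" "w \<in> borel_measurable borel" for t
    using c w by (auto intro: borel_measurable_continuous_onI)
  have int: "integrable lborel (\<lambda>x. g t x * w x)" for t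
  proof (rule Bochner_Integration.integrable_bound)
    show "integrable lborel (\<lambda>x. B t * w x)" using w by simp
    show "AE x in lborel. norm (g t x * w x) \<le> norm (B t * w x)"
      using b[of t] by (intro AE_I2) (auto simp: abs_mult intro!: mult_right_mono order_trans[OF b abs_ge_self])
  qed simp
  then show "integrable lborel (\<lambda>x. g t x * w x)" for t by blast
  show "continuous_on UNIV (\<lambda>t::real. LINT x|lborel. g t x * w x)"
  proof (rule continuous_at_imp_continuous_on, safe)
    fix t0
    define M where "M = (LINT x|lborel. \<bar>w x\<bar>) + 1"
    have M: "0 < M" by (simp add: M_def add_nonneg_pos)
    have "((\<lambda>t. LINT x|lborel. g t x * w x) \<longlongrightarrow> (LINT x|lborel. g t0 x * w x)) (at t0)"
    proof (rule tendstoI)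
      fix e :: real assume "0 < e"
      then have "\<forall>\<^sub>F t in at t0. \<forall>x\<in>UNIV. dist (g t x) (g t0 x) < e / M"
        using lim[of t0] M by (auto simp: uniform_limit_iff)
      then show "\<forall>\<^sub>F t in at t0. dist (LINT x|lborel. g t x * w x) (LINT x|lborel. g t0 x * w x) < e"
      proof eventually_elim
        case (elim t)
        have "\<bar>(LINT x|lborel. g t x * w x) - (LINT x|lborel. g t0 x * w x)\<bar>
            = \<bar>LINT x|lborel. g t x * w x - g t0 x * w x\<bar>"
          using int by simp
        also have "\<dots> \<le> (LINT x|lborel. \<bar>g t x * w x - g t0 x * w x\<bar>)" by (rule integral_abs_bound)
        also have "\<dots> \<le> (LINT x|lborel. e / M * \<bar>w x\<bar>)"
        proof (rule integral_mono)
          show "\<bar>g t x * w x - g t0 x * w x\<bar> \<le> e / M * \<bar>w x\<bar>" for x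
            using elim by (simp add: dist_real_def less_imp_le mult_right_mono flip: left_diff_distrib abs_mult)
              (metis abs_mult abs_ge_zero less_imp_le mult_right_mono times_divide_eq_left)
        qed (use int w in auto)
        also have "\<dots> = e / M * (M - 1)" by (simp add: M_def)
        also have "\<dots> < e" using M \<open>0 < e\<close> by (simp add: field_simps)
        finally show ?case by (simp add: dist_real_def)
      qed
    qed
    then show "isCont (\<lambda>t. LINT x|lborel. g t x * w x) t0" by (simp add: isCont_def)
  qed
qed

lemma uniform_limit_u_square: "uniform_limit UNIV (\<lambda>t x. (u t x)\<^sup>2) (\<lambda>x. (u t x)\<^sup>2) (at t)"
  unfolding power2_eq_square
  by (intro uniform_lim_mult uniform_limit_u) (auto intro!: boundedI[of _ "norm (u t)"] u_le_norm)

lemma u_square_le: "\<bar>(u t x)\<^sup>2\<bar> \<le> (norm (u t))\<^sup>2"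
  using power_mono[OF u_le_norm[of t x], of 2] by simp

lemma integrable_test_function: "test_function \<eta> \<Longrightarrow> integrable lborel (\<eta> :: real \<Rightarrow> real)"
  using integrable_L1_loc_test_function[of "\<lambda>_. 1" \<eta>] by (simp add: L1_loc_continuous)

text \<open>In the weak equation \<open>u u\<^sub>x\<close> is integrated by parts to \<open>- u\<^sup>2/2\<close>. Only then is its integral seen to
be continuous in time, so that the weak derivative in time is a classical one.\<close>

lemma momentum_weak:
  assumes \<eta>: "test_function \<eta>"
  shows "continuous_on UNIV (\<lambda>t. 1/2 * (LINT x|lborel. (u t x)\<^sup>2 * dir_deriv 1 \<eta> x) + 1/2 * (LINT x|lborel. \<eta> x * F t x))"
    and "primitive (\<lambda>t. LINT x|lborel. u t x * \<eta> x)
      (\<lambda>t. 1/2 * (LINT x|lborel. (u t x)\<^sup>2 * dir_deriv 1 \<eta> x) + 1/2 * (LINT x|lborel. \<eta> x * F t x))"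
proof -
  define A where "A t = (LINT x|lborel. u t x * \<eta> x)" for t
  define K where "K t = 1/2 * (LINT x|lborel. (u t x)\<^sup>2 * dir_deriv 1 \<eta> x) + 1/2 * (LINT x|lborel. \<eta> x * F t x)" for t
  note w = integrable_test_function[OF \<eta>]
  have cA: "continuous_on UNIV A" unfolding A_def
    by (rule continuous_integral_space[OF w continuous_u_space u_le_norm uniform_limit_u])
  have cK: "continuous_on UNIV K" unfolding K_def
    by (intro continuous_intros continuous_integral_F w continuous_integral_space(1)[OF _ _ u_square_le uniform_limit_u_square]
       integrable_test_function test_function_dir_deriv \<eta> continuous_u_space)
  have parts: "integrable lborel (\<lambda>x. \<eta> x * (u t x * ux t x))"
    "(LINT x|lborel. \<eta> x * (u t x * ux t x)) = - 1/2 * (LINT x|lborel. (u t x)\<^sup>2 * dir_deriv 1 \<eta> x)" for t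
  proof -
    have p: "primitive (\<lambda>x. (u t x)\<^sup>2) (\<lambda>x. ux t x * u t x + ux t x * u t x)"
      using primitive_mult[OF primitive_u[of t] primitive_u[of t]] by (simp add: power2_eq_square)
    have eq: "(\<lambda>x. (ux t x * u t x + ux t x * u t x) * \<eta> x) = (\<lambda>x. 2 * (\<eta> x * (u t x * ux t x)))"
      by (auto simp: algebra_simps)
    show "integrable lborel (\<lambda>x. \<eta> x * (u t x * ux t x))"
      using integral_by_parts_test_function(2)[OF p \<eta>] unfolding eq by simp
    show "(LINT x|lborel. \<eta> x * (u t x * ux t x)) = - 1/2 * (LINT x|lborel. (u t x)\<^sup>2 * dir_deriv 1 \<eta> x)"
      using integral_by_parts_test_function(3)[OF p \<eta>] unfolding eq by simp
  qed
  have "has_weak_deriv 1 A K"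
    unfolding has_weak_deriv_def
  proof (intro conjI allI impI L1_loc_continuous cA cK)
    fix \<psi> :: "real \<Rightarrow> real" assume \<psi>: "test_function \<psi>"
    have "(LINT x|lborel. u t x * (\<eta> x * dir_deriv 1 \<psi> t) - \<eta> x * \<psi> t * (u t x * ux t x - 1/2 * F t x))
       = A t * dir_deriv 1 \<psi> t + K t * \<psi> t" for t
    proof -
      have "(LINT x|lborel. u t x * (\<eta> x * dir_deriv 1 \<psi> t) - \<eta> x * \<psi> t * (u t x * ux t x - 1/2 * F t x))
        = (LINT x|lborel. dir_deriv 1 \<psi> t * (u t x * \<eta> x) - \<psi> t * (\<eta> x * (u t x * ux t x)) + \<psi> t / 2 * (\<eta> x * F t x))"
        by (intro Bochner_Integration.integral_cong refl) (simp add: algebra_simps)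
      also have "\<dots> = dir_deriv 1 \<psi> t * A t - \<psi> t * (LINT x|lborel. \<eta> x * (u t x * ux t x))
          + \<psi> t / 2 * (LINT x|lborel. \<eta> x * F t x)"
        using parts(1)[of t] integrable_mult_F[OF w, of t]
          continuous_integral_space(2)[OF w continuous_u_space u_le_norm uniform_limit_u, of t]
        by (simp add: A_def)
      also have "\<dots> = A t * dir_deriv 1 \<psi> t + K t * \<psi> t"
        unfolding parts(2) K_def by (simp add: algebra_simps)
      finally show ?thesis .
    qed
    moreover have "(LINT t|lborel. LINT x|lborel. u t x * (\<eta> x * dir_deriv 1 \<psi> t) - \<eta> x * \<psi> t * (u t x * ux t x - 1/2 * F t x)) = 0"
    proof -
      have "\<forall>\<phi>. test_function \<phi> \<longrightarrow>
        (LINT t|lborel. LINT x|lborel.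
           u t x * D_t \<phi> (x, t)
           - \<phi> (x, t) * (u t x * weak_deriv (u t) x - 1/2 * cdf (\<mu> t) x)) = 0"
        using solution unfolding conservative_solution_def by blast
      from this[rule_format, OF test_function_tensor(1)[OF \<eta> \<psi>]]
      show ?thesis unfolding test_function_tensor(2)[OF \<eta> \<psi>] F_def fst_conv snd_conv .
    qed
    ultimately have "(LINT t|lborel. A t * dir_deriv 1 \<psi> t + K t * \<psi> t) = 0" by simp
    moreover have "integrable lborel (\<lambda>t. K t * \<psi> t)" "integrable lborel (\<lambda>t. A t * dir_deriv 1 \<psi> t)"
      by (intro integrable_L1_loc_test_function L1_loc_continuous cA cK \<psi> test_function_dir_deriv)+
    ultimately show "(LINT t|lborel. A t * dir_deriv 1 \<psi> t) = - (LINT t|lborel. K t * \<psi> t)"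
      by simp
  qed
  from has_weak_deriv_primitive[OF this cA] cK
  show "continuous_on UNIV (\<lambda>t. 1/2 * (LINT x|lborel. (u t x)\<^sup>2 * dir_deriv 1 \<eta> x) + 1/2 * (LINT x|lborel. \<eta> x * F t x))"
    "primitive (\<lambda>t. LINT x|lborel. u t x * \<eta> x)
      (\<lambda>t. 1/2 * (LINT x|lborel. (u t x)\<^sup>2 * dir_deriv 1 \<eta> x) + 1/2 * (LINT x|lborel. \<eta> x * F t x))"
    by (simp_all add: A_def[abs_def] K_def[abs_def])
qed


lemma F_L1_loc: "F t \<in> L1_loc"
proof -
  have "set_integrable lborel K (F t)" if "compact K" for K
  proof -
    have "integrable lborel (indicat_real K)"
      by (rule integrable_real_indicator)
         (use that emeasure_compact_finite in \<open>auto simp: compact_imp_closed less_top\<close>)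
    from integrable_mult_F[OF this] show ?thesis by (simp add: set_integrable_def)
  qed
  then show ?thesis by (simp add: L1_loc_def)
qed

text \<open>The momentum balance on an interval, from plateaus that approximate its indicator.\<close>

lemma momentum_derivative:
  assumes ab: "a \<le> b"
  shows "((\<lambda>t. LINT x:{a..b}|lborel. u t x) has_real_derivative
      ((u t a)\<^sup>2 - (u t b)\<^sup>2) / 2 + 1/2 * (LINT x:{a..b}|lborel. F t x)) (at t)"
proof (rule primitive_derivative)
  define k where "k t = ((u t a)\<^sup>2 - (u t b)\<^sup>2) / 2 + 1/2 * (LINT x:{a..b}|lborel. F t x)" for t
  have iw: "integrable lborel (indicat_real {a..b})" by simp
  have cu: "continuous_on UNIV (\<lambda>t. u t x)" for x
    using continuous_on_compose2[OF jointly_continuous_u, of UNIV "\<lambda>t. (x, t)"]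
    by (simp add: continuous_intros)
  have ck: "continuous_on UNIV k"
    unfolding k_def set_lebesgue_integral_def real_scaleR_def
    by (intro continuous_intros cu continuous_integral_F[OF iw]) simp_all
  then show "continuous_on UNIV (\<lambda>t. ((u t a)\<^sup>2 - (u t b)\<^sup>2) / 2 + 1/2 * (LINT x:{a..b}|lborel. F t x))"
    unfolding k_def[abs_def] .
  note FL = F_L1_loc
  show "primitive (\<lambda>t. LINT x:{a..b}|lborel. u t x)
      (\<lambda>t. ((u t a)\<^sup>2 - (u t b)\<^sup>2) / 2 + 1/2 * (LINT x:{a..b}|lborel. F t x))"
    unfolding k_def[symmetric] primitive_def
  proof (intro conjI allI impI L1_loc_continuous ck)
    fix s t :: real assume st: "s \<le> t"
    let ?\<eta> = "\<lambda>n. plateau n a b"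
    define A where "A n t = (LINT x|lborel. u t x * ?\<eta> n x)" for n t
    define K where "K n t = 1/2 * (LINT x|lborel. (u t x)\<^sup>2 * dir_deriv 1 (?\<eta> n) x) + 1/2 * (LINT x|lborel. ?\<eta> n x * F t x)" for n t
    note test = test_function_plateau[OF ab]
    obtain B where B: "0 \<le> B" "\<And>\<tau> x. \<tau> \<in> {s..t} \<Longrightarrow> \<bar>u \<tau> x\<bar> \<le> B"
      using norm_u_bounded_on by blast
    let ?m = "\<lambda>n c \<tau>. LINT x|lborel. (u \<tau> x)\<^sup>2 * (real (Suc n) * smooth_bump (real (Suc n) * (x - c)))"
    have cu2: "continuous_on UNIV (\<lambda>x. (u \<tau> x)\<^sup>2)" for \<tau> by (intro continuous_intros continuous_u_space)
    have im: "integrable lborel (\<lambda>x. (u \<tau> x)\<^sup>2 * (real (Suc n) * smooth_bump (real (Suc n) * (x - c))))" for \<tau> n c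
      by (rule smooth_bump_approximate_identity(1)[OF cu2])
    have K: "K n \<tau> = 1/2 * (?m n a \<tau> - ?m n b \<tau>) + 1/2 * (LINT x|lborel. F \<tau> x * ?\<eta> n x)" for n \<tau>
      using Bochner_Integration.integral_diff[OF im[of \<tau> n a] im[of \<tau> n b]]
      unfolding K_def by (simp only: plateau_derivative mult.commute[of "F _ _"] flip: right_diff_distrib)
    have Klim: "(\<lambda>n. K n \<tau>) \<longlonglongrightarrow> k \<tau>" for \<tau>
    proof -
      have "(\<lambda>n. K n \<tau>) \<longlonglongrightarrow> 1/2 * ((u \<tau> a)\<^sup>2 - (u \<tau> b)\<^sup>2) + 1/2 * (LINT x:{a..b}|lborel. F \<tau> x)"
        unfolding K by (intro tendsto_intros smooth_bump_approximate_identity(2) cu2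
            L1_loc_integral_plateau_LIMSEQ(2) FL ab)
      then show ?thesis by (simp add: k_def)
    qed
    define C where "C = B\<^sup>2 + 1/2 * ((b + 1 - a) * total_mass)"
    have Kbound: "\<bar>K n \<tau>\<bar> \<le> C" if \<tau>: "\<tau> \<in> {s..t}" for n \<tau>
    proof -
      have "\<bar>(u \<tau> x)\<^sup>2\<bar> \<le> B\<^sup>2" for x
        using power_mono[OF B(2)[OF \<tau>, of x], of 2] by simp
      from smooth_bump_mollifier_bound[OF cu2 this] have 1: "\<bar>?m n c \<tau>\<bar> \<le> B\<^sup>2" for c .
      have "\<bar>LINT x|lborel. F \<tau> x * ?\<eta> n x\<bar> \<le> (LINT x|lborel. \<bar>F \<tau> x * ?\<eta> n x\<bar>)"
        by (rule integral_abs_bound)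
      also have "\<dots> \<le> (LINT x|lborel. total_mass * indicator {a..b+1} x)"
      proof (rule integral_mono)
        show "integrable lborel (\<lambda>x. \<bar>F \<tau> x * ?\<eta> n x\<bar>)"
          by (intro integrable_abs L1_loc_integral_plateau_LIMSEQ(1) FL ab)
        show "\<bar>F \<tau> x * ?\<eta> n x\<bar> \<le> total_mass * indicator {a..b+1} x" for x
          unfolding abs_mult using F_nonneg[of \<tau> x] F_le_total_mass[of \<tau> x]
          by (intro mult_mono plateau_bounds ab) auto
      qed simp
      also have "\<dots> = (b + 1 - a) * total_mass" using ab by simp
      finally have 2: "\<bar>LINT x|lborel. F \<tau> x * ?\<eta> n x\<bar> \<le> (b + 1 - a) * total_mass" .
      have "\<bar>1/2 * (X - Y) + 1/2 * Z\<bar> \<le> p + 1/2 * r"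
        if "\<bar>X\<bar> \<le> p" "\<bar>Y\<bar> \<le> p" "\<bar>Z\<bar> \<le> r" for X Y Z p r :: real
        using that by (auto simp: abs_le_iff field_simps)
      from this[OF 1 1 2] show ?thesis unfolding K C_def .
    qed
    have meas: "K n \<in> borel_measurable borel" for n
      unfolding K_def by (intro borel_measurable_continuous_onI momentum_weak(1) test)
    have "(\<lambda>n. LINT \<tau>:{s..t}|lborel. K n \<tau>) \<longlonglongrightarrow> (LINT \<tau>:{s..t}|lborel. k \<tau>)"
      unfolding set_lebesgue_integral_def
    proof (rule integral_dominated_convergence[where w = "\<lambda>\<tau>. C * indicator {s..t} \<tau>"])
      show "(\<lambda>\<tau>. indicator {s..t} \<tau> *\<^sub>R k \<tau>) \<in> borel_measurable lborel"
        using borel_measurable_continuous_onI[OF ck] by measurable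
      show "(\<lambda>\<tau>. indicator {s..t} \<tau> *\<^sub>R K n \<tau>) \<in> borel_measurable lborel" for n
        using meas by measurable
      show "AE \<tau> in lborel. norm (indicator {s..t} \<tau> *\<^sub>R K n \<tau>) \<le> C * indicator {s..t} \<tau>" for n
        using Kbound by (intro AE_I2) (auto simp: indicator_def)
      show "AE \<tau> in lborel. (\<lambda>n. indicator {s..t} \<tau> *\<^sub>R K n \<tau>) \<longlonglongrightarrow> indicator {s..t} \<tau> *\<^sub>R k \<tau>"
        by (intro AE_I2 tendsto_intros Klim)
    qed simp
    moreover have "A n t - A n s = (LINT \<tau>:{s..t}|lborel. K n \<tau>)" for n
      using momentum_weak(2)[OF test, of n] st unfolding primitive_def A_def K_def by blast
    moreover have "(\<lambda>n. A n t - A n s) \<longlonglongrightarrow> (LINT x:{a..b}|lborel. u t x) - (LINT x:{a..b}|lborel. u s x)"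
      unfolding A_def
      by (intro tendsto_diff L1_loc_integral_plateau_LIMSEQ(2) L1_loc_continuous continuous_u_space ab)
    ultimately show "(LINT x:{a..b}|lborel. u t x) - (LINT x:{a..b}|lborel. u s x) = (LINT \<tau>:{s..t}|lborel. k \<tau>)"
      using LIMSEQ_unique by force
  qed
qed


section \<open>The velocity along a quantile\<close>

text \<open>The chain rule for an integral with a moving end point. The two partial derivatives come from
\<open>momentum_derivative\<close> and from the fundamental theorem of calculus; the second one is jointly
continuous.\<close>

lemma moving_integral_derivative:
  assumes y: "(y has_real_derivative y') (at t)" and L: "L < y t"
  shows "((\<lambda>t. integral {L..y t} (u t)) has_real_derivative
      ((u t L)\<^sup>2 - (u t (y t))\<^sup>2) / 2 + 1/2 * integral {L..y t} (F t) + u t (y t) * y') (at t)"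
proof -
  have ui: "(LINT x:{L..z}|lborel. u t x) = integral {L..z} (u t)" for z t
    by (intro set_borel_integral_eq_integral(2) L1_loc_integrable_Icc L1_loc_continuous continuous_u_space)
  have Fi: "(LINT x:{L..z}|lborel. F t x) = integral {L..z} (F t)" for z t
    by (intro set_borel_integral_eq_integral(2) L1_loc_integrable_Icc F_L1_loc)
  define G where "G t z = integral {L..z} (u t)" for t z
  define k where "k z = ((u t L)\<^sup>2 - (u t z)\<^sup>2) / 2 + 1/2 * integral {L..z} (F t)" for z
  have Gt: "((\<lambda>t. G t (y t0)) has_derivative (\<lambda>h. k (y t0) * h)) (at t within UNIV)" if "t0 = t" for t0
    using momentum_derivative[of L "y t" t] L that
    unfolding ui Fi G_def k_def has_field_derivative_def by simp
  have Gx: "((\<lambda>z. G s z) has_derivative blinfun_apply (blinfun_mult_right (u s z))) (at z within {L<..})"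
    if "z \<in> {L<..}" for s z
  proof -
    have "((\<lambda>z. G s z) has_real_derivative u s z) (at z within {L..z+1})"
      unfolding G_def using that by (intro integral_has_real_derivative continuous_u_space) auto
    moreover have "at z within {L..z+1} = at z" using that by (intro at_within_interior) simp
    ultimately have "((\<lambda>z. G s z) has_real_derivative u s z) (at z)" by simp
    then show ?thesis
      unfolding has_field_derivative_def blinfun_mult_right.rep_eq by (rule has_derivative_at_withinI)
  qed
  have cont: "continuous (at (t, y t) within UNIV \<times> {L<..}) (\<lambda>(s, z). blinfun_mult_right (u s z))"
  proof -
    have "continuous_on UNIV (\<lambda>p. u (fst p) (snd p))"
      using continuous_on_compose2[OF jointly_continuous_u, of UNIV "\<lambda>p. (snd p, fst p)"]
      by (simp add: continuous_intros)
    then have "continuous_on UNIV (\<lambda>p. blinfun_mult_right (u (fst p) (snd p)))"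
      by (rule bounded_linear.continuous_on[OF bounded_linear_blinfun_mult_right])
    then show ?thesis
      by (simp add: continuous_on_eq_continuous_at continuous_at_imp_continuous_at_within case_prod_beta')
  qed
  have "((\<lambda>(s, z). G s z) has_derivative (\<lambda>(h, j). k (y t) * h + blinfun_mult_right (u t (y t)) j))
      (at (t, y t) within UNIV \<times> {L<..})"
    by (rule has_derivative_partialsI[OF Gt Gx cont]) (use L in auto)
  moreover have "at (t, y t) within UNIV \<times> {L<..} = at (t, y t)"
    using L by (intro at_within_open open_Times) auto
  ultimately have D: "((\<lambda>(s, z). G s z) has_derivative (\<lambda>(h, j). k (y t) * h + u t (y t) * j)) (at (t, y t))"
    by simp
  have "((\<lambda>s. (s, y s)) has_derivative (\<lambda>h. (h, y' * h))) (at t)"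
    using y by (auto intro!: has_derivative_Pair simp: has_field_derivative_def)
  from has_derivative_compose[OF this D]
  have "((\<lambda>s. G s (y s)) has_derivative (\<lambda>h. k (y t) * h + u t (y t) * (y' * h))) (at t)" by simp
  then have "((\<lambda>s. integral {L..y s} (u s)) has_derivative (\<lambda>h. k (y t) * h + u t (y t) * (y' * h))) (at t)"
    unfolding G_def .
  then show ?thesis
    unfolding has_field_derivative_def by (rule has_derivative_eq_rhs) (auto simp: G_def k_def algebra_simps)
qed

lemma AE_no_atoms: "AE t in lborel. \<forall>x. measure (\<mu> t) {x} = 0"
proof -
  have "AE t in lborel. \<mu> t = energy_density (u t)"
    using solution by (simp add: conservative_solution_def)
  then show ?thesis
  proof eventually_elim
    case (elim t)
    have "emeasure (energy_density (u t)) {x} = 0" for x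
      unfolding energy_density_def by (subst emeasure_density) (auto intro!: nn_integral_null_set)
    then show ?case unfolding elim by (simp add: measure_def)
  qed
qed

context
  fixes \<alpha> assumes \<alpha>: "0 < \<alpha>" "\<alpha> < total_mass"
begin

lemma F_q_ge: "\<alpha> \<le> F t (q \<alpha> t)"
  using q_le_iff[OF \<alpha>] by blast

lemma measure_left_q: "measure (\<mu> t) {..<q \<alpha> t} \<le> \<alpha>"
proof (rule tendsto_upperbound)
  show "(F t \<longlongrightarrow> measure (\<mu> t) {..<q \<alpha> t}) (at_left (q \<alpha> t))"
    unfolding F_def[abs_def] by (rule finite_borel_measure.cdf_at_left[OF finite_borel])
  show "\<forall>\<^sub>F x in at_left (q \<alpha> t). F t x \<le> \<alpha>"
  proof -
    have "F t x \<le> \<alpha>" if "x < q \<alpha> t" for x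
      using q_le_iff[OF \<alpha>, of t x] that by linarith
    then show ?thesis by (auto simp: eventually_at_filter)
  qed
qed simp

lemma F_q_eq:
  assumes "measure (\<mu> t) {q \<alpha> t} = 0"
  shows "F t (q \<alpha> t) = \<alpha>"
proof -
  interpret finite_measure "\<mu> t" by (rule finite_\<mu>)
  have "{..q \<alpha> t} = {..<q \<alpha> t} \<union> {q \<alpha> t}" by auto
  then have "F t (q \<alpha> t) = measure (\<mu> t) {..<q \<alpha> t} + measure (\<mu> t) {q \<alpha> t}"
    unfolding F_def cdf_def by (simp only:) (rule finite_measure_Union, auto)
  then show ?thesis using F_q_ge[of t] measure_left_q[of t] assms by linarith
qed

text \<open>With \<open>Y = q \<alpha>\<close>, the momentum flux \<open>- u(Y + \<delta>)\<^sup>2/2 + u(Y)\<^sup>2/2\<close> and the motion of the interval,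
\<open>u(Y) (u(Y + \<delta>) - u(Y))\<close>, add up to \<open>- (u(Y + \<delta>) - u(Y))\<^sup>2/2\<close>. After division by \<open>\<delta>\<close> this square
is bounded by the energy in \<open>(Y, Y + \<delta>)\<close>. The bound by the total mass holds at all times and
dominates the derivatives as \<open>\<delta>\<close> tends to zero.\<close>

lemma averaged_velocity_derivative:
  assumes \<delta>: "0 < \<delta>"
  obtains r where
    "((\<lambda>t. integral {q \<alpha> t..q \<alpha> t + \<delta>} (u t) / \<delta> - \<alpha> / 2 * t) has_real_derivative r) (at t)"
    "\<bar>r\<bar> \<le> total_mass" "measure (\<mu> t) {q \<alpha> t} = 0 \<Longrightarrow> \<bar>r\<bar> \<le> F t (q \<alpha> t + \<delta>) - \<alpha>"
proof -
  let ?Y = "q \<alpha>"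
  define L where "L = ?Y t - 1"
  define r where "r = - (u t (?Y t + \<delta>) - u t (?Y t))\<^sup>2 / 2 / \<delta>
      + 1/2 * (integral {?Y t..?Y t + \<delta>} (F t) / \<delta> - \<alpha>)"
  have ui: "u t integrable_on {a..b}" for t a b
    by (intro integrable_continuous_interval continuous_u_space)
  have Fi: "F t integrable_on {a..b}" for t a b
    by (intro set_borel_integral_eq_integral(1) L1_loc_integrable_Icc F_L1_loc)
  have dY: "(?Y has_real_derivative u t (?Y t)) (at t)" by (rule q_derivative[OF \<alpha>])
  then have dY': "((\<lambda>t. ?Y t + \<delta>) has_real_derivative u t (?Y t)) (at t)"
    by (auto intro!: derivative_eq_intros)
  have "((\<lambda>s. (integral {L..?Y s + \<delta>} (u s) - integral {L..?Y s} (u s)) / \<delta> - \<alpha> / 2 * s) has_real_derivative r) (at t)"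
  proof (rule DERIV_cong[OF DERIV_diff[OF DERIV_cdivide[OF DERIV_diff[OF
        moving_integral_derivative[OF dY', of L] moving_integral_derivative[OF dY, of L]]]
        DERIV_cmult_Id]])
    have "integral {L..?Y t + \<delta>} (F t) = integral {L..?Y t} (F t) + integral {?Y t..?Y t + \<delta>} (F t)"
      using \<delta> by (intro Henstock_Kurzweil_Integration.integral_combine[symmetric] Fi) (auto simp: L_def)
    then show "(((u t L)\<^sup>2 - (u t (?Y t + \<delta>))\<^sup>2) / 2 + 1 / 2 * integral {L..?Y t + \<delta>} (F t) + u t (?Y t + \<delta>) * u t (?Y t) -
      (((u t L)\<^sup>2 - (u t (?Y t))\<^sup>2) / 2 + 1 / 2 * integral {L..?Y t} (F t) + u t (?Y t) * u t (?Y t))) / \<delta> - \<alpha> / 2 = r"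
      using \<delta> by (simp add: r_def power2_eq_square field_simps)
  qed (use \<delta> in \<open>auto simp: L_def\<close>)
  moreover have "\<forall>\<^sub>F s in nhds t. integral {?Y s..?Y s + \<delta>} (u s) / \<delta> - \<alpha> / 2 * s
      = (integral {L..?Y s + \<delta>} (u s) - integral {L..?Y s} (u s)) / \<delta> - \<alpha> / 2 * s"
  proof -
    have "isCont ?Y t" using dY by (rule DERIV_isCont)
    then have "\<forall>\<^sub>F s in nhds t. L < ?Y s"
      by (intro order_tendstoD(1)[of ?Y "?Y t"]) (auto simp: L_def isCont_def tendsto_at_iff_tendsto_nhds)
    then show ?thesis
    proof eventually_elim
      case (elim s)
      have "integral {L..?Y s} (u s) + integral {?Y s..?Y s + \<delta>} (u s) = integral {L..?Y s + \<delta>} (u s)"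
        using \<delta> elim by (intro Henstock_Kurzweil_Integration.integral_combine ui) auto
      then show ?case by simp
    qed
  qed
  ultimately have d: "((\<lambda>t. integral {?Y t..?Y t + \<delta>} (u t) / \<delta> - \<alpha> / 2 * t) has_real_derivative r) (at t)"
    by (subst DERIV_cong_ev[OF refl _ refl])
  interpret finite_measure "\<mu> t" by (rule finite_\<mu>)
  have sq: "(u t (?Y t + \<delta>) - u t (?Y t))\<^sup>2 / \<delta> \<le> measure (\<mu> t) {?Y t<..<?Y t + \<delta>}"
    using square_increment_u[of "?Y t" "?Y t + \<delta>" t] \<delta> by (simp add: field_simps)
  have "measure (\<mu> t) {?Y t<..<?Y t + \<delta>} \<le> measure (\<mu> t) {?Y t<..?Y t + \<delta>}"
    by (rule finite_measure_mono) auto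
  also have "\<dots> = F t (?Y t + \<delta>) - F t (?Y t)"
    unfolding F_def using \<delta> by (subst finite_borel_measure.cdf_diff_eq[OF finite_borel]) auto
  finally have sq2: "(u t (?Y t + \<delta>) - u t (?Y t))\<^sup>2 / \<delta> \<le> F t (?Y t + \<delta>) - F t (?Y t)"
    using sq by linarith
  have sq0: "0 \<le> (u t (?Y t + \<delta>) - u t (?Y t))\<^sup>2 / \<delta>" using \<delta> by simp
  have mono: "F t (?Y t) \<le> F t z" "F t z \<le> F t (?Y t + \<delta>)" if "z \<in> {?Y t..?Y t + \<delta>}" for z
    using that by (auto intro!: F_mono)
  have "integral {?Y t..?Y t + \<delta>} (\<lambda>_. F t (?Y t)) \<le> integral {?Y t..?Y t + \<delta>} (F t)"
    by (intro integral_le Fi mono) auto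
  then have av1: "F t (?Y t) \<le> integral {?Y t..?Y t + \<delta>} (F t) / \<delta>"
    using \<delta> by (simp add: field_simps)
  have "integral {?Y t..?Y t + \<delta>} (F t) \<le> integral {?Y t..?Y t + \<delta>} (\<lambda>_. F t (?Y t + \<delta>))"
    by (intro integral_le Fi mono) auto
  then have av2: "integral {?Y t..?Y t + \<delta>} (F t) / \<delta> \<le> F t (?Y t + \<delta>)"
    using \<delta> by (simp add: field_simps)
  have r: "r = - ((u t (?Y t + \<delta>) - u t (?Y t))\<^sup>2 / \<delta>) / 2 + 1/2 * (integral {?Y t..?Y t + \<delta>} (F t) / \<delta> - \<alpha>)"
    by (simp add: r_def)
  have arith: "\<bar>- X / 2 + 1/2 * (I - \<alpha>)\<bar> \<le> total_mass \<and> (f1 = \<alpha> \<longrightarrow> \<bar>- X / 2 + 1/2 * (I - \<alpha>)\<bar> \<le> f2 - \<alpha>)"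
    if "X \<le> f2 - f1" "0 \<le> X" "f1 \<le> I" "I \<le> f2" "0 \<le> f1" "f2 \<le> total_mass" "\<alpha> \<le> f1" for X I f1 f2
    using that \<alpha> by (auto simp: abs_le_iff field_simps)
  note bounds = arith[OF sq2 sq0 av1 av2 F_nonneg F_le_total_mass F_q_ge, folded r]
  show ?thesis
    by (rule that[OF d conjunct1[OF bounds] conjunct2[OF bounds, THEN mp, OF F_q_eq]])
qed

text \<open>Dominated convergence as \<open>\<delta> \<rightarrow> 0\<close>. At the exceptional times, where the energy may have an atom on
the curve, the derivatives are replaced by zero, which does not change their integrals.\<close>

lemma u_along_q:
  assumes "a \<le> b"
  shows "u b (q \<alpha> b) - u a (q \<alpha> a) = \<alpha> / 2 * (b - a)"
proof -
  let ?Y = "q \<alpha>"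
  define \<delta> where "\<delta> n = inverse (real (Suc n))" for n
  have \<delta>: "0 < \<delta> n" for n by (simp add: \<delta>_def)
  have \<delta>0: "\<delta> \<longlonglongrightarrow> 0" unfolding \<delta>_def by (rule LIMSEQ_inverse_real_of_nat)
  define E where "E n t = integral {?Y t..?Y t + \<delta> n} (u t) / \<delta> n - \<alpha> / 2 * t" for n t
  have "\<exists>r. (E n has_real_derivative r) (at t) \<and> \<bar>r\<bar> \<le> total_mass \<and>
      (measure (\<mu> t) {?Y t} = 0 \<longrightarrow> \<bar>r\<bar> \<le> F t (?Y t + \<delta> n) - \<alpha>)" for n t
    unfolding E_def by (rule averaged_velocity_derivative[OF \<delta>, of n t]) blast
  then obtain r where r: "\<And>n t. (E n has_real_derivative r n t) (at t)" "\<And>n t. \<bar>r n t\<bar> \<le> total_mass"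
      "\<And>n t. measure (\<mu> t) {?Y t} = 0 \<Longrightarrow> \<bar>r n t\<bar> \<le> F t (?Y t + \<delta> n) - \<alpha>"
    by metis
  obtain N where N: "N \<in> null_sets lborel" "{t. \<not> (\<forall>x. measure (\<mu> t) {x} = 0)} \<subseteq> N"
    using AE_no_atoms by (auto elim!: AE_E simp: null_sets_def)
  have negl: "negligible N"
    using N(1) by (simp add: negligible_iff_null_sets null_sets_completionI)
  define g where "g n t = (if t \<in> N then 0 else r n t)" for n t
  have FTC: "(r n has_integral (E n b - E n a)) {a..b}" for n
    by (rule fundamental_theorem_of_calculus[OF assms])
       (use r(1) in \<open>auto simp: has_real_derivative_iff_has_vector_derivative[symmetric] intro: has_field_derivative_at_within\<close>)
  have g: "(g n has_integral (E n b - E n a)) {a..b}" for n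
    by (rule has_integral_spike[OF negl _ FTC]) (simp add: g_def)
  have "(\<lambda>n. integral {a..b} (g n)) \<longlonglongrightarrow> integral {a..b} (\<lambda>_. 0)"
  proof (rule dominated_convergence(2))
    show "g n integrable_on {a..b}" for n using g by blast
    show "(\<lambda>_. total_mass) integrable_on {a..b}" by (rule integrable_const_ivl)
    show "norm (g n t) \<le> total_mass" for n t
      using r(2)[of n t] \<alpha> by (simp add: g_def)
    show "(\<lambda>n. g n t) \<longlonglongrightarrow> 0" for t
    proof (cases "t \<in> N")
      case False
      then have m: "measure (\<mu> t) {?Y t} = 0" using N(2) by blast
      have "continuous (at_right (?Y t)) (F t)" by (rule F.cont)
      then have "(F t \<longlongrightarrow> F t (?Y t)) (at_right (?Y t))" by (simp add: continuous_within)
      moreover have "filterlim (\<lambda>n. ?Y t + \<delta> n) (at_right (?Y t)) sequentially"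
      proof -
        have "(\<lambda>n. ?Y t + \<delta> n) \<longlonglongrightarrow> ?Y t + 0" by (intro tendsto_intros \<delta>0)
        moreover have "\<delta> n \<noteq> 0" for n using \<delta>[of n] by linarith
        ultimately show ?thesis using \<delta> by (simp add: filterlim_at)
      qed
      ultimately have "(\<lambda>n. F t (?Y t + \<delta> n)) \<longlonglongrightarrow> F t (?Y t)" by (rule filterlim_compose)
      then have lim: "(\<lambda>n. F t (?Y t + \<delta> n) - \<alpha>) \<longlonglongrightarrow> 0"
        using F_q_eq[OF m] by (simp add: LIM_zero_iff)
      show ?thesis
        by (rule Lim_null_comparison[OF _ lim]) (use r(3)[OF m] False in \<open>auto simp: g_def\<close>)
    qed (simp add: g_def)
  qed
  moreover have "integral {a..b} (g n) = E n b - E n a" for n using g by (rule integral_unique)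
  ultimately have lim0: "(\<lambda>n. E n b - E n a) \<longlonglongrightarrow> 0" by simp
  have limE: "(\<lambda>n. E n t) \<longlonglongrightarrow> u t (?Y t) - \<alpha> / 2 * t" for t
  proof -
    have "((\<lambda>z. integral {?Y t..z} (u t)) has_real_derivative u t (?Y t)) (at (?Y t) within {?Y t..?Y t + 1})"
      by (intro integral_has_real_derivative continuous_u_space) simp
    then have "((\<lambda>z. integral {?Y t..z} (u t) / (z - ?Y t)) \<longlongrightarrow> u t (?Y t)) (at (?Y t) within {?Y t..?Y t + 1})"
      by (simp add: has_field_derivative_iff)
    moreover have "filterlim (\<lambda>n. ?Y t + \<delta> n) (at (?Y t) within {?Y t..?Y t + 1}) sequentially"
    proof -
      have "(\<lambda>n. ?Y t + \<delta> n) \<longlonglongrightarrow> ?Y t + 0" by (intro tendsto_intros \<delta>0)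
      moreover have "?Y t + \<delta> n \<in> {?Y t..?Y t + 1}" "?Y t + \<delta> n \<noteq> ?Y t" for n
        using \<delta>[of n] by (auto simp: \<delta>_def inverse_le_1_iff)
      ultimately show ?thesis unfolding filterlim_at by (auto intro!: always_eventually)
    qed
    ultimately have "(\<lambda>n. integral {?Y t..?Y t + \<delta> n} (u t) / (?Y t + \<delta> n - ?Y t)) \<longlonglongrightarrow> u t (?Y t)"
      by (rule filterlim_compose)
    then have "(\<lambda>n. integral {?Y t..?Y t + \<delta> n} (u t) / \<delta> n) \<longlonglongrightarrow> u t (?Y t)" by simp
    then show ?thesis unfolding E_def by (intro tendsto_intros)
  qed
  have "(u b (?Y b) - \<alpha> / 2 * b) - (u a (?Y a) - \<alpha> / 2 * a) = 0"
    using LIMSEQ_unique[OF tendsto_diff[OF limE limE] lim0] .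
  then show ?thesis by (simp add: algebra_simps)
qed

end

section \<open>Asymptotics of the velocity\<close>

text \<open>Between \<open>x\<close> and \<open>q \<gamma> t\<close> there is at most the energy \<open>\<bar>F t x - \<gamma>\<bar>\<close>.\<close>

lemma near_quantile:
  assumes \<gamma>: "0 < \<gamma>" "\<gamma> < total_mass"
  shows "(u t x - u t (q \<gamma> t))\<^sup>2 \<le> \<bar>x - q \<gamma> t\<bar> * \<bar>F t x - \<gamma>\<bar>"
proof -
  interpret finite_measure "\<mu> t" by (rule finite_\<mu>)
  show ?thesis
  proof (cases "q \<gamma> t \<le> x")
    case True
    have "measure (\<mu> t) {q \<gamma> t<..<x} \<le> F t x - \<gamma>"
    proof (cases "q \<gamma> t = x")
      case False
      have "measure (\<mu> t) {q \<gamma> t<..<x} \<le> measure (\<mu> t) {q \<gamma> t<..x}" by (rule finite_measure_mono) auto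
      also have "\<dots> = F t x - F t (q \<gamma> t)"
        unfolding F_def using True False by (subst finite_borel_measure.cdf_diff_eq[OF finite_borel]) auto
      finally show ?thesis using F_q_ge[OF \<gamma>, of t] by linarith
    qed (use F_q_ge[OF \<gamma>, of t] in simp)
    then have "(x - q \<gamma> t) * measure (\<mu> t) {q \<gamma> t<..<x} \<le> (x - q \<gamma> t) * (F t x - \<gamma>)"
      using True by (intro mult_left_mono) auto
    moreover have "\<gamma> \<le> F t x" using True q_le_iff[OF \<gamma>] by blast
    then have "\<bar>x - q \<gamma> t\<bar> = x - q \<gamma> t" "\<bar>F t x - \<gamma>\<bar> = F t x - \<gamma>" using True by auto
    ultimately show ?thesis using square_increment_u[OF True, of t] by linarith
  next
    case False
    have "measure (\<mu> t) ({..<q \<gamma> t} - {..x}) = measure (\<mu> t) {..<q \<gamma> t} - measure (\<mu> t) {..x}"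
      by (rule finite_measure_Diff) (use False in auto)
    moreover have "{..<q \<gamma> t} - {..x} = {x<..<q \<gamma> t}" by auto
    ultimately have "measure (\<mu> t) {x<..<q \<gamma> t} = measure (\<mu> t) {..<q \<gamma> t} - measure (\<mu> t) {..x}"
      by (simp only:)
    then have "measure (\<mu> t) {x<..<q \<gamma> t} \<le> \<gamma> - F t x"
      using measure_left_q[OF \<gamma>, of t] by (simp add: F_def cdf_def)
    then have "(q \<gamma> t - x) * measure (\<mu> t) {x<..<q \<gamma> t} \<le> (q \<gamma> t - x) * (\<gamma> - F t x)"
      using False by (intro mult_left_mono) auto
    moreover have "F t x < \<gamma>" using False q_le_iff[OF \<gamma>, of t x] by linarith
    then have "\<bar>x - q \<gamma> t\<bar> = q \<gamma> t - x" "\<bar>F t x - \<gamma>\<bar> = \<gamma> - F t x" using False by auto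
    moreover have "(u t (q \<gamma> t) - u t x)\<^sup>2 \<le> (q \<gamma> t - x) * measure (\<mu> t) {x<..<q \<gamma> t}"
      by (rule square_increment_u) (use False in simp)
    ultimately show ?thesis
      unfolding power2_commute[of "u t x"] by simp
  qed
qed

lemma q_mono:
  assumes "0 < \<gamma>" "\<gamma> \<le> \<gamma>'" "\<gamma>' < total_mass"
  shows "q \<gamma> t \<le> q \<gamma>' t"
proof -
  have "\<gamma>' \<le> F t (q \<gamma>' t)" using assms by (intro F_q_ge) auto
  then show ?thesis using assms q_le_iff[of \<gamma> t "q \<gamma>' t"] by auto
qed

lemma u_at_q:
  assumes "0 < \<gamma>" "\<gamma> < total_mass"
  shows "u t (q \<gamma> t) = u 0 (q \<gamma> 0) + \<gamma> / 2 * t"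
  using u_along_q[OF assms, of 0 t] u_along_q[OF assms, of t 0] by (cases "0 \<le> t") (auto simp: algebra_simps)

lemma q_eq:
  assumes \<gamma>: "0 < \<gamma>" "\<gamma> < total_mass"
  shows "q \<gamma> t = q \<gamma> 0 + u 0 (q \<gamma> 0) * t + \<gamma> / 4 * t\<^sup>2"
proof -
  have "((\<lambda>s. q \<gamma> s - (u 0 (q \<gamma> 0) * s + \<gamma> / 4 * s\<^sup>2)) has_real_derivative 0) (at s)" for s
    using q_derivative[OF \<gamma>, of s] unfolding u_at_q[OF \<gamma>, of s]
    by (auto intro!: derivative_eq_intros)
  then have "q \<gamma> t - (u 0 (q \<gamma> 0) * t + \<gamma> / 4 * t\<^sup>2) = q \<gamma> 0 - (u 0 (q \<gamma> 0) * 0 + \<gamma> / 4 * 0\<^sup>2)"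
    by (intro DERIV_isconst_all) blast
  then show ?thesis by simp
qed

text \<open>Without energy there are no quantiles; then \<open>u\<close> is constant in space and the momentum balance
makes it constant in time.\<close>

lemma u_without_mass:
  assumes "total_mass = 0"
  shows "u t x = u 0 0"
proof -
  have const: "u t x = u t y" if "x \<le> y" for t x y
  proof -
    have "measure (\<mu> t) {x<..<y} \<le> measure (\<mu> t) UNIV"
      using finite_measure.bounded_measure[OF finite_\<mu>, of t] by simp
    then have "measure (\<mu> t) {x<..<y} = 0"
      using assms mass_conserved[of t] measure_nonneg[of "\<mu> t" "{x<..<y}"]
      unfolding total_mass_def by linarith
    then show ?thesis using square_increment_u[OF that, of t] by simp
  qed
  then have flat: "u t x = u t 0" for t x using linear[of x 0] by metis
  have F0: "F t = (\<lambda>_. 0)" for t using F_nonneg F_le_total_mass assms by (intro ext) (metis order_antisym)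
  have "((\<lambda>t. LINT x:{0..1}|lborel. u t x) has_real_derivative 0) (at t)" for t
    using momentum_derivative[of 0 1 t] flat[of t 1] by (simp add: F0 set_lebesgue_integral_def)
  moreover have "(LINT x:{0..1}|lborel. u t x) = u t 0" for t
  proof -
    have "(LINT x:{0..1}|lborel. u t x) = (LINT x:{0..1::real}|lborel. u t 0)"
      by (rule arg_cong[where f = "set_lebesgue_integral lborel {0..1}"]) (use flat in auto)
    then show ?thesis by (simp add: set_lebesgue_integral_def)
  qed
  ultimately have "((\<lambda>t. u t 0) has_real_derivative 0) (at t)" for t by simp
  then have "u t 0 = u 0 0" by (intro DERIV_isconst_all[of "\<lambda>t. u t 0"]) blast
  then show ?thesis using flat[of t x] by simp
qed

lemma total_mass_nonneg: "0 \<le> total_mass"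
  by (simp add: total_mass_def)

text \<open>On quantile curves the difference is the initial velocity. Any other point \<open>x\<close> is compared with the
curves whose label \<open>\<gamma>\<close> tends to \<open>\<beta> = F t x\<close>; a limit is needed because \<open>\<beta>\<close> may be \<open>0\<close> or the total
mass, which are not labels of curves.\<close>

lemma u_minus_F_bound: "\<bar>u t x - t / 2 * F t x\<bar> \<le> norm (u 0)"
proof (cases "total_mass = 0")
  case True
  then have "F t x = 0" using F_nonneg[of t x] F_le_total_mass[of t x] by linarith
  then show ?thesis using u_without_mass[OF True, of t x] u_le_norm[of 0 0] by simp
next
  case False
  then have m: "0 < total_mass" using total_mass_nonneg by linarith
  define \<beta> where "\<beta> = F t x"
  define h where "h = total_mass / 2"
  \<comment> \<open>labels strictly between \<open>0\<close> and the total mass; each lies between \<open>\<beta>\<close> and \<open>h\<close>, so its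
    curve lies between \<open>x\<close> and \<open>q h t\<close>\<close>
  define \<gamma> where "\<gamma> n = \<beta> + (h - \<beta>) * inverse (real (Suc n))" for n
  define K where "K = \<bar>x - q h t\<bar>"
  have \<beta>: "0 \<le> \<beta>" "\<beta> \<le> total_mass" using F_nonneg F_le_total_mass by (auto simp: \<beta>_def)
  have h: "0 < h" "h < total_mass" using m by (auto simp: h_def)
  have inv: "0 < inverse (real (Suc n))" "inverse (real (Suc n)) \<le> 1" for n
    by (auto simp: inverse_le_1_iff)
  have \<gamma>: "0 < \<gamma> n" "\<gamma> n < total_mass" "\<bar>x - q (\<gamma> n) t\<bar> \<le> K" for n
  proof -
    define \<theta> where "\<theta> = inverse (real (Suc n))"
    have \<theta>: "0 < \<theta>" "\<theta> \<le> 1" using inv by (auto simp: \<theta>_def)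
    have eq: "\<gamma> n = (1 - \<theta>) * \<beta> + \<theta> * h" by (simp add: \<gamma>_def \<theta>_def algebra_simps)
    have "0 \<le> (1 - \<theta>) * \<beta>" "0 < \<theta> * h" "(1 - \<theta>) * \<beta> \<le> (1 - \<theta>) * total_mass" "\<theta> * h < \<theta> * total_mass"
      using \<theta> \<beta> h by (auto intro!: mult_nonneg_nonneg mult_left_mono)
    then show g: "0 < \<gamma> n" "\<gamma> n < total_mass" unfolding eq by (auto simp: algebra_simps)
    show "\<bar>x - q (\<gamma> n) t\<bar> \<le> K"
    proof (cases "\<beta> < h")
      case True
      then have "0 < (h - \<beta>) * \<theta>" "(h - \<beta>) * \<theta> \<le> (h - \<beta>) * 1" using \<theta> by (auto intro!: mult_left_mono)
      then have "\<beta> < \<gamma> n" "\<gamma> n \<le> h" unfolding \<gamma>_def \<theta>_def[symmetric] by auto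
      then have "x < q (\<gamma> n) t" "q (\<gamma> n) t \<le> q h t"
        using q_le_iff[OF g, of t x] q_mono[OF g(1) _ h(2)] by (auto simp: \<beta>_def not_le[symmetric])
      then show ?thesis by (simp add: K_def)
    next
      case False
      then have "(h - \<beta>) * \<theta> \<le> 0" "(h - \<beta>) * 1 \<le> (h - \<beta>) * \<theta>"
        using \<theta> mult_left_mono_neg[of \<theta> 1 "h - \<beta>"] by (auto simp: mult_nonpos_nonneg)
      then have "\<gamma> n \<le> \<beta>" "h \<le> \<gamma> n" unfolding \<gamma>_def \<theta>_def[symmetric] by auto
      then have "q (\<gamma> n) t \<le> x" "q h t \<le> q (\<gamma> n) t"
        using q_le_iff[OF g, of t x] q_mono[OF h(1) _ g(2)] by (auto simp: \<beta>_def)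
      then show ?thesis by (simp add: K_def)
    qed
  qed
  have lim: "\<gamma> \<longlonglongrightarrow> \<beta>"
    using tendsto_add[OF tendsto_const tendsto_mult_left[OF LIMSEQ_inverse_real_of_nat, of "h - \<beta>"], of \<beta>]
    unfolding \<gamma>_def[abs_def] by simp
  have "\<bar>u t x - t / 2 * \<beta>\<bar> \<le> sqrt (K * \<bar>\<beta> - \<gamma> n\<bar>) + norm (u 0) + \<bar>t / 2\<bar> * \<bar>\<gamma> n - \<beta>\<bar>" for n
  proof -
    have "(u t x - u t (q (\<gamma> n) t))\<^sup>2 \<le> K * \<bar>\<beta> - \<gamma> n\<bar>"
      using near_quantile[OF \<gamma>(1,2), of t x n] mult_right_mono[OF \<gamma>(3)[of n], of "\<bar>\<beta> - \<gamma> n\<bar>"]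
      by (simp add: \<beta>_def)
    then have 1: "\<bar>u t x - u t (q (\<gamma> n) t)\<bar> \<le> sqrt (K * \<bar>\<beta> - \<gamma> n\<bar>)"
      using real_le_rsqrt[of "\<bar>u t x - u t (q (\<gamma> n) t)\<bar>"] by simp
    have 2: "\<bar>u t (q (\<gamma> n) t) - t / 2 * \<gamma> n\<bar> \<le> norm (u 0)"
      unfolding u_at_q[OF \<gamma>(1,2), of t n] using u_le_norm[of 0 "q (\<gamma> n) 0"] by (simp add: mult.commute)
    have 3: "\<bar>t / 2 * \<gamma> n - t / 2 * \<beta>\<bar> = \<bar>t / 2\<bar> * \<bar>\<gamma> n - \<beta>\<bar>"
      unfolding right_diff_distrib[symmetric] by (rule abs_mult)
    show ?thesis using 1 2 3 by linarith
  qed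
  moreover have "(\<lambda>n. sqrt (K * \<bar>\<beta> - \<gamma> n\<bar>) + norm (u 0) + \<bar>t / 2\<bar> * \<bar>\<gamma> n - \<beta>\<bar>)
      \<longlonglongrightarrow> sqrt (K * \<bar>\<beta> - \<beta>\<bar>) + norm (u 0) + \<bar>t / 2\<bar> * \<bar>\<beta> - \<beta>\<bar>"
    by (intro tendsto_intros lim)
  ultimately have "\<bar>u t x - t / 2 * \<beta>\<bar> \<le> sqrt (K * \<bar>\<beta> - \<beta>\<bar>) + norm (u 0) + \<bar>t / 2\<bar> * \<bar>\<beta> - \<beta>\<bar>"
    by (intro LIMSEQ_le_const) auto
  then show ?thesis by (simp add: \<beta>_def)
qed

abbreviation "v \<equiv> profile total_mass"

text \<open>For \<open>\<gamma>\<close> between \<open>\<epsilon>\<close> and \<open>m - \<epsilon>\<close> the initial positions \<open>q \<gamma> 0\<close> lie in a bounded interval, so the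
rescaled positions are uniformly close to \<open>\<gamma>\<close> after a time \<open>T\<close>. The remaining labels carry energy
\<open>\<epsilon>\<close> at either end, which the error absorbs because \<open>F\<close> is monotone.\<close>

lemma uniform_asymptotics:
  assumes \<epsilon>: "0 < \<epsilon>"
  obtains T where "0 < T" "\<And>t x. T \<le> \<bar>t\<bar> \<Longrightarrow> \<bar>2 / t * u t x - v (4 * x / t\<^sup>2)\<bar> \<le> 4 * \<epsilon>"
proof -
  define C where "C = norm (u 0)"
  define m where "m = total_mass"
  define Q where "Q = \<bar>q \<epsilon> 0\<bar> + \<bar>q (m - \<epsilon>) 0\<bar>"
  define T where "T = max 1 ((4 * Q + 4 * C) / \<epsilon> + 1)"
  have C: "0 \<le> C" and Q: "0 \<le> Q" and m: "0 \<le> m" by (auto simp: C_def Q_def m_def total_mass_nonneg)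
  have "\<bar>2 / t * u t x - v (4 * x / t\<^sup>2)\<bar> \<le> 4 * \<epsilon>" if t: "T \<le> \<bar>t\<bar>" for t x
  proof -
    have t1: "1 \<le> \<bar>t\<bar>" "t \<noteq> 0" using t by (auto simp: T_def)
    have big: "4 * Q + 4 * C < \<epsilon> * \<bar>t\<bar>"
    proof -
      have "(4 * Q + 4 * C) / \<epsilon> < \<bar>t\<bar>" using t by (simp add: T_def)
      then show ?thesis using \<epsilon> by (simp add: field_simps)
    qed
    define y where "y = 4 * x / t\<^sup>2"
    have t2: "0 < t\<^sup>2" using t1 by simp
    have near: "\<bar>2 / t * u t x - F t x\<bar> \<le> \<epsilon>"
    proof -
      have "2 / t * u t x - F t x = 2 / t * (u t x - t / 2 * F t x)" using t1 by (simp add: field_simps)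
      then have "\<bar>2 / t * u t x - F t x\<bar> = 2 / \<bar>t\<bar> * \<bar>u t x - t / 2 * F t x\<bar>"
        by (simp only: abs_mult abs_divide abs_numeral)
      also have "\<dots> \<le> 2 / \<bar>t\<bar> * C" unfolding C_def by (intro mult_left_mono u_minus_F_bound) auto
      also have "\<dots> \<le> \<epsilon>" using big C Q t1 by (simp add: field_simps)
      finally show ?thesis .
    qed
    have front: "\<bar>4 * q \<gamma> t / t\<^sup>2 - \<gamma>\<bar> < \<epsilon>" if \<gamma>: "\<epsilon> \<le> \<gamma>" "\<gamma> \<le> m - \<epsilon>" for \<gamma>
    proof -
      have g: "0 < \<gamma>" "\<gamma> < total_mass" using \<gamma> \<epsilon> by (auto simp: m_def)
      have "q \<epsilon> 0 \<le> q \<gamma> 0" "q \<gamma> 0 \<le> q (m - \<epsilon>) 0"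
        using \<gamma> \<epsilon> by (auto intro!: q_mono simp: m_def)
      then have "\<bar>q \<gamma> 0\<bar> \<le> Q" by (auto simp: Q_def)
      moreover have "Q * 1 \<le> Q * \<bar>t\<bar>" using Q t1 by (intro mult_left_mono) auto
      ultimately have qt: "\<bar>q \<gamma> 0\<bar> \<le> Q * \<bar>t\<bar>" by linarith
      have ut: "\<bar>u 0 (q \<gamma> 0) * t\<bar> \<le> C * \<bar>t\<bar>"
        unfolding abs_mult C_def by (intro mult_right_mono u_le_norm) auto
      have "\<bar>4 * q \<gamma> t / t\<^sup>2 - \<gamma>\<bar> * t\<^sup>2 = \<bar>4 * (q \<gamma> 0 + u 0 (q \<gamma> 0) * t)\<bar>"
      proof -
        have "(4 * q \<gamma> t / t\<^sup>2 - \<gamma>) * t\<^sup>2 = 4 * (q \<gamma> 0 + u 0 (q \<gamma> 0) * t)"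
          using t1 unfolding q_eq[OF g, of t] by (simp add: field_simps)
        then show ?thesis by (metis abs_mult abs_power2)
      qed
      also have "\<dots> \<le> (4 * Q + 4 * C) * \<bar>t\<bar>"
        using qt ut by (simp add: algebra_simps abs_le_iff)
      also have "\<dots> < (\<epsilon> * \<bar>t\<bar>) * \<bar>t\<bar>" using big t1 by (intro mult_strict_right_mono) auto
      also have "\<dots> = \<epsilon> * t\<^sup>2" by (simp add: power2_eq_square)
      finally show ?thesis using t2 by simp
    qed
    have v: "v y = max 0 (min y m)" using m by (auto simp: profile_def m_def)
    have F: "0 \<le> F t x" "F t x \<le> m" using F_nonneg F_le_total_mass by (auto simp: m_def)
    have upper: "F t x \<le> v y + 3 * \<epsilon>"
    proof (cases "v y + 2 * \<epsilon> \<le> m - \<epsilon>")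
      case True
      let ?\<gamma> = "v y + 2 * \<epsilon>"
      have y: "y \<le> v y" "0 \<le> v y" using v True \<epsilon> by auto
      then have "\<bar>4 * q ?\<gamma> t / t\<^sup>2 - ?\<gamma>\<bar> < \<epsilon>" using True \<epsilon> by (intro front) auto
      then have "y < 4 * q ?\<gamma> t / t\<^sup>2" using y \<epsilon> by linarith
      then have "x < q ?\<gamma> t" using t2 by (simp add: y_def divide_less_cancel)
      then have "F t x < ?\<gamma>"
        using q_le_iff[of ?\<gamma> t x] y True \<epsilon> by (auto simp: m_def not_le[symmetric])
      then show ?thesis using \<epsilon> by linarith
    qed (use F in linarith)
    have lower: "v y - 3 * \<epsilon> \<le> F t x"
    proof (cases "\<epsilon> \<le> v y - 2 * \<epsilon>")
      case True
      let ?\<gamma> = "v y - 2 * \<epsilon>"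
      have y: "v y \<le> y" "v y \<le> m" using v True \<epsilon> by auto
      then have "\<bar>4 * q ?\<gamma> t / t\<^sup>2 - ?\<gamma>\<bar> < \<epsilon>" using True \<epsilon> by (intro front) auto
      then have "4 * q ?\<gamma> t / t\<^sup>2 < y" using y \<epsilon> by linarith
      then have "q ?\<gamma> t < x" using t2 by (simp add: y_def divide_less_cancel)
      then have "q ?\<gamma> t \<le> x" by (rule less_imp_le)
      then have "?\<gamma> \<le> F t x"
        using q_le_iff[of ?\<gamma> t x] y True \<epsilon> by (auto simp: m_def)
      then show ?thesis using \<epsilon> by linarith
    qed (use F in linarith)
    show ?thesis using near upper lower unfolding y_def by linarith
  qed
  moreover have "0 < T" by (simp add: T_def)
  ultimately show ?thesis using that by blast
qed


lemma eventually_abs_ge: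
  assumes "G \<in> {at_top, at_bot}"
  shows "\<forall>\<^sub>F t::real in G. T \<le> \<bar>t\<bar>"
proof -
  have "\<forall>\<^sub>F t::real in at_top. T \<le> \<bar>t\<bar>"
    using eventually_ge_at_top[of T] by eventually_elim linarith
  moreover have "\<forall>\<^sub>F t::real in at_bot. T \<le> \<bar>t\<bar>"
    using eventually_le_at_bot[of "- T"] by eventually_elim linarith
  ultimately show ?thesis using assms by auto
qed

lemma rescaled_u_tendsto:
  assumes G: "G \<in> {at_top, at_bot}"
  shows "((\<lambda>t. 2 / t * u t (t\<^sup>2 / 4 * x)) \<longlongrightarrow> v x) G"
proof (rule tendstoI)
  fix e :: real assume "0 < e"
  then obtain T where T: "0 < T" "\<And>t x. T \<le> \<bar>t\<bar> \<Longrightarrow> \<bar>2 / t * u t x - v (4 * x / t\<^sup>2)\<bar> \<le> 4 * (e / 8)"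
    using uniform_asymptotics[of "e / 8"] by auto
  have "\<forall>\<^sub>F t in G. T \<le> \<bar>t\<bar>" by (rule eventually_abs_ge[OF G])
  then show "\<forall>\<^sub>F t in G. dist (2 / t * u t (t\<^sup>2 / 4 * x)) (v x) < e"
  proof eventually_elim
    case (elim t)
    then have "t \<noteq> 0" using T(1) by auto
    then have "4 * (t\<^sup>2 / 4 * x) / t\<^sup>2 = x" by (simp add: field_simps)
    then have "\<bar>2 / t * u t (t\<^sup>2 / 4 * x) - v x\<bar> \<le> 4 * (e / 8)"
      using T(2)[OF elim, of "t\<^sup>2 / 4 * x"] by (simp only:)
    then show ?case unfolding dist_real_def using \<open>0 < e\<close> by linarith
  qed
qed

abbreviation "front t \<equiv> total_mass * t\<^sup>2 / 4"

definition self_similar :: "real \<Rightarrow> real \<Rightarrow> real" where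
  "self_similar t x = t / 2 * v (4 * x / t\<^sup>2)"

definition self_similar_deriv :: "real \<Rightarrow> real \<Rightarrow> real" where
  "self_similar_deriv t x = 2 / t * indicator {0..front t} x"

lemma continuous_v: "continuous_on UNIV v"
proof -
  have "v = (\<lambda>y. max 0 (min y total_mass))"
    using total_mass_nonneg by (auto simp: profile_def fun_eq_iff)
  then show ?thesis by (auto intro!: continuous_intros)
qed

lemma self_similar_expansion: "expansion Linfty norm_Linfty (\<lambda>x t. u t x) (\<lambda>x t. self_similar t x) (\<lambda>t. t)"
  unfolding expansion_def
proof (intro ballI conjI)
  fix G :: "real filter" assume G: "G \<in> {at_top, at_bot}"
  have meas [measurable]: "(\<lambda>x. u t x - self_similar t x) \<in> borel_measurable borel" for t
  proof -
    have "continuous_on UNIV (\<lambda>x. v (4 * x / t\<^sup>2))" if "t \<noteq> 0"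
      using that by (intro continuous_on_compose2[OF continuous_v]) (auto intro!: continuous_intros)
    then have "continuous_on UNIV (\<lambda>x. u t x - self_similar t x)"
      unfolding self_similar_def by (cases "t = 0") (auto intro!: continuous_intros continuous_u_space)
    then show ?thesis by (rule borel_measurable_continuous_onI)
  qed
  have sup: "esssup lborel (\<lambda>x. ereal \<bar>u t x - self_similar t x\<bar>) \<le> ereal B"
    if "\<And>x. \<bar>u t x - self_similar t x\<bar> \<le> B" for t B
    using that by (intro esssup_I) auto
  have sup0: "0 \<le> esssup lborel (\<lambda>x. ereal \<bar>u t x - self_similar t x\<bar>)" for t
  proof -
    have "esssup (lborel :: real measure) (\<lambda>_. 0 :: ereal) = 0" by (rule esssup_const) simp
    moreover have "esssup (lborel :: real measure) (\<lambda>_. 0 :: ereal) \<le> esssup lborel (\<lambda>x. ereal \<bar>u t x - self_similar t x\<bar>)"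
      by (rule esssup_mono) auto
    ultimately show ?thesis by simp
  qed
  have *: "\<forall>\<^sub>F t in G. t \<noteq> 0 \<and> (\<forall>x. \<bar>u t x - self_similar t x\<bar> \<le> e * \<bar>t\<bar>)" if e: "0 < e" for e
  proof -
    obtain T where T: "0 < T" "\<And>t x. T \<le> \<bar>t\<bar> \<Longrightarrow> \<bar>2 / t * u t x - v (4 * x / t\<^sup>2)\<bar> \<le> 4 * (e / 2)"
      using uniform_asymptotics[of "e / 2"] e by auto
    have "\<forall>\<^sub>F t in G. T \<le> \<bar>t\<bar>" by (rule eventually_abs_ge[OF G])
    then show ?thesis
    proof eventually_elim
      case (elim t)
      have t: "t \<noteq> 0" using T(1) elim by auto
      have "\<bar>u t x - self_similar t x\<bar> \<le> e * \<bar>t\<bar>" for x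
      proof -
        have "u t x - self_similar t x = t / 2 * (2 / t * u t x - v (4 * x / t\<^sup>2))"
          unfolding self_similar_def using t by (simp add: field_simps)
        then have "\<bar>u t x - self_similar t x\<bar> = \<bar>t\<bar> / 2 * \<bar>2 / t * u t x - v (4 * x / t\<^sup>2)\<bar>"
          by (simp only: abs_mult abs_divide abs_numeral)
        also have "\<dots> \<le> \<bar>t\<bar> / 2 * (4 * (e / 2))" by (intro mult_left_mono T elim) auto
        finally show ?thesis by (simp add: mult.commute)
      qed
      then show ?case using t by blast
    qed
  qed
  have "\<forall>\<^sub>F t in G. t \<noteq> 0 \<and> (\<forall>x. \<bar>u t x - self_similar t x\<bar> \<le> 1 * \<bar>t\<bar>)"
    by (rule *) simp
  then show "\<forall>\<^sub>F t in G. (\<lambda>x. u t x - self_similar t x) \<in> Linfty"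
  proof eventually_elim
    case (elim t)
    then have "esssup lborel (\<lambda>x. ereal \<bar>u t x - self_similar t x\<bar>) \<le> ereal (1 * \<bar>t\<bar>)" by (intro sup) blast
    also have "\<dots> < \<infinity>" by simp
    finally show ?case using meas by (simp add: Linfty_def)
  qed
  show "((\<lambda>t. norm_Linfty (\<lambda>x. u t x - self_similar t x) / \<bar>t\<bar>) \<longlongrightarrow> 0) G"
  proof (rule tendstoI)
    fix e :: real assume "0 < e"
    then have "\<forall>\<^sub>F t in G. t \<noteq> 0 \<and> (\<forall>x. \<bar>u t x - self_similar t x\<bar> \<le> e / 2 * \<bar>t\<bar>)" by (intro *) simp
    then show "\<forall>\<^sub>F t in G. dist (norm_Linfty (\<lambda>x. u t x - self_similar t x) / \<bar>t\<bar>) 0 < e"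
    proof eventually_elim
      case (elim t)
      have le: "esssup lborel (\<lambda>x. ereal \<bar>u t x - self_similar t x\<bar>) \<le> ereal (e / 2 * \<bar>t\<bar>)"
        using elim by (intro sup) blast
      have "0 \<le> norm_Linfty (\<lambda>x. u t x - self_similar t x)"
        unfolding norm_Linfty_def using sup0 by (rule real_of_ereal_pos)
      moreover have "norm_Linfty (\<lambda>x. u t x - self_similar t x) \<le> e / 2 * \<bar>t\<bar>"
        unfolding norm_Linfty_def using le sup0[of t]
        by (cases "esssup lborel (\<lambda>x. ereal \<bar>u t x - self_similar t x\<bar>)") auto
      moreover have "0 < \<bar>t\<bar>" using elim by simp
      then have "e / 2 * \<bar>t\<bar> < e * \<bar>t\<bar>" using \<open>0 < e\<close> by simp
      ultimately have "norm_Linfty (\<lambda>x. u t x - self_similar t x) < e * \<bar>t\<bar>" by linarith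
      then show ?case
        using \<open>0 \<le> norm_Linfty (\<lambda>x. u t x - self_similar t x)\<close> \<open>0 < \<bar>t\<bar>\<close>
        by (simp add: divide_less_eq)
    qed
  qed
qed

lemma primitive_self_similar:
  assumes t: "t \<noteq> 0"
  shows "primitive (self_similar t) (self_similar_deriv t)"
  unfolding primitive_def
proof (intro conjI allI impI)
  have [measurable]: "self_similar_deriv t \<in> borel_measurable borel"
    unfolding self_similar_deriv_def[abs_def] by measurable
  define M where "M = front t"
  have M: "0 \<le> M" by (simp add: M_def total_mass_nonneg)
  have int: "integrable lborel (self_similar_deriv t)"
    unfolding self_similar_deriv_def[abs_def] by (intro integrable_mult_right integrable_indicator_Icc)
  show "self_similar_deriv t \<in> L1_loc"
    unfolding L1_loc_def set_integrable_def
    using integrable_mult_indicator[OF _ int] by (auto simp: compact_imp_closed)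
  fix a b :: real assume ab: "a \<le> b"
  have ss: "self_similar t x = 2 / t * max 0 (min x M)" for x
  proof -
    have t2: "0 < t\<^sup>2" using t by simp
    have "v (4 * x / t\<^sup>2) = 4 / t\<^sup>2 * max 0 (min x M)"
    proof -
      consider "x < 0" | "0 \<le> x" "x \<le> M" | "M < x" "0 \<le> x" by linarith
      then show ?thesis
      proof cases
        case 1
        then have "4 * x / t\<^sup>2 < 0" using t2 by (simp add: divide_neg_pos)
        then show ?thesis using 1 M by (simp add: profile_def)
      next
        case 2
        then have "\<not> 4 * x / t\<^sup>2 < 0" "4 * x / t\<^sup>2 \<le> total_mass" using t2 by (auto simp: M_def field_simps not_less)
        then show ?thesis using 2 by (simp add: profile_def)
      next
        case 3
        then have "\<not> 4 * x / t\<^sup>2 < 0" "\<not> 4 * x / t\<^sup>2 \<le> total_mass" using t2 by (auto simp: M_def field_simps not_less)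
        then show ?thesis using 3 M t2 by (simp add: profile_def M_def)
      qed
    qed
    then show ?thesis unfolding self_similar_def using t by (simp add: power2_eq_square field_simps)
  qed
  have "(LINT x:{a..b}|lborel. self_similar_deriv t x) = 2 / t * (LINT x|lborel. indicator ({a..b} \<inter> {0..M}) x)"
    unfolding set_lebesgue_integral_def self_similar_deriv_def M_def[symmetric]
    by (subst Bochner_Integration.integral_mult_right_zero[symmetric])
       (intro Bochner_Integration.integral_cong refl, auto simp: indicator_def)
  also have "(LINT x|lborel. indicator ({a..b} \<inter> {0..M}) x) = max 0 (min b M) - max 0 (min a M)"
  proof -
    have "measure lborel {max a 0..min b M} = max 0 (min b M) - max 0 (min a M)"
      using ab M by (cases "max a 0 \<le> min b M") (auto simp: max_def min_def split: if_splits)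
    then show ?thesis by (simp add: Int_atLeastAtMost)
  qed
  finally show "self_similar t b - self_similar t a = (LINT x:{a..b}|lborel. self_similar_deriv t x)"
    unfolding ss by (simp add: right_diff_distrib)
qed

section \<open>Asymptotics of the energy\<close>

lemma energy_plus_singular_mass: "(LINT x|lborel. (ux t x)\<^sup>2) + measure (sing_part (\<mu> t)) UNIV = total_mass"
  using energy_integral(2)[of UNIV t] mass_conserved[of t] by (simp add: total_mass_def set_lebesgue_integral_def)

text \<open>Weak derivatives are chosen representatives, so the derivative of the self-similar profile is
known only almost everywhere. The right-hand side depends on \<open>u\<close> only through its values at the two
ends of the support.\<close>

lemma energy_distance:
  assumes t: "t \<noteq> 0"
  defines "J \<equiv> 2 / t * (u t (front t) - u t 0)"
  shows "integrable lborel (\<lambda>x. (ux t x - weak_deriv (self_similar t) x)\<^sup>2)"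
    and "(LINT x|lborel. (ux t x - weak_deriv (self_similar t) x)\<^sup>2) + measure (sing_part (\<mu> t)) UNIV
      = 2 * (total_mass - J)"
    and "weak_deriv (self_similar t) \<in> borel_measurable borel"
proof -
  note p = primitive_self_similar[OF t]
  define w where "w = weak_deriv (self_similar t)"
  have "\<exists>g. has_weak_deriv 1 (self_similar t) g" using primitive_has_weak_deriv[OF p] by blast
  then have w: "has_weak_deriv 1 (self_similar t) w" unfolding w_def weak_deriv_def by (rule someI_ex)
  then have wp: "primitive (self_similar t) w"
    by (rule has_weak_deriv_primitive) (rule primitive_continuous[OF p])
  then show wm: "weak_deriv (self_similar t) \<in> borel_measurable borel"
    by (simp add: w_def primitive_def L1_loc_def)
  let ?p = "self_similar_deriv t"
  have [measurable]: "w \<in> borel_measurable borel" using wm by (simp add: w_def)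
  have [measurable]: "?p \<in> borel_measurable borel"
    unfolding self_similar_deriv_def[abs_def] by measurable
  have ae: "AE x in lborel. w x = ?p x" by (rule primitive_unique[OF wp p])
  have M: "0 \<le> front t" by (simp add: total_mass_nonneg)
  have i1: "integrable lborel (\<lambda>x. (ux t x)\<^sup>2)"
    using energy_integral(1)[of UNIV t] by (simp add: set_integrable_def)
  have p2: "(\<lambda>x. (?p x)\<^sup>2) = (\<lambda>x. 4 / t\<^sup>2 * indicator {0..front t} x)"
    by (auto simp: self_similar_deriv_def power_mult_distrib power_divide indicator_def)
  have i2: "integrable lborel (\<lambda>x. (?p x)\<^sup>2)"
    unfolding p2 by (intro integrable_mult_right integrable_indicator_Icc)
  have l2: "(LINT x|lborel. (?p x)\<^sup>2) = total_mass"
    unfolding p2 using M t by simp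
  have up: "(\<lambda>x. ux t x * ?p x) = (\<lambda>x. 2 / t * (indicator {0..front t} x *\<^sub>R ux t x))"
    by (auto simp: self_similar_deriv_def)
  have i3: "integrable lborel (\<lambda>x. ux t x * ?p x)"
    unfolding up using L1_loc_integrable_Icc[of "ux t" 0 "front t"] primitive_u[of t]
    by (intro integrable_mult_right) (simp add: primitive_def set_integrable_def)
  have l3: "(LINT x|lborel. ux t x * ?p x) = J"
  proof -
    have "(LINT x|lborel. ux t x * ?p x) = 2 / t * (LINT x:{0..front t}|lborel. ux t x)"
      unfolding up set_lebesgue_integral_def by simp
    also have "(LINT x:{0..front t}|lborel. ux t x) = u t (front t) - u t 0"
      using primitive_u[of t] M by (simp add: primitive_def)
    finally show ?thesis by (simp add: J_def)
  qed
  have exp: "(ux t x - ?p x)\<^sup>2 = (ux t x)\<^sup>2 - 2 * (ux t x * ?p x) + (?p x)\<^sup>2" for x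
    by (simp add: power2_diff)
  have ip: "integrable lborel (\<lambda>x. (ux t x - ?p x)\<^sup>2)"
    unfolding exp using i1 i2 i3 by simp
  have lp: "(LINT x|lborel. (ux t x - ?p x)\<^sup>2) = (LINT x|lborel. (ux t x)\<^sup>2) - 2 * J + total_mass"
    unfolding exp using i1 i2 i3 by (simp add: l2 l3)
  have ae2: "AE x in lborel. (ux t x - w x)\<^sup>2 = (ux t x - ?p x)\<^sup>2"
    using ae by eventually_elim simp
  show "integrable lborel (\<lambda>x. (ux t x - weak_deriv (self_similar t) x)\<^sup>2)"
    unfolding w_def[symmetric] using ip by (subst integrable_cong_AE[OF _ _ ae2]) auto
  have "(LINT x|lborel. (ux t x - w x)\<^sup>2) = (LINT x|lborel. (ux t x - ?p x)\<^sup>2)"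
    by (rule integral_cong_AE[OF _ _ ae2]) auto
  then show "(LINT x|lborel. (ux t x - weak_deriv (self_similar t) x)\<^sup>2) + measure (sing_part (\<mu> t)) UNIV
      = 2 * (total_mass - J)"
    unfolding w_def[symmetric] lp using energy_plus_singular_mass[of t] by simp
qed

lemma energy_distance_tendsto:
  assumes G: "G \<in> {at_top, at_bot}"
  shows "((\<lambda>t. 2 * (total_mass - 2 / t * (u t (front t) - u t 0))) \<longlongrightarrow> 0) G"
proof -
  have "((\<lambda>t. 2 * (total_mass - (2 / t * u t (t\<^sup>2 / 4 * total_mass) - 2 / t * u t (t\<^sup>2 / 4 * 0))))
      \<longlongrightarrow> 2 * (total_mass - (v total_mass - v 0))) G"
    by (intro tendsto_intros rescaled_u_tendsto G)
  moreover have "v total_mass = total_mass" "v 0 = 0"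
    using total_mass_nonneg by (auto simp: profile_def)
  moreover have "(\<lambda>t. 2 * (total_mass - (2 / t * u t (t\<^sup>2 / 4 * total_mass) - 2 / t * u t (t\<^sup>2 / 4 * 0))))
      = (\<lambda>t. 2 * (total_mass - 2 / t * (u t (front t) - u t 0)))"
    by (simp add: right_diff_distrib mult.commute)
  ultimately show ?thesis by simp
qed

lemma eventually_nonzero: "G \<in> {at_top, at_bot} \<Longrightarrow> \<forall>\<^sub>F t::real in G. t \<noteq> 0"
  using eventually_abs_ge[of G 1] by (auto elim!: eventually_mono)

lemma sing_part_tendsto:
  assumes G: "G \<in> {at_top, at_bot}"
  shows "((\<lambda>t. measure (sing_part (\<mu> t)) UNIV) \<longlongrightarrow> 0) G"
proof (rule Lim_null_comparison[OF _ energy_distance_tendsto[OF G]])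
  show "\<forall>\<^sub>F t in G. norm (measure (sing_part (\<mu> t)) UNIV) \<le> 2 * (total_mass - 2 / t * (u t (front t) - u t 0))"
    using eventually_nonzero[OF G]
  proof eventually_elim
    case (elim t)
    have "0 \<le> (LINT x|lborel. (ux t x - weak_deriv (self_similar t) x)\<^sup>2)" by simp
    with energy_distance(2)[OF elim] show ?case
      unfolding real_norm_def abs_of_nonneg[OF measure_nonneg] by linarith
  qed
qed

lemma self_similar_expansion_deriv:
  "expansion L2 norm_L2 (\<lambda>x t. ux t x) (\<lambda>x t. weak_deriv (self_similar t) x) (\<lambda>t. 1)"
  unfolding expansion_def
proof (intro ballI conjI)
  fix G :: "real filter" assume G: "G \<in> {at_top, at_bot}"
  show "\<forall>\<^sub>F t in G. (\<lambda>x. ux t x - weak_deriv (self_similar t) x) \<in> L2"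
    using eventually_nonzero[OF G]
  proof eventually_elim
    case (elim t)
    then show ?case using energy_distance(1,3)[OF elim] by (simp add: L2_def)
  qed
  have "((\<lambda>t. sqrt (2 * (total_mass - 2 / t * (u t (front t) - u t 0)))) \<longlongrightarrow> 0) G"
    using tendsto_real_sqrt[OF energy_distance_tendsto[OF G]] by simp
  then show "((\<lambda>t. norm_L2 (\<lambda>x. ux t x - weak_deriv (self_similar t) x) / \<bar>1\<bar>) \<longlongrightarrow> 0) G"
  proof (rule Lim_null_comparison[rotated])
    show "\<forall>\<^sub>F t in G. norm (norm_L2 (\<lambda>x. ux t x - weak_deriv (self_similar t) x) / \<bar>1\<bar>)
        \<le> sqrt (2 * (total_mass - 2 / t * (u t (front t) - u t 0)))"
      using eventually_nonzero[OF G]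
    proof eventually_elim
      case (elim t)
      have "(LINT x|lborel. (ux t x - weak_deriv (self_similar t) x)\<^sup>2) \<le> 2 * (total_mass - 2 / t * (u t (front t) - u t 0))"
        using energy_distance(2)[OF elim] measure_nonneg[of "sing_part (\<mu> t)" UNIV] by linarith
      moreover have "0 \<le> (LINT x|lborel. (ux t x - weak_deriv (self_similar t) x)\<^sup>2)" by simp
      ultimately show ?case by (simp add: norm_L2_def)
    qed
  qed
qed

end

section \<open>The asymptotic expansions\<close>

theorem theorem1p2:
  fixes ubar :: "real \<Rightarrow>\<^sub>C real" and \<mu>bar :: "real measure"
    and u :: "real \<Rightarrow> (real \<Rightarrow>\<^sub>C real)" and \<mu> :: "real \<Rightarrow> real measure"
    and v :: "real \<Rightarrow> real"
  defines "v \<equiv> profile (measure \<mu>bar UNIV)"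
  assumes "(ubar, \<mu>bar) \<in> \<D>"
    and "conservative_solution ubar \<mu>bar u \<mu>"
  shows "(\<forall>x. ((\<lambda>t. 2 / t * u t (t\<^sup>2 / 4 * x)) \<longlongrightarrow> v x) at_top \<and>
              ((\<lambda>t. 2 / t * u t (t\<^sup>2 / 4 * x)) \<longlongrightarrow> v x) at_bot)
    \<and> expansion Linfty norm_Linfty
        (\<lambda>x t. u t x) (\<lambda>x t. t / 2 * v (4 * x / t\<^sup>2)) (\<lambda>t. t)
    \<and> expansion L2 norm_L2
        (\<lambda>x t. weak_deriv (u t) x)
        (\<lambda>x t. weak_deriv (\<lambda>y. t / 2 * v (4 * y / t\<^sup>2)) x) (\<lambda>t. 1)
    \<and> ((\<lambda>t. measure (sing_part (\<mu> t)) UNIV) \<longlongrightarrow> 0) at_top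
    \<and> ((\<lambda>t. measure (sing_part (\<mu> t)) UNIV) \<longlongrightarrow> 0) at_bot"
proof -
  have init: "u 0 = ubar" "\<mu> 0 = \<mu>bar"
    using assms(3) by (auto simp: conservative_solution_def)
  interpret hs_solution u \<mu>
    by unfold_locales (simp add: init assms(3))
  have v: "v = profile total_mass" by (simp add: v_def total_mass_def init)
  show ?thesis
    using rescaled_u_tendsto[of at_top] rescaled_u_tendsto[of at_bot] self_similar_expansion
      self_similar_expansion_deriv sing_part_tendsto[of at_top] sing_part_tendsto[of at_bot]
    unfolding v self_similar_def[abs_def] by simp
qed

end
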